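(* Assume that there exist $\kappa>0$ and $s\ge0$ such that the continuously differentiable maps $\mathcal M_i,\mathcal H_i$ satisfy $|\mathcal M_i(x)|$, $|\mathcal M_i'(x)|$, $|\mathcal H_i(x)|$, $|\mathcal H_i'(x)|\le\kappa(1+|x|^s)$ for all $i=1,\ldots,k$ and all $x\in\mathbf R^m$. Let $X_{0:k|k}^{j,n,N_j}$ be the ensemble members and $\bar X_{0:k|k}^{j,N_j}$ the sample means generated by the LM-EnKS algorithm with ensemble sizes $N_1,N_2,\ldots\ge2$, and let $U_{0:k|k}^{j,n}$ be the reference ensemble members, all defined in the context. Then for every iteration $j\geq 1$ and every fixed member index $n$ (with $N_j\ge n$), $$X_{0:k|k}^{j,n,N_j}\to U_{0:k|k}^{j,n}\quad\text{and}\quad \bar X_{0:k|k}^{j,N_j}\to E\left(U_{0:k|k}^{j,1}\right)\qquad\text{as }\min\{N_1,\ldots,N_j\}\to\infty,$$ in $L^p$ for all $1\le p<\infty$.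
   Context: Norms: $|\cdot|$ is the Euclidean norm of a vector or the spectral norm of a matrix; $\|X\|_p=E(|X|^p)^{1/p}$; convergence in $L^p$ is convergence in $\|\cdot\|_p$. Data: integers $k,m,d_i\ge1$; continuously differentiable maps $\mathcal M_i:\mathbf R^m\to\mathbf R^m$, $\mathcal H_i:\mathbf R^m\to\mathbf R^{d_i}$ with Jacobians $\mathcal M_i',\mathcal H_i'$; fixed vectors $x_{\mathrm b},\mu_i\in\mathbf R^m$, $y_i\in\mathbf R^{d_i}$; covariance matrices $B,Q_i\in\mathbf R^{m\times m}$ (symmetric positive semidefinite) and $R_i\in\mathbf R^{d_i\times d_i}$ (symmetric positive definite), $i=1,\ldots,k$; a constant $\gamma>0$; a deterministic initial approximation $x_{0:k}^0=(x_0^0,\ldots,x_k^0)$ with $x_i^0\in\mathbf R^m$. Put $$\tilde{\mathcal H}_i(x)=\begin{bmatrix}\mathcal H_i(x)\\ x\end{bmatrix},\quad \tilde{\mathcal H}_i'(x)=\begin{bmatrix}\mathcal H_i'(x)\\ I_m\end{bmatrix},\quad \tilde R_i=\begin{bmatrix}R_i&0\\ 0&\frac1\gamma I_m\end{bmatrix}.$$ Random inputs: for $j,n=1,2,\ldots$ and $i=1,\dots,k$, mutually independent random vectors $X_{0|0}^{j,n}\sim N(x_{\mathrm b},B)$, $V_i^{j,n}\sim N(0,Q_i)$, $\tilde W_i^{j,n}\sim N(0,\tilde R_i)$. LM-EnKS algorithm with ensemble sizes $N_1,N_2,\ldots\ge2$: set $\bar X_{0:k|k}^{0,N_0}=x_{0:k}^0$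 (formal notation; there is no ensemble for $j=0$). For $j=1,2,\ldots$ let $z_i=\bar X_{i|k}^{j-1,N_{j-1}}$ denote the $i$-th block of $\bar X_{0:k|k}^{j-1,N_{j-1}}$. Start from $X_{0:0|0}^{j,n}=X_{0|0}^{j,n}$, $n=1,\ldots,N_j$. For $i=1,\ldots,k$: with $X_{i-1|i-1}^{j,n}$ the last block of $X_{0:i-1|i-1}^{j,n}$, set $$X_{i|i-1}^{j,n}=\mathcal M_i'(z_{i-1})(X_{i-1|i-1}^{j,n}-z_{i-1})+\mathcal M_i(z_{i-1})+\mu_i+V_i^{j,n};$$ let $X_{0:i|i-1}^{j,n}$ be $X_{0:i-1|i-1}^{j,n}$ with the block $X_{i|i-1}^{j,n}$ appended; let $\bar X_{0:i|i-1}^{j},\bar X_{i|i-1}^{j}$ be the sample means over $n=1,\ldots,N_j$; put $$P_{0:i,i}=\frac1{N_j-1}\sum_{n=1}^{N_j}(X_{0:i|i-1}^{j,n}-\bar X_{0:i|i-1}^{j})(X_{i|i-1}^{j,n}-\bar X_{i|i-1}^{j})^{\mathrm T},$$ let $P_{i,i}$ be its last block row, $G_i=\tilde{\mathcal H}_i'(z_i)$, $\tilde y_i=\begin{bmatrix}y_i\\ z_i\end{bmatrix}$, and set $$X_{0:i|i}^{j,n}=X_{0:i|i-1}^{j,n}+P_{0:i,i}G_i^{\mathrm T}(G_iP_{i,i}G_i^{\mathrm T}+\tilde R_i)^{-1}\left(\tilde y_i-\tilde W_i^{j,n}-\tilde{\mathcal H}_i(z_i)-G_i(X_{i|i-1}^{j,n}-z_i)\right).$$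 The next iterate is $\bar X_{0:k|k}^{j,N_j}=\frac1{N_j}\sum_{n=1}^{N_j}X_{0:k|k}^{j,n}$. One writes $X_{0:k|k}^{j,n,N_j}$ for $X_{0:k|k}^{j,n}$ to emphasize the ensemble size (it also depends on $N_1,\ldots,N_{j-1}$). Reference ensemble: for $j=0$, $U_{0:k|k}^{0,n}=x_{0:k}^0$. For $j\ge1$ let $u_i=E(U_{i|k}^{j-1,1})$ be the $i$-th block of $E(U_{0:k|k}^{j-1,1})$. Start from $U_{0:0|0}^{j,n}=X_{0|0}^{j,n}$. For $i=1,\ldots,k$: with $U_{i-1|i-1}^{j,n}$ the last block of $U_{0:i-1|i-1}^{j,n}$, set $U_{i|i-1}^{j,n}=\mathcal M_i'(u_{i-1})(U_{i-1|i-1}^{j,n}-u_{i-1})+\mathcal M_i(u_{i-1})+\mu_i+V_i^{j,n}$, append it to get $U_{0:i|i-1}^{j,n}$, and with $C_{0:i,i}=\operatorname{Cov}(U_{0:i|i-1}^{j,1},U_{i|i-1}^{j,1})$, $C_{i,i}=\operatorname{Cov}(U_{i|i-1}^{j,1})$, $L_i=\tilde{\mathcal H}_i'(u_i)$, $\hat y_i=\begin{bmatrix}y_i\\ u_i\end{bmatrix}$, $$U_{0:i|i}^{j,n}=U_{0:i|i-1}^{j,n}+C_{0:i,i}L_i^{\mathrm T}(L_iC_{i,i}L_i^{\mathrm T}+\tilde R_i)^{-1}\left(\hat y_i-\tilde W_i^{j,n}-\tilde{\mathcal H}_i(u_i)-L_i(U_{i|i-1}^{j,n}-u_i)\right).$$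 *)

theory Defs
  imports
    "HOL-Probability.Probability"
    "Jordan_Normal_Form.Matrix"
    "Jordan_Normal_Form.Gauss_Jordan_Elimination"
begin

unbundle no vec_syntax
unbundle no inner_syntax

text \<open>
  The observation dimension varies with the time index and composite states over times 0 to i have
  i + 1 blocks, so dimensions are natural numbers here: vectors and matrices are those of
  Jordan_Normal_Form, and a point of Euclidean n-space is an element of \<^term>\<open>carrier_vec n\<close>.
\<close>

type_synonym rvec = "real Matrix.vec"
type_synonym rmat = "real Matrix.mat"


section \<open>Norms, differentiability, matrices\<close>

definition enorm :: "rvec \<Rightarrow> real" where
  "enorm v = sqrt (v \<bullet> v)"

definition spectral_norm :: "rmat \<Rightarrow> real" where
  "spectral_norm A = (SUP v \<in> {v \<in> carrier_vec (dim_col A). enorm v \<le> 1}. enorm (A *\<^sub>v v))"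

text \<open>\<open>J x\<close> is the Jacobian matrix, i.e. the matrix of the Frechet derivative, of \<open>f\<close> at \<open>x\<close>.\<close>

definition has_jacobian :: "nat \<Rightarrow> nat \<Rightarrow> (rvec \<Rightarrow> rvec) \<Rightarrow> (rvec \<Rightarrow> rmat) \<Rightarrow> bool" where
  "has_jacobian p q f J \<longleftrightarrow>
     f \<in> carrier_vec p \<rightarrow> carrier_vec q \<and>
     J \<in> carrier_vec p \<rightarrow> carrier_mat q p \<and>
     (\<forall>x\<in>carrier_vec p. \<forall>\<epsilon>>0. \<exists>\<delta>>0. \<forall>h\<in>carrier_vec p. enorm h < \<delta> \<longrightarrow>
        enorm (f (x + h) - f x - J x *\<^sub>v h) \<le> \<epsilon> * enorm h)"

definition cont_diff :: "nat \<Rightarrow> nat \<Rightarrow> (rvec \<Rightarrow> rvec) \<Rightarrow> (rvec \<Rightarrow> rmat) \<Rightarrow> bool" where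
  "cont_diff p q f J \<longleftrightarrow>
     has_jacobian p q f J \<and>
     (\<forall>x\<in>carrier_vec p. \<forall>\<epsilon>>0. \<exists>\<delta>>0. \<forall>x'\<in>carrier_vec p. enorm (x' - x) < \<delta> \<longrightarrow>
        spectral_norm (J x' - J x) < \<epsilon>)"

definition sym_psd :: "nat \<Rightarrow> rmat \<Rightarrow> bool" where
  "sym_psd n A \<longleftrightarrow> A \<in> carrier_mat n n \<and> A\<^sup>T = A \<and> (\<forall>v\<in>carrier_vec n. 0 \<le> v \<bullet> (A *\<^sub>v v))"

definition sym_pd :: "nat \<Rightarrow> rmat \<Rightarrow> bool" where
  "sym_pd n A \<longleftrightarrow> A \<in> carrier_mat n n \<and> A\<^sup>T = A \<and>
     (\<forall>v\<in>carrier_vec n. v \<noteq> 0\<^sub>v n \<longrightarrow> 0 < v \<bullet> (A *\<^sub>v v))"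

text \<open>Meaningful for invertible square matrices only.\<close>

definition minv :: "rmat \<Rightarrow> rmat" where
  "minv A = the (mat_inverse A)"

text \<open>Real powers of nonnegative numbers with \<open>0\<^sup>0 = 1\<close>, whereas \<^term>\<open>(0::real) powr 0 = 0\<close>.\<close>

definition rpow :: "real \<Rightarrow> real \<Rightarrow> real" where
  "rpow t s = (if s = 0 then 1 else t powr s)"

text \<open>A composite vector consists of consecutive blocks of length \<open>m\<close>, numbered from 0.\<close>

definition block :: "nat \<Rightarrow> rvec \<Rightarrow> nat \<Rightarrow> rvec" where
  "block m v i = Matrix.vec m (\<lambda>a. v $ (i * m + a))"

definition block_row :: "nat \<Rightarrow> rmat \<Rightarrow> nat \<Rightarrow> rmat" where
  "block_row m C i = Matrix.mat m (dim_col C) (\<lambda>(a, b). C $$ (i * m + a, b))"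


section \<open>Random vectors\<close>

text \<open>The Borel sigma-algebra of Euclidean n-space, generated by the coordinate half-spaces.\<close>

definition borel_vec :: "nat \<Rightarrow> rvec measure" where
  "borel_vec n = sigma (carrier_vec n) {{v \<in> carrier_vec n. v $ a \<le> c} | a c. a < n}"

definition mean_vec :: "'w measure \<Rightarrow> nat \<Rightarrow> ('w \<Rightarrow> rvec) \<Rightarrow> rvec" where
  "mean_vec \<Omega> n X = Matrix.vec n (\<lambda>a. \<integral>\<omega>. X \<omega> $ a \<partial>\<Omega>)"

definition cov_mat ::
  "'w measure \<Rightarrow> nat \<Rightarrow> nat \<Rightarrow> ('w \<Rightarrow> rvec) \<Rightarrow> ('w \<Rightarrow> rvec) \<Rightarrow> rmat" where
  "cov_mat \<Omega> p q X Y = Matrix.mat p q (\<lambda>(a, b).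
     \<integral>\<omega>. (X \<omega> $ a - mean_vec \<Omega> p X $ a) * (Y \<omega> $ b - mean_vec \<Omega> q Y $ b) \<partial>\<Omega>)"

text \<open>
  The possibly degenerate multivariate normal law: every linear form in \<open>X\<close> is univariate normal,
  where the normal law of variance zero is the point mass at the mean.
\<close>

definition normal_vec :: "'w measure \<Rightarrow> nat \<Rightarrow> ('w \<Rightarrow> rvec) \<Rightarrow> rvec \<Rightarrow> rmat \<Rightarrow> bool" where
  "normal_vec \<Omega> n X \<mu> \<Sigma> \<longleftrightarrow>
     X \<in> measurable \<Omega> (borel_vec n) \<and>
     (\<forall>a\<in>carrier_vec n.
        if a \<bullet> (\<Sigma> *\<^sub>v a) = 0 then (AE \<omega> in \<Omega>. a \<bullet> X \<omega> = a \<bullet> \<mu>)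
        else distributed \<Omega> lborel (\<lambda>\<omega>. a \<bullet> X \<omega>)
               (normal_density (a \<bullet> \<mu>) (sqrt (a \<bullet> (\<Sigma> *\<^sub>v a)))))"

definition in_Lp :: "'w measure \<Rightarrow> real \<Rightarrow> nat \<Rightarrow> ('w \<Rightarrow> rvec) \<Rightarrow> bool" where
  "in_Lp \<Omega> p n X \<longleftrightarrow>
     X \<in> measurable \<Omega> (borel_vec n) \<and> integrable \<Omega> (\<lambda>\<omega>. enorm (X \<omega>) powr p)"

definition Lp_norm :: "'w measure \<Rightarrow> real \<Rightarrow> ('w \<Rightarrow> rvec) \<Rightarrow> real" where
  "Lp_norm \<Omega> p X = (\<integral>\<omega>. enorm (X \<omega>) powr p \<partial>\<Omega>) powr (1 / p)"

text \<open>
  Membership in \<open>L\<^sup>p\<close> is demanded explicitly, since the Bochner integral of a function that is not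
  integrable is 0.
\<close>

definition Lp_tendsto ::
  "'w measure \<Rightarrow> real \<Rightarrow> nat \<Rightarrow> ('a \<Rightarrow> 'w \<Rightarrow> rvec) \<Rightarrow> ('w \<Rightarrow> rvec) \<Rightarrow> 'a filter \<Rightarrow> bool" where
  "Lp_tendsto \<Omega> p n X L F \<longleftrightarrow>
     (\<forall>\<^sub>F N in F. in_Lp \<Omega> p n (X N)) \<and> in_Lp \<Omega> p n L \<and>
     ((\<lambda>N. Lp_norm \<Omega> p (\<lambda>\<omega>. X N \<omega> - L \<omega>)) \<longlongrightarrow> 0) F"

definition sample_mean :: "nat \<Rightarrow> nat \<Rightarrow> (nat \<Rightarrow> rvec) \<Rightarrow> rvec" where
  "sample_mean N p X = Matrix.vec p (\<lambda>a. (\<Sum>n=1..N. X n $ a) / real N)"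

definition sample_cov :: "nat \<Rightarrow> nat \<Rightarrow> nat \<Rightarrow> (nat \<Rightarrow> rvec) \<Rightarrow> (nat \<Rightarrow> rvec) \<Rightarrow> rmat" where
  "sample_cov N p q X Y = Matrix.mat p q (\<lambda>(a, b).
     (\<Sum>n=1..N. (X n $ a - sample_mean N p X $ a) * (Y n $ b - sample_mean N q Y $ b))
       / (real N - 1))"


section \<open>Problem data and random inputs\<close>

text \<open>
  The fields are, in this order, $k$, $m$, $d_i$, $M_i$, $M_i'$, $H_i$, $H_i'$, $x_b$,
  $B$, $\mu_i$, $Q_i$, $y_i$, $R_i$, $\gamma$ and $x^0_{0:k}$, the last one as a single composite
  vector with $k+1$ blocks. Only time indices 1 to $k$ of the indexed fields matter.
\<close>

record lm_data =
  steps :: nat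
  sdim :: nat
  odim :: "nat \<Rightarrow> nat"
  evol :: "nat \<Rightarrow> rvec \<Rightarrow> rvec"
  evol_jac :: "nat \<Rightarrow> rvec \<Rightarrow> rmat"
  obs :: "nat \<Rightarrow> rvec \<Rightarrow> rvec"
  obs_jac :: "nat \<Rightarrow> rvec \<Rightarrow> rmat"
  bg_mean :: rvec
  bg_cov :: rmat
  forcing :: "nat \<Rightarrow> rvec"
  evol_cov :: "nat \<Rightarrow> rmat"
  obs_val :: "nat \<Rightarrow> rvec"
  obs_cov :: "nat \<Rightarrow> rmat"
  reg :: real
  start :: rvec

definition valid_data :: "lm_data \<Rightarrow> bool" where
  "valid_data D \<longleftrightarrow>
     1 \<le> steps D \<and> 1 \<le> sdim D \<and> 0 < reg D \<and>
     bg_mean D \<in> carrier_vec (sdim D) \<and> sym_psd (sdim D) (bg_cov D) \<and>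
     start D \<in> carrier_vec (Suc (steps D) * sdim D) \<and>
     (\<forall>i\<in>{1..steps D}.
        1 \<le> odim D i \<and>
        cont_diff (sdim D) (sdim D) (evol D i) (evol_jac D i) \<and>
        cont_diff (sdim D) (odim D i) (obs D i) (obs_jac D i) \<and>
        forcing D i \<in> carrier_vec (sdim D) \<and> sym_psd (sdim D) (evol_cov D i) \<and>
        obs_val D i \<in> carrier_vec (odim D i) \<and> sym_pd (odim D i) (obs_cov D i))"

definition aug_obs :: "lm_data \<Rightarrow> nat \<Rightarrow> rvec \<Rightarrow> rvec" where
  "aug_obs D i x = obs D i x @\<^sub>v x"

definition aug_jac :: "lm_data \<Rightarrow> nat \<Rightarrow> rvec \<Rightarrow> rmat" where
  "aug_jac D i x = obs_jac D i x @\<^sub>r 1\<^sub>m (sdim D)"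

definition aug_cov :: "lm_data \<Rightarrow> nat \<Rightarrow> rmat" where
  "aug_cov D i = four_block_mat (obs_cov D i) (0\<^sub>m (odim D i) (sdim D))
                   (0\<^sub>m (sdim D) (odim D i)) ((1 / reg D) \<cdot>\<^sub>m 1\<^sub>m (sdim D))"

definition growth_bound :: "lm_data \<Rightarrow> real \<Rightarrow> real \<Rightarrow> bool" where
  "growth_bound D \<kappa> s \<longleftrightarrow>
     (\<forall>i\<in>{1..steps D}. \<forall>x\<in>carrier_vec (sdim D).
        enorm (evol D i x) \<le> \<kappa> * (1 + rpow (enorm x) s) \<and>
        spectral_norm (evol_jac D i x) \<le> \<kappa> * (1 + rpow (enorm x) s) \<and>
        enorm (obs D i x) \<le> \<kappa> * (1 + rpow (enorm x) s) \<and>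
        spectral_norm (obs_jac D i x) \<le> \<kappa> * (1 + rpow (enorm x) s))"

text \<open>
  Labels of the independent inputs: \<open>Init j n\<close> for $X_{0|0}^{j,n}$, \<open>Model j n i\<close> for $V_i^{j,n}$ and
  \<open>Obs j n i\<close> for the augmented observation noise.
\<close>

datatype input = Init nat nat | Model nat nat nat | Obs nat nat nat

fun input_dim :: "lm_data \<Rightarrow> input \<Rightarrow> nat" where
  "input_dim D (Init j n) = sdim D"
| "input_dim D (Model j n i) = sdim D"
| "input_dim D (Obs j n i) = odim D i + sdim D"

fun input_mean :: "lm_data \<Rightarrow> input \<Rightarrow> rvec" where
  "input_mean D (Init j n) = bg_mean D"
| "input_mean D (Model j n i) = 0\<^sub>v (sdim D)"
| "input_mean D (Obs j n i) = 0\<^sub>v (odim D i + sdim D)"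

fun input_cov :: "lm_data \<Rightarrow> input \<Rightarrow> rmat" where
  "input_cov D (Init j n) = bg_cov D"
| "input_cov D (Model j n i) = evol_cov D i"
| "input_cov D (Obs j n i) = aug_cov D i"

definition inputs :: "lm_data \<Rightarrow> input set" where
  "inputs D = {Init j n | j n. 1 \<le> j \<and> 1 \<le> n}
     \<union> {Model j n i | j n i. 1 \<le> j \<and> 1 \<le> n \<and> i \<in> {1..steps D}}
     \<union> {Obs j n i | j n i. 1 \<le> j \<and> 1 \<le> n \<and> i \<in> {1..steps D}}"

definition random_inputs :: "'w measure \<Rightarrow> lm_data \<Rightarrow> (input \<Rightarrow> 'w \<Rightarrow> rvec) \<Rightarrow> bool" where
  "random_inputs \<Omega> D \<xi> \<longleftrightarrow>
     prob_space \<Omega> \<and>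
     prob_space.indep_vars \<Omega> (\<lambda>l. borel_vec (input_dim D l)) \<xi> (inputs D) \<and>
     (\<forall>l\<in>inputs D. normal_vec \<Omega> (input_dim D l) (\<xi> l) (input_mean D l) (input_cov D l))"


section \<open>The algorithm and the reference ensemble\<close>

text \<open>
  Both share the two steps below for a single member, in which \<open>z\<close> is the composite linearization
  trajectory. \<open>append_forecast\<close> turns a member over times 0 to i - 1 into one over times 0 to i.
\<close>

definition append_forecast :: "lm_data \<Rightarrow> rvec \<Rightarrow> nat \<Rightarrow> rvec \<Rightarrow> rvec \<Rightarrow> rvec" where
  "append_forecast D z i v x =
     (let z' = block (sdim D) z (i - 1) in
      x @\<^sub>v (evol_jac D i z' *\<^sub>v (block (sdim D) x (i - 1) - z') + evol D i z' + forcing D i + v))"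

text \<open>
  \<open>C\<close> is the (sample or exact) covariance of the whole forecast member over times 0 to i with its
  last block; \<open>w\<close> is the augmented observation noise and \<open>x\<close> the forecast member.
\<close>

definition analysis :: "lm_data \<Rightarrow> rvec \<Rightarrow> nat \<Rightarrow> rmat \<Rightarrow> rvec \<Rightarrow> rvec \<Rightarrow> rvec" where
  "analysis D z i C w x =
     (let z' = block (sdim D) z i;
          G = aug_jac D i z'
      in x + (C * G\<^sup>T * minv (G * block_row (sdim D) C i * G\<^sup>T + aug_cov D i)) *\<^sub>v
             ((obs_val D i @\<^sub>v z') - w - aug_obs D i z' - G *\<^sub>v (block (sdim D) x i - z')))"

text \<open>
  One smoother pass with ensemble size \<open>N\<close>, for given realizations of the inputs (which are indexed
  by the member \<open>n\<close>); the result is the ensemble $X_{0:i|i}^{j,n}$ as a function of \<open>n\<close>.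
\<close>

primrec enks ::
  "lm_data \<Rightarrow> nat \<Rightarrow> rvec \<Rightarrow> (nat \<Rightarrow> rvec) \<Rightarrow> (nat \<Rightarrow> nat \<Rightarrow> rvec) \<Rightarrow> (nat \<Rightarrow> nat \<Rightarrow> rvec) \<Rightarrow>
   nat \<Rightarrow> nat \<Rightarrow> rvec" where
  "enks D N z x0 v w 0 = x0"
| "enks D N z x0 v w (Suc i) =
     (let F = (\<lambda>n. append_forecast D z (Suc i) (v n (Suc i)) (enks D N z x0 v w i n));
          C = sample_cov N (Suc (Suc i) * sdim D) (sdim D) F (\<lambda>n. block (sdim D) (F n) (Suc i))
      in (\<lambda>n. analysis D z (Suc i) C (w n (Suc i)) (F n)))"

definition enks_pass ::
  "lm_data \<Rightarrow> nat \<Rightarrow> rvec \<Rightarrow> (input \<Rightarrow> 'w \<Rightarrow> rvec) \<Rightarrow> nat \<Rightarrow> 'w \<Rightarrow> nat \<Rightarrow> rvec" where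
  "enks_pass D N z \<xi> j \<omega> =
     enks D N z (\<lambda>n. \<xi> (Init j n) \<omega>) (\<lambda>n i. \<xi> (Model j n i) \<omega>) (\<lambda>n i. \<xi> (Obs j n i) \<omega>) (steps D)"

primrec lm_mean :: "lm_data \<Rightarrow> (nat \<Rightarrow> nat) \<Rightarrow> (input \<Rightarrow> 'w \<Rightarrow> rvec) \<Rightarrow> nat \<Rightarrow> 'w \<Rightarrow> rvec" where
  "lm_mean D N \<xi> 0 = (\<lambda>\<omega>. start D)"
| "lm_mean D N \<xi> (Suc j) = (\<lambda>\<omega>. sample_mean (N (Suc j)) (Suc (steps D) * sdim D)
     (enks_pass D (N (Suc j)) (lm_mean D N \<xi> j \<omega>) \<xi> (Suc j) \<omega>))"

text \<open>For \<open>j \<ge> 1\<close>; there is no ensemble for \<open>j = 0\<close>.\<close>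

definition lm_member ::
  "lm_data \<Rightarrow> (nat \<Rightarrow> nat) \<Rightarrow> (input \<Rightarrow> 'w \<Rightarrow> rvec) \<Rightarrow> nat \<Rightarrow> nat \<Rightarrow> 'w \<Rightarrow> rvec" where
  "lm_member D N \<xi> j n \<omega> = enks_pass D (N j) (lm_mean D N \<xi> (j - 1) \<omega>) \<xi> j \<omega> n"

primrec ref_pass ::
  "'w measure \<Rightarrow> lm_data \<Rightarrow> rvec \<Rightarrow> (input \<Rightarrow> 'w \<Rightarrow> rvec) \<Rightarrow> nat \<Rightarrow> nat \<Rightarrow> nat \<Rightarrow> 'w \<Rightarrow> rvec" where
  "ref_pass \<Omega> D u \<xi> j 0 = (\<lambda>n. \<xi> (Init j n))"
| "ref_pass \<Omega> D u \<xi> j (Suc i) =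
     (let F = (\<lambda>n \<omega>. append_forecast D u (Suc i) (\<xi> (Model j n (Suc i)) \<omega>)
                       (ref_pass \<Omega> D u \<xi> j i n \<omega>));
          C = cov_mat \<Omega> (Suc (Suc i) * sdim D) (sdim D) (F 1)
                (\<lambda>\<omega>. block (sdim D) (F 1 \<omega>) (Suc i))
      in (\<lambda>n \<omega>. analysis D u (Suc i) C (\<xi> (Obs j n (Suc i)) \<omega>) (F n \<omega>)))"

primrec ref_member ::
  "'w measure \<Rightarrow> lm_data \<Rightarrow> (input \<Rightarrow> 'w \<Rightarrow> rvec) \<Rightarrow> nat \<Rightarrow> nat \<Rightarrow> 'w \<Rightarrow> rvec" where
  "ref_member \<Omega> D \<xi> 0 = (\<lambda>n \<omega>. start D)"
| "ref_member \<Omega> D \<xi> (Suc j) =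
     ref_pass \<Omega> D (mean_vec \<Omega> (Suc (steps D) * sdim D) (ref_member \<Omega> D \<xi> j 1)) \<xi> (Suc j) (steps D)"

text \<open>
  The limit \<open>min {N 1, \<dots>, N j} \<rightarrow> \<infinity>\<close> over sequences of ensemble sizes \<open>\<ge> 2\<close>. In particular,
  \<open>n \<le> N j\<close> holds eventually for every fixed \<open>n\<close> if \<open>j \<ge> 1\<close>.
\<close>

definition sizes_at_top :: "nat \<Rightarrow> (nat \<Rightarrow> nat) filter" where
  "sizes_at_top j =
     inf (filtercomap (\<lambda>N. Min (N ` {1..j})) at_top) (principal {N. \<forall>l\<ge>1. 2 \<le> N l})"

end

theory Submission
  imports Defs "Jordan_Normal_Form.Determinant"
begin

text \<open>
  All random quantities have moments of all orders, so by the Cauchy-Schwarz inequality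
  convergence in \<open>L\<^sup>2\<close> together with bounded moments is the same as convergence in every \<open>L\<^sup>p\<close>, and
  this notion is stable under sums and products. The members of an ensemble are compared with the
  reference members in this sense uniformly in the member index.

  The linearization points and the sample covariances converge to deterministic limits. At these,
  continuity and polynomial growth of \<open>M\<^sub>i\<close>, \<open>H\<^sub>i\<close> and their Jacobians pass convergence on, and so
  does matrix inversion, because \<open>G P G\<^sup>T + R\<close> dominates the fixed positive definite \<open>R\<close>. The
  convergence of sample means and covariances is a law of large numbers for the reference members:
  these are affine in the Gaussian inputs with coefficients independent of the member, so it
  suffices to treat the inputs and their pairwise products, which are independent across members
  and whose expectations are fixed by means and covariances.
\<close>

section \<open>Convergence with all moments\<close>

text \<open>The obstacle is that the members of one ensemble are dependent: they share linearization
  points and gains, which are random functions of the whole ensemble and of the earlier passes. No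
  law of large numbers applies to them directly, which is why each is paired with a reference member
  built from the same inputs. A gain multiplies a residual it is correlated with, and bounding a
  moment of a product takes moments of twice the order; the loss recurs at every time step and every
  pass, so moments of all orders are carried along instead of one fixed exponent. Inverses could
  destroy moments, but the entries of the inverse of a matrix dominating R are bounded by constants
  of R alone. This needs semidefinite sample covariances at every outcome, not only in the limit. On
  the reference side the gains are deterministic, so affine families are preserved and independence
  is established for the inputs only, never for composite states. Since the normal law is given
  through linear forms, the mean of a product of two coordinates of one input is recovered by
  polarization.\<close>

definition all_moments :: "'w measure \<Rightarrow> ('w \<Rightarrow> real) \<Rightarrow> bool" where
  "all_moments M X \<longleftrightarrow> X \<in> borel_measurable M \<and> (\<forall>q. integrable M (\<lambda>\<omega>. \<bar>X \<omega>\<bar> ^ q))"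

text \<open>The filter decides what the bound is uniform in: all members for
  \<open>principal {1..}\<close>, the members of late ensembles for \<open>ensemble_filter\<close>,
  the late ensembles themselves for the filter of the sizes. Natural exponents suffice, as a real
  power is later bounded by a sum of two natural ones.\<close>

definition bounded_moments :: "'w measure \<Rightarrow> 'i filter \<Rightarrow> ('i \<Rightarrow> 'w \<Rightarrow> real) \<Rightarrow> bool" where
  "bounded_moments M G X \<longleftrightarrow> (\<forall>\<^sub>F i in G. all_moments M (X i)) \<and>
     (\<forall>q. \<exists>B. \<forall>\<^sub>F i in G. (\<integral>\<omega>. \<bar>X i \<omega>\<bar> ^ q \<partial>M) \<le> B)"

definition vanishing :: "'w measure \<Rightarrow> 'i filter \<Rightarrow> ('i \<Rightarrow> 'w \<Rightarrow> real) \<Rightarrow> bool" where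
  "vanishing M G X \<longleftrightarrow> bounded_moments M G X \<and> ((\<lambda>i. \<integral>\<omega>. (X i \<omega>)\<^sup>2 \<partial>M) \<longlongrightarrow> 0) G"

text \<open>The limit \<open>U\<close> may vary with the index because each member has its own
  reference member; a deterministic limit is a constant \<open>U\<close>. Moments of
  \<open>U\<close> are bounded along with those of the difference, hence those of \<open>X\<close>
  are bounded too.\<close>

definition mconv ::
  "'w measure \<Rightarrow> 'i filter \<Rightarrow> ('i \<Rightarrow> 'w \<Rightarrow> real) \<Rightarrow> ('i \<Rightarrow> 'w \<Rightarrow> real) \<Rightarrow> bool" where
  "mconv M G X U \<longleftrightarrow> bounded_moments M G U \<and> vanishing M G (\<lambda>i \<omega>. X i \<omega> - U i \<omega>)"

section \<open>Power inequalities behind the moment bounds\<close>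

lemma abs_add_power_le: "\<bar>x + y :: real\<bar> ^ q \<le> 2 ^ q * (\<bar>x\<bar> ^ q + \<bar>y\<bar> ^ q)"
proof -
  have "\<bar>x + y\<bar> ^ q \<le> (2 * max \<bar>x\<bar> \<bar>y\<bar>) ^ q"
    by (rule power_mono) auto
  also have "\<dots> = 2 ^ q * (max \<bar>x\<bar> \<bar>y\<bar>) ^ q"
    by (simp add: power_mult_distrib)
  also have "(max \<bar>x\<bar> \<bar>y\<bar>) ^ q \<le> \<bar>x\<bar> ^ q + \<bar>y\<bar> ^ q"
    by (simp add: max_def)
  finally show ?thesis by simp
qed

lemma abs_mult_power_le: "\<bar>x * y :: real\<bar> ^ q \<le> \<bar>x\<bar> ^ (2 * q) + \<bar>y\<bar> ^ (2 * q)"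
proof -
  have "2 * (\<bar>x\<bar> ^ q * \<bar>y\<bar> ^ q) \<le> (\<bar>x\<bar> ^ q)\<^sup>2 + (\<bar>y\<bar> ^ q)\<^sup>2"
    using sum_squares_bound[of "\<bar>x\<bar> ^ q" "\<bar>y\<bar> ^ q"] by simp
  moreover have "\<bar>x\<bar> ^ q * \<bar>y\<bar> ^ q \<le> 2 * (\<bar>x\<bar> ^ q * \<bar>y\<bar> ^ q)" by simp
  moreover have "(\<bar>x\<bar> ^ q)\<^sup>2 = \<bar>x\<bar> ^ (2 * q)" "(\<bar>y\<bar> ^ q)\<^sup>2 = \<bar>y\<bar> ^ (2 * q)"
    by (simp_all add: power_mult[symmetric] mult.commute)
  ultimately have "\<bar>x\<bar> ^ q * \<bar>y\<bar> ^ q \<le> \<bar>x\<bar> ^ (2 * q) + \<bar>y\<bar> ^ (2 * q)" by linarith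
  then show ?thesis
    by (simp add: abs_mult power_mult_distrib)
qed

text \<open>Jensen's inequality for the q-th power on the nonnegative half-line, applied to absolute
  values. It bounds moments of a sample mean by averaged moments of the members, whatever their
  dependence.\<close>

lemma abs_mean_power_le:
  assumes "1 \<le> N"
  shows "\<bar>(\<Sum>n=1..N. x n) / real N\<bar> ^ q \<le> (\<Sum>n=1..N. \<bar>x n :: real\<bar> ^ q) / real N"
proof (cases "q = 0")
  case True
  then show ?thesis using assms by simp
next
  case False
  \<comment> \<open>Convexity is asserted on the half-line, since odd powers above the first fail to
    be convex on the whole line.\<close>
  have cv: "convex_on {0::real..} (\<lambda>x. x ^ q)"
  proof (cases "even q")
    case True
    then show ?thesis using convex_power_even[of q] by (rule_tac convex_on_subset[of UNIV]) auto
  qed (rule convex_power_odd)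
  have "\<bar>(\<Sum>n=1..N. x n) / real N\<bar> ^ q \<le> (\<Sum>n=1..N. (1 / real N) *\<^sub>R \<bar>x n\<bar>) ^ q"
  proof (rule power_mono)
    have "\<bar>(\<Sum>n=1..N. x n)\<bar> / real N \<le> (\<Sum>n=1..N. \<bar>x n\<bar>) / real N"
      by (intro divide_right_mono sum_abs) auto
    then show "\<bar>(\<Sum>n=1..N. x n) / real N\<bar> \<le> (\<Sum>n=1..N. (1 / real N) *\<^sub>R \<bar>x n\<bar>)"
      by (simp add: sum_divide_distrib[symmetric])
  qed auto
  also have "\<dots> \<le> (\<Sum>n=1..N. (1 / real N) * \<bar>x n\<bar> ^ q)"
    by (rule convex_on_sum[OF _ _ cv]) (use assms in auto)
  also have "\<dots> = (\<Sum>n=1..N. \<bar>x n\<bar> ^ q) / real N"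
    by (simp add: sum_divide_distrib)
  finally show ?thesis .
qed

section \<open>Single random variables with all moments\<close>

lemma all_moments_cong:
  assumes "\<And>\<omega>. \<omega> \<in> space M \<Longrightarrow> X \<omega> = Y \<omega>"
  shows "all_moments M X \<longleftrightarrow> all_moments M Y"
  unfolding all_moments_def
  using measurable_cong[of M X Y borel] Bochner_Integration.integrable_cong[OF refl, of M "\<lambda>\<omega>. \<bar>X \<omega>\<bar> ^ _" "\<lambda>\<omega>. \<bar>Y \<omega>\<bar> ^ _"] assms
  by auto

lemma all_moments_measurable: "all_moments M X \<Longrightarrow> X \<in> borel_measurable M"
  by (simp add: all_moments_def)

lemma all_moments_abs_power: "all_moments M X \<Longrightarrow> integrable M (\<lambda>\<omega>. \<bar>X \<omega>\<bar> ^ q)"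
  by (simp add: all_moments_def)

lemma all_moments_dominated:
  assumes "all_moments M X" and [measurable]: "Y \<in> borel_measurable M"
    and "\<And>\<omega>. \<omega> \<in> space M \<Longrightarrow> \<bar>Y \<omega>\<bar> \<le> \<bar>X \<omega>\<bar>"
  shows "all_moments M Y"
  unfolding all_moments_def
proof (intro conjI allI)
  fix q
  have [measurable]: "X \<in> borel_measurable M" by (rule all_moments_measurable[OF assms(1)])
  show "integrable M (\<lambda>\<omega>. \<bar>Y \<omega>\<bar> ^ q)"
    by (rule Bochner_Integration.integrable_bound[OF all_moments_abs_power[OF assms(1), of q]])
      (use assms(3) in \<open>auto intro!: power_mono\<close>)
qed fact

lemma all_moments_abs: "all_moments M X \<Longrightarrow> all_moments M (\<lambda>\<omega>. \<bar>X \<omega>\<bar>)"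
  by (auto simp: all_moments_def)

lemma all_moments_add:
  assumes "all_moments M X" "all_moments M Y"
  shows "all_moments M (\<lambda>\<omega>. X \<omega> + Y \<omega>)"
  unfolding all_moments_def
proof (intro conjI allI)
  have [measurable]: "X \<in> borel_measurable M" "Y \<in> borel_measurable M"
    using assms by (auto intro: all_moments_measurable)
  show "(\<lambda>\<omega>. X \<omega> + Y \<omega>) \<in> borel_measurable M" by measurable
  fix q
  have "integrable M (\<lambda>\<omega>. 2 ^ q * (\<bar>X \<omega>\<bar> ^ q + \<bar>Y \<omega>\<bar> ^ q))"
    using assms by (auto intro: all_moments_abs_power)
  then show "integrable M (\<lambda>\<omega>. \<bar>X \<omega> + Y \<omega>\<bar> ^ q)"
    by (rule Bochner_Integration.integrable_bound) (auto simp: abs_add_power_le)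
qed

lemma all_moments_mult:
  assumes "all_moments M X" "all_moments M Y"
  shows "all_moments M (\<lambda>\<omega>. X \<omega> * Y \<omega>)"
  unfolding all_moments_def
proof (intro conjI allI)
  have [measurable]: "X \<in> borel_measurable M" "Y \<in> borel_measurable M"
    using assms by (auto intro: all_moments_measurable)
  show "(\<lambda>\<omega>. X \<omega> * Y \<omega>) \<in> borel_measurable M" by measurable
  fix q
  have "integrable M (\<lambda>\<omega>. \<bar>X \<omega>\<bar> ^ (2 * q) + \<bar>Y \<omega>\<bar> ^ (2 * q))"
    using assms by (auto intro: all_moments_abs_power)
  then show "integrable M (\<lambda>\<omega>. \<bar>X \<omega> * Y \<omega>\<bar> ^ q)"
    by (rule Bochner_Integration.integrable_bound) (auto intro: abs_mult_power_le[THEN order_trans])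
qed

lemma all_moments_integrable: "all_moments M X \<Longrightarrow> integrable M X"
  using all_moments_abs_power[of M X 1] all_moments_measurable[of M X]
  by (simp add: integrable_iff_bounded) 

lemma all_moments_integrable_power2: "all_moments M X \<Longrightarrow> integrable M (\<lambda>\<omega>. (X \<omega>)\<^sup>2)"
  using all_moments_abs_power[of M X 2] by simp

context prob_space
begin

lemma all_moments_const: "all_moments M (\<lambda>\<omega>. c)"
  by (simp add: all_moments_def)

lemma all_moments_sum:
  assumes "\<And>a. a \<in> A \<Longrightarrow> all_moments M (X a)"
  shows "all_moments M (\<lambda>\<omega>. \<Sum>a\<in>A. X a \<omega>)"
  using assms
proof (induction A rule: infinite_finite_induct)
  case (insert a A)
  then show ?case using all_moments_add[of M "X a" "\<lambda>\<omega>. \<Sum>a\<in>A. X a \<omega>"] by simp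
qed (simp_all add: all_moments_const)

lemma all_moments_cmult: "all_moments M X \<Longrightarrow> all_moments M (\<lambda>\<omega>. c * X \<omega>)"
  by (rule all_moments_mult[OF all_moments_const])

lemma all_moments_diff:
  assumes "all_moments M X" "all_moments M Y"
  shows "all_moments M (\<lambda>\<omega>. X \<omega> - Y \<omega>)"
  using all_moments_add[OF assms(1) all_moments_cmult[OF assms(2), of "-1"]] by simp

lemma all_moments_power: "all_moments M X \<Longrightarrow> all_moments M (\<lambda>\<omega>. X \<omega> ^ r)"
  by (induction r) (auto intro: all_moments_const all_moments_mult)

text \<open>Cauchy-Schwarz inequality, from the fact that the quadratic polynomial a - 2tc + t^2 b,
  the expectation of (|f| - t|g|)^2, is nonnegative for every real t.\<close>

lemma integral_product_le_sqrt:
  assumes [measurable]: "f \<in> borel_measurable M" "g \<in> borel_measurable M"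
    and f: "integrable M (\<lambda>\<omega>. (f \<omega>)\<^sup>2)" and g: "integrable M (\<lambda>\<omega>. (g \<omega>)\<^sup>2)"
  shows "(\<integral>\<omega>. \<bar>f \<omega> * g \<omega>\<bar> \<partial>M) \<le> sqrt (\<integral>\<omega>. (f \<omega>)\<^sup>2 \<partial>M) * sqrt (\<integral>\<omega>. (g \<omega>)\<^sup>2 \<partial>M)"
proof -
  define a b c where "a = (\<integral>\<omega>. (f \<omega>)\<^sup>2 \<partial>M)" and "b = (\<integral>\<omega>. (g \<omega>)\<^sup>2 \<partial>M)"
    and "c = (\<integral>\<omega>. \<bar>f \<omega> * g \<omega>\<bar> \<partial>M)"
  have a0: "0 \<le> a" and b0: "0 \<le> b" and c0: "0 \<le> c" by (simp_all add: a_def b_def c_def)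
  have fg: "integrable M (\<lambda>\<omega>. \<bar>f \<omega> * g \<omega>\<bar>)"
  proof (rule Bochner_Integration.integrable_bound[OF Bochner_Integration.integrable_add[OF f g]])
    have "\<bar>x * y\<bar> \<le> x\<^sup>2 + y\<^sup>2" for x y :: real
      using abs_mult_power_le[of x y 1] by simp
    then show "AE \<omega> in M. norm \<bar>f \<omega> * g \<omega>\<bar> \<le> norm ((f \<omega>)\<^sup>2 + (g \<omega>)\<^sup>2)"
      by simp
  qed measurable
  have q: "0 \<le> a - 2 * t * c + t\<^sup>2 * b" for t
  proof -
    have "0 \<le> (\<integral>\<omega>. (\<bar>f \<omega>\<bar> - t * \<bar>g \<omega>\<bar>)\<^sup>2 \<partial>M)" by simp
    also have "\<dots> = (\<integral>\<omega>. (f \<omega>)\<^sup>2 - 2 * t * \<bar>f \<omega> * g \<omega>\<bar> + t\<^sup>2 * (g \<omega>)\<^sup>2 \<partial>M)"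
      by (rule Bochner_Integration.integral_cong) (auto simp: power2_diff power_mult_distrib abs_mult)
    also have "\<dots> = a - 2 * t * c + t\<^sup>2 * b"
      using f g fg by (simp add: a_def b_def c_def)
    finally show ?thesis .
  qed
  have "c\<^sup>2 \<le> a * b"
  proof (cases "b = 0")
    case True
    have "c = 0"
    proof (rule ccontr)
      assume "c \<noteq> 0"
      \<comment> \<open>With b = 0 the polynomial is a - 2tc, and at this t it equals -1.\<close>
      then show False using q[of "(a + 1) / (2 * c)"] True by (simp add: field_simps)
    qed
    then show ?thesis using True by simp
  next
    case False
    \<comment> \<open>The minimizer t = c / b turns nonnegativity into c^2 \<le> a b.\<close>
    then show ?thesis using q[of "c / b"] b0 by (simp add: field_simps power2_eq_square)
  qed
  then have "c \<le> sqrt (a * b)" by (rule real_le_rsqrt)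
  then show ?thesis by (simp add: a_def b_def c_def real_sqrt_mult)
qed

section \<open>Families with uniformly bounded moments\<close>

lemma bounded_moments_moments: "bounded_moments M G X \<Longrightarrow> \<forall>\<^sub>F i in G. all_moments M (X i)"
  by (simp add: bounded_moments_def)

lemma bounded_moments_const: "all_moments M Z \<Longrightarrow> bounded_moments M G (\<lambda>i. Z)"
  unfolding bounded_moments_def by (metis always_eventually order_refl)

lemma bounded_moments_dominated:
  assumes X: "bounded_moments M G X" and Y: "\<forall>\<^sub>F i in G. Y i \<in> borel_measurable M"
    and le: "\<forall>\<^sub>F i in G. \<forall>\<omega>\<in>space M. \<bar>Y i \<omega>\<bar> \<le> \<bar>X i \<omega>\<bar>"
  shows "bounded_moments M G Y"
proof -
  have Ym: "\<forall>\<^sub>F i in G. all_moments M (Y i)"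
    using bounded_moments_moments[OF X] Y le by eventually_elim (auto intro: all_moments_dominated)
  have "\<exists>B. \<forall>\<^sub>F i in G. (\<integral>\<omega>. \<bar>Y i \<omega>\<bar> ^ q \<partial>M) \<le> B" for q
  proof -
    obtain B where B: "\<forall>\<^sub>F i in G. (\<integral>\<omega>. \<bar>X i \<omega>\<bar> ^ q \<partial>M) \<le> B"
      using X by (auto simp: bounded_moments_def)
    have "\<forall>\<^sub>F i in G. (\<integral>\<omega>. \<bar>Y i \<omega>\<bar> ^ q \<partial>M) \<le> B"
      using B Ym bounded_moments_moments[OF X] le
    proof eventually_elim
      case (elim i)
      have "(\<integral>\<omega>. \<bar>Y i \<omega>\<bar> ^ q \<partial>M) \<le> (\<integral>\<omega>. \<bar>X i \<omega>\<bar> ^ q \<partial>M)"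
        using elim by (intro integral_mono) (auto intro!: power_mono all_moments_abs_power)
      then show ?case using elim by simp
    qed
    then show ?thesis ..
  qed
  then show ?thesis using Ym by (simp add: bounded_moments_def)
qed

lemma bounded_moments_cong:
  assumes "bounded_moments M G X" and e: "\<forall>\<^sub>F i in G. \<forall>\<omega>\<in>space M. X i \<omega> = Y i \<omega>"
  shows "bounded_moments M G Y"
proof (rule bounded_moments_dominated[OF assms(1)])
  show "\<forall>\<^sub>F i in G. Y i \<in> borel_measurable M"
    using bounded_moments_moments[OF assms(1)] e
  proof eventually_elim
    case (elim i)
    then have "all_moments M (Y i)" using all_moments_cong[of M "X i" "Y i"] by blast
    then show ?case by (rule all_moments_measurable)
  qed
  show "\<forall>\<^sub>F i in G. \<forall>\<omega>\<in>space M. \<bar>Y i \<omega>\<bar> \<le> \<bar>X i \<omega>\<bar>"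
    using e by eventually_elim auto
qed

text \<open>Common scheme for sums, with r = 1, and products, with r = 2. The factor 2^q is the one
  that sums need. Passing to moments of order r q is harmless because every order is
  bounded.\<close>

lemma bounded_moments_growth:
  assumes X: "bounded_moments M G X" and Y: "bounded_moments M G Y"
    and Z: "\<forall>\<^sub>F i in G. all_moments M (Z i)"
    and le: "\<And>q i \<omega>. \<bar>Z i \<omega>\<bar> ^ q \<le> 2 ^ q * (\<bar>X i \<omega>\<bar> ^ (r * q) + \<bar>Y i \<omega>\<bar> ^ (r * q))"
  shows "bounded_moments M G Z"
proof -
  have "\<exists>B. \<forall>\<^sub>F i in G. (\<integral>\<omega>. \<bar>Z i \<omega>\<bar> ^ q \<partial>M) \<le> B" for q
  proof -
    obtain B C where B: "\<forall>\<^sub>F i in G. (\<integral>\<omega>. \<bar>X i \<omega>\<bar> ^ (r * q) \<partial>M) \<le> B"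
      and C: "\<forall>\<^sub>F i in G. (\<integral>\<omega>. \<bar>Y i \<omega>\<bar> ^ (r * q) \<partial>M) \<le> C"
      using X Y unfolding bounded_moments_def by metis
    have "\<forall>\<^sub>F i in G. (\<integral>\<omega>. \<bar>Z i \<omega>\<bar> ^ q \<partial>M) \<le> 2 ^ q * (B + C)"
      using B C Z bounded_moments_moments[OF X] bounded_moments_moments[OF Y]
    proof eventually_elim
      case (elim i)
      have "(\<integral>\<omega>. \<bar>Z i \<omega>\<bar> ^ q \<partial>M) \<le> (\<integral>\<omega>. 2 ^ q * (\<bar>X i \<omega>\<bar> ^ (r * q) + \<bar>Y i \<omega>\<bar> ^ (r * q)) \<partial>M)"
        using elim by (intro integral_mono le)
          (auto intro!: all_moments_abs_power integrable_mult_right integrable_add)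
      also have "\<dots> = 2 ^ q * ((\<integral>\<omega>. \<bar>X i \<omega>\<bar> ^ (r * q) \<partial>M) + (\<integral>\<omega>. \<bar>Y i \<omega>\<bar> ^ (r * q) \<partial>M))"
        using elim by (simp add: all_moments_abs_power)
      also have "\<dots> \<le> 2 ^ q * (B + C)" using elim by simp
      finally show ?case .
    qed
    then show ?thesis ..
  qed
  then show ?thesis using Z by (simp add: bounded_moments_def)
qed

lemma bounded_moments_add:
  assumes X: "bounded_moments M G X" and Y: "bounded_moments M G Y"
  shows "bounded_moments M G (\<lambda>i \<omega>. X i \<omega> + Y i \<omega>)"
proof (rule bounded_moments_growth[OF X Y, where r = 1])
  show "\<forall>\<^sub>F i in G. all_moments M (\<lambda>\<omega>. X i \<omega> + Y i \<omega>)"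
    using bounded_moments_moments[OF X] bounded_moments_moments[OF Y]
    by eventually_elim (rule all_moments_add)
qed (simp add: abs_add_power_le)

lemma bounded_moments_mult:
  assumes X: "bounded_moments M G X" and Y: "bounded_moments M G Y"
  shows "bounded_moments M G (\<lambda>i \<omega>. X i \<omega> * Y i \<omega>)"
proof (rule bounded_moments_growth[OF X Y, where r = 2])
  show "\<forall>\<^sub>F i in G. all_moments M (\<lambda>\<omega>. X i \<omega> * Y i \<omega>)"
    using bounded_moments_moments[OF X] bounded_moments_moments[OF Y]
    by eventually_elim (rule all_moments_mult)
  fix q :: nat and i \<omega>
  have "1 * (\<bar>X i \<omega>\<bar> ^ (2 * q) + \<bar>Y i \<omega>\<bar> ^ (2 * q)) \<le> 2 ^ q * (\<bar>X i \<omega>\<bar> ^ (2 * q) + \<bar>Y i \<omega>\<bar> ^ (2 * q))"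
    by (intro mult_right_mono) auto
  then show "\<bar>X i \<omega> * Y i \<omega>\<bar> ^ q \<le> 2 ^ q * (\<bar>X i \<omega>\<bar> ^ (2 * q) + \<bar>Y i \<omega>\<bar> ^ (2 * q))"
    unfolding mult_1 by (rule order_trans[OF abs_mult_power_le])
qed

lemma bounded_moments_cmult: "bounded_moments M G X \<Longrightarrow> bounded_moments M G (\<lambda>i \<omega>. c * X i \<omega>)"
  by (intro bounded_moments_mult bounded_moments_const all_moments_const)

lemma bounded_moments_diff:
  assumes "bounded_moments M G X" "bounded_moments M G Y"
  shows "bounded_moments M G (\<lambda>i \<omega>. X i \<omega> - Y i \<omega>)"
  using bounded_moments_add[OF assms(1) bounded_moments_cmult[OF assms(2), of "-1"]] by simp

lemma bounded_moments_sum: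
  assumes "\<And>a. a \<in> A \<Longrightarrow> bounded_moments M G (\<lambda>i. X i a)"
  shows "bounded_moments M G (\<lambda>i \<omega>. \<Sum>a\<in>A. X i a \<omega>)"
  using assms
proof (induction A rule: infinite_finite_induct)
  case (insert a A)
  then show ?case
    using bounded_moments_add[of G "\<lambda>i. X i a" "\<lambda>i \<omega>. \<Sum>a\<in>A. X i a \<omega>"] by simp
qed (simp_all add: bounded_moments_const all_moments_const)

lemma bounded_moments_abs: "bounded_moments M G X \<Longrightarrow> bounded_moments M G (\<lambda>i \<omega>. \<bar>X i \<omega>\<bar>)"
  by (auto simp: bounded_moments_def elim!: eventually_mono intro: all_moments_abs)

lemma bounded_moments_power: "bounded_moments M G X \<Longrightarrow> bounded_moments M G (\<lambda>i \<omega>. X i \<omega> ^ r)"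
  by (induction r) (auto intro: bounded_moments_const all_moments_const bounded_moments_mult)

text \<open>Reindexing moves bounds between the filters: \<open>snd\<close> leads from all members
  to ensembles, \<open>fst\<close> from the sizes to ensembles, and pairing with a fixed n from
  ensembles to one member.\<close>

lemma bounded_moments_filterlim:
  assumes "bounded_moments M G X" "filterlim f G F"
  shows "bounded_moments M F (\<lambda>i. X (f i))"
  using assms unfolding bounded_moments_def filterlim_iff by meson

section \<open>Families that tend to zero in mean square\<close>

lemma vanishing_bounded: "vanishing M G X \<Longrightarrow> bounded_moments M G X"
  by (simp add: vanishing_def)

text \<open>Cauchy-Schwarz with the second moments of \<open>D\<close>, which tend to zero, and
  those of \<open>Y\<close>, which stay below a constant. It is later applied to products from which
  one factor \<open>D\<close> has been split off.\<close>

lemma vanishing_mult_L1: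
  assumes D: "vanishing M G D" and Y: "bounded_moments M G Y"
  shows "((\<lambda>i. \<integral>\<omega>. \<bar>D i \<omega> * Y i \<omega>\<bar> \<partial>M) \<longlongrightarrow> 0) G"
proof -
  obtain B where B: "\<forall>\<^sub>F i in G. (\<integral>\<omega>. \<bar>Y i \<omega>\<bar> ^ 2 \<partial>M) \<le> B"
    using Y unfolding bounded_moments_def by metis
  have "((\<lambda>i. sqrt (\<integral>\<omega>. (D i \<omega>)\<^sup>2 \<partial>M) * sqrt B) \<longlongrightarrow> sqrt 0 * sqrt B) G"
    using D by (intro tendsto_intros) (simp add: vanishing_def)
  then have l: "((\<lambda>i. sqrt (\<integral>\<omega>. (D i \<omega>)\<^sup>2 \<partial>M) * sqrt B) \<longlongrightarrow> 0) G" by simp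
  show ?thesis
  proof (rule tendsto_sandwich[OF _ _ tendsto_const l])
    show "\<forall>\<^sub>F i in G. (\<integral>\<omega>. \<bar>D i \<omega> * Y i \<omega>\<bar> \<partial>M) \<le> sqrt (\<integral>\<omega>. (D i \<omega>)\<^sup>2 \<partial>M) * sqrt B"
      using B bounded_moments_moments[OF Y] bounded_moments_moments[OF vanishing_bounded[OF D]]
    proof eventually_elim
      case (elim i)
      have "(\<integral>\<omega>. \<bar>D i \<omega> * Y i \<omega>\<bar> \<partial>M) \<le> sqrt (\<integral>\<omega>. (D i \<omega>)\<^sup>2 \<partial>M) * sqrt (\<integral>\<omega>. (Y i \<omega>)\<^sup>2 \<partial>M)"
        using elim by (intro integral_product_le_sqrt all_moments_measurable all_moments_integrable_power2)
      also have "\<dots> \<le> sqrt (\<integral>\<omega>. (D i \<omega>)\<^sup>2 \<partial>M) * sqrt B"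
        using elim by (intro mult_left_mono) auto
      finally show ?case .
    qed
  qed auto
qed

text \<open>Splitting the power as D * D^(q-1) leaves a second factor with bounded moments, so mean
  square convergence passes to every exponent q \<ge> 1.\<close>

lemma vanishing_abs_power:
  assumes D: "vanishing M G D" and q: "1 \<le> q"
  shows "((\<lambda>i. \<integral>\<omega>. \<bar>D i \<omega>\<bar> ^ q \<partial>M) \<longlongrightarrow> 0) G"
proof -
  have "((\<lambda>i. \<integral>\<omega>. \<bar>D i \<omega> * D i \<omega> ^ (q - 1)\<bar> \<partial>M) \<longlongrightarrow> 0) G"
    by (intro vanishing_mult_L1[OF D] bounded_moments_power vanishing_bounded[OF D])
  then show ?thesis using q by (simp add: power_abs flip: power_Suc)
qed

text \<open>The square of the product is D * (D Y^2), whose second factor has bounded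
  moments.\<close>

lemma vanishing_mult:
  assumes D: "vanishing M G D" and Y: "bounded_moments M G Y"
  shows "vanishing M G (\<lambda>i \<omega>. D i \<omega> * Y i \<omega>)"
proof -
  have "((\<lambda>i. \<integral>\<omega>. \<bar>D i \<omega> * (D i \<omega> * (Y i \<omega>)\<^sup>2)\<bar> \<partial>M) \<longlongrightarrow> 0) G"
    by (intro vanishing_mult_L1[OF D] bounded_moments_mult bounded_moments_power vanishing_bounded[OF D] Y)
  moreover have "\<bar>d * (d * y\<^sup>2)\<bar> = (d * y)\<^sup>2" for d y :: real
    by (simp add: power2_eq_square abs_mult)
  ultimately show ?thesis
    using bounded_moments_mult[OF vanishing_bounded[OF D] Y] by (simp add: vanishing_def)
qed

lemma vanishing_add:
  assumes X: "vanishing M G X" and Y: "vanishing M G Y"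
  shows "vanishing M G (\<lambda>i \<omega>. X i \<omega> + Y i \<omega>)"
proof -
  note bX = vanishing_bounded[OF X] and bY = vanishing_bounded[OF Y]
  have "((\<lambda>i. 2 * (\<integral>\<omega>. (X i \<omega>)\<^sup>2 \<partial>M) + 2 * (\<integral>\<omega>. (Y i \<omega>)\<^sup>2 \<partial>M)) \<longlongrightarrow> 2 * 0 + 2 * 0) G"
    using X Y by (intro tendsto_intros) (auto simp: vanishing_def)
  then have l: "((\<lambda>i. 2 * (\<integral>\<omega>. (X i \<omega>)\<^sup>2 \<partial>M) + 2 * (\<integral>\<omega>. (Y i \<omega>)\<^sup>2 \<partial>M)) \<longlongrightarrow> 0) G" by simp
  have "((\<lambda>i. \<integral>\<omega>. (X i \<omega> + Y i \<omega>)\<^sup>2 \<partial>M) \<longlongrightarrow> 0) G"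
  proof (rule tendsto_sandwich[OF _ _ tendsto_const l])
    show "\<forall>\<^sub>F i in G. (\<integral>\<omega>. (X i \<omega> + Y i \<omega>)\<^sup>2 \<partial>M) \<le> 2 * (\<integral>\<omega>. (X i \<omega>)\<^sup>2 \<partial>M) + 2 * (\<integral>\<omega>. (Y i \<omega>)\<^sup>2 \<partial>M)"
      using bounded_moments_moments[OF bX] bounded_moments_moments[OF bY]
    proof eventually_elim
      case (elim i)
      have le: "(x + y)\<^sup>2 \<le> 2 * x\<^sup>2 + 2 * y\<^sup>2" for x y :: real
        using sum_squares_bound[of x y] by (simp add: power2_sum)
      have "(\<integral>\<omega>. (X i \<omega> + Y i \<omega>)\<^sup>2 \<partial>M) \<le> (\<integral>\<omega>. 2 * (X i \<omega>)\<^sup>2 + 2 * (Y i \<omega>)\<^sup>2 \<partial>M)"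
        using elim by (intro integral_mono le)
          (auto intro!: all_moments_integrable_power2 all_moments_add integrable_add)
      then show ?case using elim by (simp add: all_moments_integrable_power2)
    qed
  qed auto
  then show ?thesis using bounded_moments_add[OF bX bY] by (simp add: vanishing_def)
qed

lemma vanishing_cmult: "vanishing M G X \<Longrightarrow> vanishing M G (\<lambda>i \<omega>. c * X i \<omega>)"
  using vanishing_mult[of G X "\<lambda>i \<omega>. c"]
  by (simp add: bounded_moments_const all_moments_const mult.commute)

lemma vanishing_zero: "vanishing M G (\<lambda>i \<omega>. 0)"
  by (simp add: vanishing_def bounded_moments_const all_moments_const)

lemma vanishing_sum:
  assumes "\<And>a. a \<in> A \<Longrightarrow> vanishing M G (\<lambda>i. X i a)"
  shows "vanishing M G (\<lambda>i \<omega>. \<Sum>a\<in>A. X i a \<omega>)"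
  using assms
proof (induction A rule: infinite_finite_induct)
  case (insert a A)
  then show ?case
    using vanishing_add[of G "\<lambda>i. X i a" "\<lambda>i \<omega>. \<Sum>a\<in>A. X i a \<omega>"] by simp
qed (simp_all add: vanishing_zero)

lemma vanishing_abs: "vanishing M G X \<Longrightarrow> vanishing M G (\<lambda>i \<omega>. \<bar>X i \<omega>\<bar>)"
  by (simp add: vanishing_def bounded_moments_abs)

lemma vanishing_filterlim:
  assumes "vanishing M G X" "filterlim f G F"
  shows "vanishing M F (\<lambda>i. X (f i))"
  using assms bounded_moments_filterlim[OF _ assms(2)]
  unfolding vanishing_def by (auto intro: filterlim_compose)

text \<open>The remainder \<open>Y\<close> may depend on \<epsilon>. Continuity arguments have this
  shape: the constant covers arguments near the limit, the remainder covers the others.\<close>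

lemma vanishing_approx:
  assumes X: "bounded_moments M G X"
    and ap: "\<And>\<epsilon>. 0 < \<epsilon> \<Longrightarrow>
      \<exists>Y. vanishing M G Y \<and> (\<forall>\<^sub>F i in G. \<forall>\<omega>\<in>space M. \<bar>X i \<omega>\<bar> \<le> \<epsilon> + \<bar>Y i \<omega>\<bar>)"
  shows "vanishing M G X"
proof -
  have "((\<lambda>i. \<integral>\<omega>. (X i \<omega>)\<^sup>2 \<partial>M) \<longlongrightarrow> 0) G"
  proof (rule tendstoI)
    fix e :: real assume e: "0 < e"
    \<comment> \<open>The choice makes 2 \<epsilon>^2 = e / 2, and the remainder contributes less
      than 2 (e / 4).\<close>
    define \<epsilon> where "\<epsilon> = sqrt (e / 4)"
    have \<epsilon>: "0 < \<epsilon>" "\<epsilon>\<^sup>2 = e / 4" using e by (simp_all add: \<epsilon>_def)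
    from ap[OF \<epsilon>(1)] obtain Y where Y: "vanishing M G Y"
      and le: "\<forall>\<^sub>F i in G. \<forall>\<omega>\<in>space M. \<bar>X i \<omega>\<bar> \<le> \<epsilon> + \<bar>Y i \<omega>\<bar>" by blast
    have "\<forall>\<^sub>F i in G. (\<integral>\<omega>. (Y i \<omega>)\<^sup>2 \<partial>M) < e / 4"
      using Y e by (intro order_tendstoD(2)[where y = 0]) (simp_all add: vanishing_def)
    then show "\<forall>\<^sub>F i in G. dist (\<integral>\<omega>. (X i \<omega>)\<^sup>2 \<partial>M) 0 < e"
      using le bounded_moments_moments[OF X] bounded_moments_moments[OF vanishing_bounded[OF Y]]
    proof eventually_elim
      case (elim i)
      have "(X i \<omega>)\<^sup>2 \<le> 2 * \<epsilon>\<^sup>2 + 2 * (Y i \<omega>)\<^sup>2" if "\<omega> \<in> space M" for \<omega>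
      proof -
        have "(X i \<omega>)\<^sup>2 \<le> (\<epsilon> + \<bar>Y i \<omega>\<bar>)\<^sup>2"
          using elim(2) that \<epsilon> by (intro abs_le_square_iff[THEN iffD1]) auto
        also have "\<dots> \<le> 2 * \<epsilon>\<^sup>2 + 2 * (Y i \<omega>)\<^sup>2"
          using sum_squares_bound[of \<epsilon> "\<bar>Y i \<omega>\<bar>"] by (simp add: power2_sum)
        finally show ?thesis .
      qed
      then have "(\<integral>\<omega>. (X i \<omega>)\<^sup>2 \<partial>M) \<le> (\<integral>\<omega>. 2 * \<epsilon>\<^sup>2 + 2 * (Y i \<omega>)\<^sup>2 \<partial>M)"
        using elim by (intro integral_mono)
          (auto intro!: all_moments_integrable_power2 integrable_add)
      also have "\<dots> = 2 * \<epsilon>\<^sup>2 + 2 * (\<integral>\<omega>. (Y i \<omega>)\<^sup>2 \<partial>M)"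
        using elim by (simp add: all_moments_integrable_power2 prob_space)
      also have "\<dots> < e" using elim \<epsilon> by simp
      finally show ?case by simp
    qed
  qed
  then show ?thesis using X by (simp add: vanishing_def)
qed

lemma vanishing_dominated:
  assumes "vanishing M G X" "\<forall>\<^sub>F i in G. Y i \<in> borel_measurable M"
    and le: "\<forall>\<^sub>F i in G. \<forall>\<omega>\<in>space M. \<bar>Y i \<omega>\<bar> \<le> \<bar>X i \<omega>\<bar>"
  shows "vanishing M G Y"
proof (rule vanishing_approx)
  show "bounded_moments M G Y"
    by (rule bounded_moments_dominated[OF vanishing_bounded[OF assms(1)] assms(2,3)])
  fix \<epsilon> :: real assume "0 < \<epsilon>"
  then have "\<forall>\<^sub>F i in G. \<forall>\<omega>\<in>space M. \<bar>Y i \<omega>\<bar> \<le> \<epsilon> + \<bar>X i \<omega>\<bar>"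
    using le by (auto elim!: eventually_mono intro: order_trans add_increasing)
  then show "\<exists>X. vanishing M G X \<and> (\<forall>\<^sub>F i in G. \<forall>\<omega>\<in>space M. \<bar>Y i \<omega>\<bar> \<le> \<epsilon> + \<bar>X i \<omega>\<bar>)"
    using assms(1) by blast
qed

lemma vanishing_cong:
  assumes "vanishing M G X" and e: "\<forall>\<^sub>F i in G. \<forall>\<omega>\<in>space M. X i \<omega> = Y i \<omega>"
  shows "vanishing M G Y"
proof (rule vanishing_dominated[OF assms(1)])
  show "\<forall>\<^sub>F i in G. Y i \<in> borel_measurable M"
    using bounded_moments_moments[OF bounded_moments_cong[OF vanishing_bounded[OF assms(1)] e]]
    by eventually_elim (rule all_moments_measurable)
  show "\<forall>\<^sub>F i in G. \<forall>\<omega>\<in>space M. \<bar>Y i \<omega>\<bar> \<le> \<bar>X i \<omega>\<bar>"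
    using e by eventually_elim auto
qed

section \<open>Limit rules for random variables\<close>

lemma mconv_bounded_limit: "mconv M G X U \<Longrightarrow> bounded_moments M G U"
  by (simp add: mconv_def)

lemma mconv_vanishing: "mconv M G X U \<Longrightarrow> vanishing M G (\<lambda>i \<omega>. X i \<omega> - U i \<omega>)"
  by (simp add: mconv_def)

lemma mconv_bounded: "mconv M G X U \<Longrightarrow> bounded_moments M G X"
  using bounded_moments_add[OF vanishing_bounded[OF mconv_vanishing] mconv_bounded_limit, of G X U X U]
  by simp

lemma mconv_refl: "bounded_moments M G U \<Longrightarrow> mconv M G U U"
  by (simp add: mconv_def vanishing_zero)

lemma mconv_const: "mconv M G (\<lambda>i \<omega>. c) (\<lambda>i \<omega>. c)"
  by (intro mconv_refl bounded_moments_const all_moments_const)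

lemma mconv_cong:
  assumes "mconv M G X U" and e: "\<forall>\<^sub>F i in G. \<forall>\<omega>\<in>space M. X i \<omega> = Y i \<omega>"
    and f: "\<forall>\<^sub>F i in G. \<forall>\<omega>\<in>space M. U i \<omega> = V i \<omega>"
  shows "mconv M G Y V"
  unfolding mconv_def
proof
  show "bounded_moments M G V"
    by (rule bounded_moments_cong[OF mconv_bounded_limit[OF assms(1)] f])
  show "vanishing M G (\<lambda>i \<omega>. Y i \<omega> - V i \<omega>)"
  proof (rule vanishing_cong[OF mconv_vanishing[OF assms(1)]])
    show "\<forall>\<^sub>F i in G. \<forall>\<omega>\<in>space M. X i \<omega> - U i \<omega> = Y i \<omega> - V i \<omega>"
      using e f by eventually_elim auto
  qed
qed

lemma mconv_add:
  assumes "mconv M G X U" "mconv M G Y V"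
  shows "mconv M G (\<lambda>i \<omega>. X i \<omega> + Y i \<omega>) (\<lambda>i \<omega>. U i \<omega> + V i \<omega>)"
  using vanishing_add[OF assms[THEN mconv_vanishing]] bounded_moments_add[OF assms[THEN mconv_bounded_limit]]
  by (simp add: mconv_def algebra_simps)

text \<open>X Y - U V = (X - U) Y + (Y - V) U, and each summand has one vanishing factor and one
  with bounded moments. The factors may therefore be correlated, as a gain and a residual
  are.\<close>

lemma mconv_mult:
  assumes "mconv M G X U" "mconv M G Y V"
  shows "mconv M G (\<lambda>i \<omega>. X i \<omega> * Y i \<omega>) (\<lambda>i \<omega>. U i \<omega> * V i \<omega>)"
proof -
  note v = assms[THEN mconv_vanishing] and b = assms[THEN mconv_bounded_limit]
  have "vanishing M G (\<lambda>i \<omega>. (X i \<omega> - U i \<omega>) * Y i \<omega> + (Y i \<omega> - V i \<omega>) * U i \<omega>)"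
    by (intro vanishing_add vanishing_mult v b mconv_bounded[OF assms(2)])
  then show ?thesis
    using bounded_moments_mult[OF b] by (simp add: mconv_def algebra_simps)
qed

lemma mconv_diff:
  assumes "mconv M G X U" "mconv M G Y V"
  shows "mconv M G (\<lambda>i \<omega>. X i \<omega> - Y i \<omega>) (\<lambda>i \<omega>. U i \<omega> - V i \<omega>)"
  using mconv_add[OF assms(1) mconv_mult[OF mconv_const[of _ "-1"] assms(2)]] by simp

lemma mconv_sum:
  assumes "\<And>a. a \<in> A \<Longrightarrow> mconv M G (\<lambda>i. X i a) (\<lambda>i. U i a)"
  shows "mconv M G (\<lambda>i \<omega>. \<Sum>a\<in>A. X i a \<omega>) (\<lambda>i \<omega>. \<Sum>a\<in>A. U i a \<omega>)"
  using assms
proof (induction A rule: infinite_finite_induct)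
  case (insert a A)
  then show ?case
    using mconv_add[of G "\<lambda>i. X i a" "\<lambda>i. U i a" "\<lambda>i \<omega>. \<Sum>a\<in>A. X i a \<omega>" "\<lambda>i \<omega>. \<Sum>a\<in>A. U i a \<omega>"]
    by simp
qed (simp_all add: mconv_const)

lemma mconv_filterlim:
  assumes "mconv M G X U" "filterlim f G F"
  shows "mconv M F (\<lambda>i. X (f i)) (\<lambda>i. U (f i))"
  using bounded_moments_filterlim[OF mconv_bounded_limit[OF assms(1)] assms(2)]
    vanishing_filterlim[OF mconv_vanishing[OF assms(1)] assms(2)]
  by (simp add: mconv_def)

lemma mconv_deterministic:
  assumes "(c \<longlongrightarrow> l) G"
  shows "mconv M G (\<lambda>i \<omega>. c i) (\<lambda>i \<omega>. l)"
proof -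
  have "((\<lambda>i. (c i - l)\<^sup>2) \<longlongrightarrow> (l - l)\<^sup>2) G" by (intro tendsto_intros assms)
  moreover have "bounded_moments M G (\<lambda>i \<omega>. c i - l)"
    unfolding bounded_moments_def
  proof (intro conjI allI exI)
    fix q
    have "((\<lambda>i. \<bar>c i - l\<bar> ^ q) \<longlongrightarrow> \<bar>l - l\<bar> ^ q) G" by (intro tendsto_intros assms)
    \<comment> \<open>The limit of the powers is kept as \<open>\<bar>l - l\<bar> ^ q\<close>
      because it is 1, not 0, for q = 0.\<close>
    then have "\<forall>\<^sub>F i in G. \<bar>c i - l\<bar> ^ q < \<bar>l - l\<bar> ^ q + 1" by (rule order_tendstoD) simp
    then show "\<forall>\<^sub>F i in G. (\<integral>\<omega>. \<bar>c i - l\<bar> ^ q \<partial>M) \<le> \<bar>l - l\<bar> ^ q + 1"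
      by eventually_elim (simp add: prob_space)
  qed (simp add: all_moments_const)
  ultimately show ?thesis
    by (simp add: mconv_def vanishing_def bounded_moments_const all_moments_const prob_space)
qed

end


section \<open>Ensembles and the law of large numbers\<close>

text \<open>
  Convergence along this filter is convergence along \<open>F\<close> uniformly in the members \<open>1, \<dots>, S i\<close> of the
  \<open>i\<close>-th ensemble, so the members need not be exchangeable.
\<close>

definition ensemble_filter :: "'i filter \<Rightarrow> ('i \<Rightarrow> nat) \<Rightarrow> ('i \<times> nat) filter" where
  "ensemble_filter F S = inf (filtercomap fst F) (principal {(i, n). n \<in> {1..S i}})"

text \<open>Unlike independence, this bundle is preserved by linear combinations of arbitrary
  families, so independence has to be shown only for the families from which all others are built.
  The averages run over members numbered from 1.\<close>

definition lln_family :: "'w measure \<Rightarrow> (nat \<Rightarrow> 'w \<Rightarrow> real) \<Rightarrow> real \<Rightarrow> bool" where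
  "lln_family M U w \<longleftrightarrow> bounded_moments M (principal {1..}) U \<and> (\<forall>n\<ge>1. (\<integral>\<omega>. U n \<omega> \<partial>M) = w) \<and>
     vanishing M sequentially (\<lambda>N \<omega>. (\<Sum>n=1..N. U n \<omega>) / real N - w)"

text \<open>The constants in \<open>const\<close> and \<open>cmult\<close> are the same for all
  members, which is what lets averages over the member index pass through. The rule
  \<open>cong\<close> compares members n \<ge> 1 at points of the space only, since that is where
  the dimensions of the inputs are known.\<close>

inductive affine_family ::
  "'w measure \<Rightarrow> (nat \<Rightarrow> 'w \<Rightarrow> real) set \<Rightarrow> (nat \<Rightarrow> 'w \<Rightarrow> real) \<Rightarrow> bool" for M \<Gamma> where
  const: "affine_family M \<Gamma> (\<lambda>n \<omega>. c)"
| generator: "g \<in> \<Gamma> \<Longrightarrow> affine_family M \<Gamma> g"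
| add: "affine_family M \<Gamma> U \<Longrightarrow> affine_family M \<Gamma> V \<Longrightarrow> affine_family M \<Gamma> (\<lambda>n \<omega>. U n \<omega> + V n \<omega>)"
| cmult: "affine_family M \<Gamma> U \<Longrightarrow> affine_family M \<Gamma> (\<lambda>n \<omega>. c * U n \<omega>)"
| cong: "affine_family M \<Gamma> U \<Longrightarrow> (\<And>n \<omega>. 1 \<le> n \<Longrightarrow> \<omega> \<in> space M \<Longrightarrow> U n \<omega> = V n \<omega>) \<Longrightarrow>
    affine_family M \<Gamma> V"

section \<open>Filters of ensemble members and sample means\<close>

lemma eventually_ensemble_filter:
  "eventually P (ensemble_filter F S) \<longleftrightarrow> (\<forall>\<^sub>F i in F. \<forall>n\<in>{1..S i}. P (i, n))"
proof -
  have "eventually P (ensemble_filter F S) \<longleftrightarrow>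
    (\<exists>Q. eventually Q F \<and> (\<forall>x. Q (fst x) \<longrightarrow> x \<in> {(i, n). n \<in> {1..S i}} \<longrightarrow> P x))"
    by (simp add: ensemble_filter_def eventually_inf_principal eventually_filtercomap)
  also have "\<dots> \<longleftrightarrow> (\<exists>Q. eventually Q F \<and> (\<forall>i. Q i \<longrightarrow> (\<forall>n\<in>{1..S i}. P (i, n))))"
    by auto
  also have "\<dots> \<longleftrightarrow> (\<forall>\<^sub>F i in F. \<forall>n\<in>{1..S i}. P (i, n))"
    by (auto elim: eventually_mono)
  finally show ?thesis .
qed

lemma filterlim_ensemble_fst: "filterlim fst F (ensemble_filter F S)"
  by (auto simp: filterlim_iff eventually_ensemble_filter elim: eventually_mono)

lemma filterlim_ensemble_snd: "filterlim snd (principal {1..}) (ensemble_filter F S)"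
  by (auto simp: filterlim_iff eventually_ensemble_filter eventually_principal)

text \<open>Growth of the sizes puts the fixed member n into all late ensembles, so a statement
  uniform over ensembles specializes to that member.\<close>

lemma filterlim_ensemble_member:
  assumes "filterlim S at_top F" "1 \<le> n"
  shows "filterlim (\<lambda>i. (i, n)) (ensemble_filter F S) F"
proof -
  have "\<forall>\<^sub>F i in F. n \<le> S i" using assms(1) by (simp add: filterlim_at_top)
  then have "\<forall>\<^sub>F i in F. P (i, n)" if "\<forall>\<^sub>F i in F. \<forall>n\<in>{1..S i}. P (i, n)" for P
    using that by eventually_elim (use assms(2) in auto)
  then show ?thesis
    unfolding filterlim_iff eventually_ensemble_filter by blast
qed

context prob_space
begin

text \<open>By Jensen's inequality the moment of a mean is at most the mean of the moments, and a
  bound uniform over the ensemble survives averaging. The inequality is a conclusion of its own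
  because mean square convergence needs it with q = 2.\<close>

lemma bounded_moments_mean:
  assumes X: "bounded_moments M (ensemble_filter F S) X" and S: "filterlim S at_top F"
  shows "bounded_moments M F (\<lambda>i \<omega>. (\<Sum>n=1..S i. X (i, n) \<omega>) / real (S i))"
    and "\<forall>\<^sub>F i in F. \<forall>q. (\<integral>\<omega>. \<bar>(\<Sum>n=1..S i. X (i, n) \<omega>) / real (S i)\<bar> ^ q \<partial>M)
      \<le> (\<Sum>n=1..S i. \<integral>\<omega>. \<bar>X (i, n) \<omega>\<bar> ^ q \<partial>M) / real (S i)" (is ?le)
proof -
  have m: "\<forall>\<^sub>F i in F. \<forall>n\<in>{1..S i}. all_moments M (X (i, n))"
    using bounded_moments_moments[OF X] by (simp add: eventually_ensemble_filter)
  have S1: "\<forall>\<^sub>F i in F. 1 \<le> S i" using S by (simp add: filterlim_at_top)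
  have am: "\<forall>\<^sub>F i in F. all_moments M (\<lambda>\<omega>. (\<Sum>n=1..S i. X (i, n) \<omega>) / real (S i))"
    using m
  proof eventually_elim
    case (elim i)
    then have "all_moments M (\<lambda>\<omega>. (1 / real (S i)) * (\<Sum>n=1..S i. X (i, n) \<omega>))"
      by (intro all_moments_cmult all_moments_sum) auto
    then show ?case by simp
  qed
  show le: ?le
    using m S1 am
  proof eventually_elim
    case (elim i)
    show ?case
    proof
      fix q
      have "(\<integral>\<omega>. \<bar>(\<Sum>n=1..S i. X (i, n) \<omega>) / real (S i)\<bar> ^ q \<partial>M)
        \<le> (\<integral>\<omega>. (\<Sum>n=1..S i. \<bar>X (i, n) \<omega>\<bar> ^ q) / real (S i) \<partial>M)"
        using elim by (intro integral_mono all_moments_abs_power abs_mean_power_le)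
          (auto intro!: integrable_divide all_moments_abs_power integrable_sum)
      also have "\<dots> = (\<Sum>n=1..S i. \<integral>\<omega>. \<bar>X (i, n) \<omega>\<bar> ^ q \<partial>M) / real (S i)"
        using elim by (auto intro!: Bochner_Integration.integral_sum all_moments_abs_power)
      finally show "(\<integral>\<omega>. \<bar>(\<Sum>n=1..S i. X (i, n) \<omega>) / real (S i)\<bar> ^ q \<partial>M)
        \<le> (\<Sum>n=1..S i. \<integral>\<omega>. \<bar>X (i, n) \<omega>\<bar> ^ q \<partial>M) / real (S i)" .
    qed
  qed
  have "\<exists>B. \<forall>\<^sub>F i in F. (\<integral>\<omega>. \<bar>(\<Sum>n=1..S i. X (i, n) \<omega>) / real (S i)\<bar> ^ q \<partial>M) \<le> B" for q
  proof -
    obtain B where B: "\<forall>\<^sub>F i in F. \<forall>n\<in>{1..S i}. (\<integral>\<omega>. \<bar>X (i, n) \<omega>\<bar> ^ q \<partial>M) \<le> B"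
      using X unfolding bounded_moments_def eventually_ensemble_filter by blast
    have "\<forall>\<^sub>F i in F. (\<integral>\<omega>. \<bar>(\<Sum>n=1..S i. X (i, n) \<omega>) / real (S i)\<bar> ^ q \<partial>M) \<le> B"
      using B le S1
    proof eventually_elim
      case (elim i)
      have "(\<Sum>n=1..S i. \<integral>\<omega>. \<bar>X (i, n) \<omega>\<bar> ^ q \<partial>M) \<le> of_nat (card {1..S i}) * B"
        using elim by (intro sum_bounded_above) auto
      then have "(\<Sum>n=1..S i. \<integral>\<omega>. \<bar>X (i, n) \<omega>\<bar> ^ q \<partial>M) / real (S i) \<le> B"
        using elim by (simp add: field_simps)
      then show ?case using elim(2) by (meson order_trans)
    qed
    then show ?thesis ..
  qed
  then show "bounded_moments M F (\<lambda>i \<omega>. (\<Sum>n=1..S i. X (i, n) \<omega>) / real (S i))"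
    using am by (simp add: bounded_moments_def)
qed

text \<open>All members of a late ensemble have a small second moment, and by convexity so has their
  mean. The estimate rests on convexity and not on cancellation, hence tolerates dependent
  members.\<close>

lemma vanishing_mean:
  assumes X: "vanishing M (ensemble_filter F S) X" and S: "filterlim S at_top F"
  shows "vanishing M F (\<lambda>i \<omega>. (\<Sum>n=1..S i. X (i, n) \<omega>) / real (S i))"
proof -
  note mean = bounded_moments_mean[OF vanishing_bounded[OF X] S]
  have S1: "\<forall>\<^sub>F i in F. 1 \<le> S i" using S by (simp add: filterlim_at_top)
  have "((\<lambda>i. \<integral>\<omega>. ((\<Sum>n=1..S i. X (i, n) \<omega>) / real (S i))\<^sup>2 \<partial>M) \<longlongrightarrow> 0) F"
  proof (rule tendstoI)
    fix e :: real assume e: "0 < e"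
    have "\<forall>\<^sub>F p in ensemble_filter F S. (\<integral>\<omega>. (X p \<omega>)\<^sup>2 \<partial>M) < e"
      using X e by (intro order_tendstoD(2)[where y = 0]) (simp_all add: vanishing_def)
    then have "\<forall>\<^sub>F i in F. \<forall>n\<in>{1..S i}. (\<integral>\<omega>. (X (i, n) \<omega>)\<^sup>2 \<partial>M) < e"
      by (simp add: eventually_ensemble_filter)
    then show "\<forall>\<^sub>F i in F. dist (\<integral>\<omega>. ((\<Sum>n=1..S i. X (i, n) \<omega>) / real (S i))\<^sup>2 \<partial>M) 0 < e"
      using mean(2) S1
    proof eventually_elim
      case (elim i)
      have "(\<Sum>n=1..S i. \<integral>\<omega>. (X (i, n) \<omega>)\<^sup>2 \<partial>M) < of_nat (card {1..S i}) * e"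
        using elim by (intro sum_bounded_above_strict) auto
      then have "(\<Sum>n=1..S i. \<integral>\<omega>. (X (i, n) \<omega>)\<^sup>2 \<partial>M) / real (S i) < e"
        using elim by (simp add: field_simps)
      moreover have "(\<integral>\<omega>. ((\<Sum>n=1..S i. X (i, n) \<omega>) / real (S i))\<^sup>2 \<partial>M)
          \<le> (\<Sum>n=1..S i. \<integral>\<omega>. (X (i, n) \<omega>)\<^sup>2 \<partial>M) / real (S i)"
        using elim(2)[rule_format, of 2] by (simp only: power2_abs)
      ultimately show ?case by (simp del: power_divide)
    qed
  qed
  then show ?thesis using mean(1) by (simp add: vanishing_def)
qed

section \<open>Laws of large numbers\<close>

lemma lln_family_moments: "lln_family M U w \<Longrightarrow> 1 \<le> n \<Longrightarrow> all_moments M (U n)"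
  by (auto simp: lln_family_def bounded_moments_def eventually_principal)

lemma lln_family_expectation: "lln_family M U w \<Longrightarrow> 1 \<le> n \<Longrightarrow> (\<integral>\<omega>. U n \<omega> \<partial>M) = w"
  by (simp add: lln_family_def)

lemma lln_family_vanishing:
  "lln_family M U w \<Longrightarrow> vanishing M sequentially (\<lambda>N \<omega>. (\<Sum>n=1..N. U n \<omega>) / real N - w)"
  by (simp add: lln_family_def)

lemma lln_family_bounded: "lln_family M U w \<Longrightarrow> bounded_moments M (principal {1..}) U"
  by (simp add: lln_family_def)

lemma lln_family_add:
  assumes "lln_family M U u" "lln_family M V v"
  shows "lln_family M (\<lambda>n \<omega>. U n \<omega> + V n \<omega>) (u + v)"
  unfolding lln_family_def
proof (intro conjI allI impI)
  show "bounded_moments M (principal {1..}) (\<lambda>n \<omega>. U n \<omega> + V n \<omega>)"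
    by (intro bounded_moments_add assms[THEN lln_family_bounded])
  show "(\<integral>\<omega>. U n \<omega> + V n \<omega> \<partial>M) = u + v" if "1 \<le> n" for n
    using that assms
    by (simp add: lln_family_expectation lln_family_moments all_moments_integrable)
  show "vanishing M sequentially (\<lambda>N \<omega>. (\<Sum>n=1..N. U n \<omega> + V n \<omega>) / real N - (u + v))"
    using vanishing_add[OF assms[THEN lln_family_vanishing]]
    by (simp add: sum.distrib add_divide_distrib algebra_simps)
qed

lemma lln_family_cmult:
  assumes "lln_family M U u"
  shows "lln_family M (\<lambda>n \<omega>. c * U n \<omega>) (c * u)"
  unfolding lln_family_def
proof (intro conjI allI impI)
  show "bounded_moments M (principal {1..}) (\<lambda>n \<omega>. c * U n \<omega>)"
    by (intro bounded_moments_cmult assms[THEN lln_family_bounded])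
  show "(\<integral>\<omega>. c * U n \<omega> \<partial>M) = c * u" if "1 \<le> n" for n
    using that assms by (simp add: lln_family_expectation)
  show "vanishing M sequentially (\<lambda>N \<omega>. (\<Sum>n=1..N. c * U n \<omega>) / real N - c * u)"
    using vanishing_cmult[OF assms[THEN lln_family_vanishing], of c]
    by (simp add: sum_distrib_left[symmetric] algebra_simps)
qed

lemma lln_family_cong:
  assumes U: "lln_family M U u" and e: "\<And>n \<omega>. 1 \<le> n \<Longrightarrow> \<omega> \<in> space M \<Longrightarrow> U n \<omega> = V n \<omega>"
  shows "lln_family M V u"
  unfolding lln_family_def
proof (intro conjI allI impI)
  show "bounded_moments M (principal {1..}) V"
    by (rule bounded_moments_cong[OF lln_family_bounded[OF U]]) (simp add: e eventually_principal)
  show "(\<integral>\<omega>. V n \<omega> \<partial>M) = u" if "1 \<le> n" for n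
    using that lln_family_expectation[OF U that]
      Bochner_Integration.integral_cong[OF refl, of M "U n" "V n"] by (simp add: e)
  show "vanishing M sequentially (\<lambda>N \<omega>. (\<Sum>n=1..N. V n \<omega>) / real N - u)"
    by (rule vanishing_cong[OF lln_family_vanishing[OF U]])
      (auto simp: e intro!: always_eventually sum.cong arg_cong2[where f = "(/)"])
qed

lemma lln_family_const: "lln_family M (\<lambda>n \<omega>. c) c"
  unfolding lln_family_def
proof (intro conjI allI impI)
  show "vanishing M sequentially (\<lambda>N \<omega>. (\<Sum>n=1..N. c) / real N - c)"
    \<comment> \<open>From N = 1 on: at N = 0 division by zero makes the average 0 and the
      difference -c.\<close>
    by (rule vanishing_cong[OF vanishing_zero], rule eventually_sequentiallyI[of 1]) simp
qed (simp_all add: bounded_moments_const all_moments_const prob_space)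

lemma indep_vars_expectation_mult:
  assumes "indep_vars (\<lambda>_. borel) X I" "a \<in> I" "b \<in> I" "a \<noteq> b"
    and "integrable M (X a)" "integrable M (X b :: _ \<Rightarrow> real)"
  shows "(\<integral>\<omega>. X a \<omega> * X b \<omega> \<partial>M) = (\<integral>\<omega>. X a \<omega> \<partial>M) * (\<integral>\<omega>. X b \<omega> \<partial>M)"
  using indep_vars_lebesgue_integral[of "{a, b}" X] indep_vars_subset[OF assms(1), of "{a, b}"] assms
  by auto

text \<open>The classical mean square argument: centred independent variables are uncorrelated, so
  the second moment of their average is at most B / N for a common bound B of the variances. A
  common mean and uniformly bounded moments take the place of identical distribution.\<close>

lemma lln_family_independent:
  assumes b: "bounded_moments M (principal {1..}) U"
    and ind: "indep_vars (\<lambda>_. borel) U {1..}"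
    and w: "\<And>n. 1 \<le> n \<Longrightarrow> (\<integral>\<omega>. U n \<omega> \<partial>M) = w"
  shows "lln_family M U w"
proof -
  define D where "D n \<omega> = U n \<omega> - w" for n \<omega>
  have bD: "bounded_moments M (principal {1..}) D"
    unfolding D_def by (intro bounded_moments_diff b bounded_moments_const all_moments_const)
  have Dm: "all_moments M (D n)" if "1 \<le> n" for n
    using bounded_moments_moments[OF bD] that by (simp add: eventually_principal)
  have Um: "all_moments M (U n)" if "1 \<le> n" for n
    using bounded_moments_moments[OF b] that by (simp add: eventually_principal)
  have indD: "indep_vars (\<lambda>_. borel) D {1..}"
    unfolding D_def by (rule indep_vars_compose2[OF ind]) simp
  have D0: "(\<integral>\<omega>. D n \<omega> \<partial>M) = 0" if "1 \<le> n" for n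
    using that w[OF that] Um[OF that] by (simp add: D_def all_moments_integrable prob_space)
  have cov: "(\<integral>\<omega>. D n \<omega> * D n' \<omega> \<partial>M) = 0" if "1 \<le> n" "1 \<le> n'" "n \<noteq> n'" for n n'
    using indep_vars_expectation_mult[OF indD, of n n'] that D0 Dm
    by (simp add: all_moments_integrable)
  obtain B where B: "\<And>n. 1 \<le> n \<Longrightarrow> (\<integral>\<omega>. (D n \<omega>)\<^sup>2 \<partial>M) \<le> B"
  proof -
    obtain B where "\<forall>\<^sub>F n in principal {1..}. (\<integral>\<omega>. \<bar>D n \<omega>\<bar> ^ 2 \<partial>M) \<le> B"
      using bD unfolding bounded_moments_def by blast
    then have "\<And>n. 1 \<le> n \<Longrightarrow> (\<integral>\<omega>. (D n \<omega>)\<^sup>2 \<partial>M) \<le> B" by (simp add: eventually_principal)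
    then show ?thesis by (rule that)
  qed
  have var: "(\<integral>\<omega>. ((\<Sum>n=1..N. D n \<omega>) / real N)\<^sup>2 \<partial>M) \<le> B / real N" if N: "1 \<le> N" for N
  proof -
    have "(\<integral>\<omega>. (\<Sum>n=1..N. D n \<omega>)\<^sup>2 \<partial>M) = (\<integral>\<omega>. (\<Sum>n=1..N. \<Sum>n'=1..N. D n \<omega> * D n' \<omega>) \<partial>M)"
      by (simp add: power2_eq_square sum_product)
    also have "\<dots> = (\<Sum>n=1..N. \<Sum>n'=1..N. \<integral>\<omega>. D n \<omega> * D n' \<omega> \<partial>M)"
    proof (subst Bochner_Integration.integral_sum)
      have p: "integrable M (\<lambda>\<omega>. D n \<omega> * D n' \<omega>)" if "n \<in> {1..N}" "n' \<in> {1..N}" for n n'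
        using that by (intro all_moments_integrable all_moments_mult Dm) auto
      then show "integrable M (\<lambda>\<omega>. \<Sum>n'=1..N. D n \<omega> * D n' \<omega>)" if "n \<in> {1..N}" for n
        using that by (intro Bochner_Integration.integrable_sum)
      show "(\<Sum>n=1..N. \<integral>\<omega>. (\<Sum>n'=1..N. D n \<omega> * D n' \<omega>) \<partial>M)
          = (\<Sum>n=1..N. \<Sum>n'=1..N. \<integral>\<omega>. D n \<omega> * D n' \<omega> \<partial>M)"
        using p by (intro sum.cong refl Bochner_Integration.integral_sum)
    qed
    \<comment> \<open>Independence removes every term off the diagonal.\<close>
    also have "\<dots> = (\<Sum>n=1..N. \<Sum>n'=1..N. if n' = n then \<integral>\<omega>. (D n \<omega>)\<^sup>2 \<partial>M else 0)"
      by (intro sum.cong refl) (auto simp: cov power2_eq_square)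
    also have "\<dots> = (\<Sum>n=1..N. \<integral>\<omega>. (D n \<omega>)\<^sup>2 \<partial>M)"
      by (intro sum.cong refl) simp
    also have "\<dots> \<le> of_nat (card {1..N}) * B"
      by (intro sum_bounded_above B) simp
    finally have "(\<integral>\<omega>. (\<Sum>n=1..N. D n \<omega>)\<^sup>2 \<partial>M) / (real N)\<^sup>2 \<le> (real N * B) / (real N)\<^sup>2"
      by (intro divide_right_mono) auto
    also have "(real N * B) / (real N)\<^sup>2 = B / real N"
      by (simp add: power2_eq_square)
    finally show ?thesis by (simp add: power_divide)
  qed
  have "vanishing M sequentially (\<lambda>N \<omega>. (\<Sum>n=1..N. D n \<omega>) / real N)"
    unfolding vanishing_def
  proof
    have id: "filterlim (\<lambda>N. N) at_top sequentially" by (rule filterlim_ident)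
    show "bounded_moments M sequentially (\<lambda>N \<omega>. (\<Sum>n=1..N. D n \<omega>) / real N)"
      \<comment> \<open>The ensemble of index N consists of the members 1 to N, so the size function
        is the identity.\<close>
      using bounded_moments_mean(1)[OF bounded_moments_filterlim[OF bD filterlim_ensemble_snd] id] by simp
    have l: "(\<lambda>N. B / real N) \<longlonglongrightarrow> 0" by (rule lim_const_over_n)
    show "(\<lambda>N. \<integral>\<omega>. ((\<Sum>n=1..N. D n \<omega>) / real N)\<^sup>2 \<partial>M) \<longlonglongrightarrow> 0"
      by (rule tendsto_sandwich[OF _ _ tendsto_const l])
        (auto intro!: eventually_sequentiallyI[of 1] var[simplified])
  qed
  then have "vanishing M sequentially (\<lambda>N \<omega>. (\<Sum>n=1..N. U n \<omega>) / real N - w)"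
    by (rule vanishing_cong)
      (rule eventually_sequentiallyI[of 1], simp add: D_def sum_subtractf diff_divide_distrib)
  then show ?thesis using b w by (simp add: lln_family_def)
qed

text \<open>The error is the mean of X - U, small because every member is close to its reference,
  plus the deviation of the reference mean from \<open>w\<close>.\<close>

lemma mconv_mean:
  assumes X: "mconv M (ensemble_filter F S) X (\<lambda>p. U (snd p))" and U: "lln_family M U w"
    and S: "filterlim S at_top F"
  shows "mconv M F (\<lambda>i \<omega>. (\<Sum>n=1..S i. X (i, n) \<omega>) / real (S i)) (\<lambda>i \<omega>. w)"
proof -
  have "vanishing M F (\<lambda>i \<omega>. (\<Sum>n=1..S i. X (i, n) \<omega> - U n \<omega>) / real (S i)
      + ((\<Sum>n=1..S i. U n \<omega>) / real (S i) - w))"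
    using vanishing_mean[OF mconv_vanishing[OF X] S]
    by (intro vanishing_add vanishing_filterlim[OF lln_family_vanishing[OF U] S]) simp
  then show ?thesis
    by (simp add: mconv_def bounded_moments_const all_moments_const sum_subtractf diff_divide_distrib)
qed

text \<open>Replaces centred products, whose centring is itself random, by averages of uncentred
  quantities, to which the law of large numbers applies.\<close>

lemma sample_covariance_eq:
  fixes x y :: "nat \<Rightarrow> real"
  assumes "2 \<le> N"
  shows "real N / (real N - 1) * ((\<Sum>n=1..N. x n * y n) / real N
      - ((\<Sum>n=1..N. x n) / real N) * ((\<Sum>n=1..N. y n) / real N))
    = (\<Sum>n=1..N. (x n - (\<Sum>n=1..N. x n) / real N) * (y n - (\<Sum>n=1..N. y n) / real N)) / (real N - 1)"
proof -
  define p r where "p = (\<Sum>n=1..N. x n) / real N" and "r = (\<Sum>n=1..N. y n) / real N"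
  have s: "(\<Sum>n=1..N. x n) = real N * p" "(\<Sum>n=1..N. y n) = real N * r"
    using assms by (simp_all add: p_def r_def)
  have "(\<Sum>n=1..N. (x n - p) * (y n - r)) = (\<Sum>n=1..N. x n * y n - p * y n - r * x n + p * r)"
    by (intro sum.cong refl) (simp add: algebra_simps)
  also have "\<dots> = (\<Sum>n=1..N. x n * y n) - p * (\<Sum>n=1..N. y n) - r * (\<Sum>n=1..N. x n) + real N * (p * r)"
    by (simp add: sum_subtractf sum.distrib sum_distrib_left)
  finally have e: "(\<Sum>n=1..N. (x n - p) * (y n - r)) = (\<Sum>n=1..N. x n * y n) - real N * (p * r)"
    by (simp only: s) (simp add: algebra_simps)
  show ?thesis
    unfolding p_def[symmetric] r_def[symmetric] e using assms by (simp add: field_simps)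
qed

text \<open>The limit is written with member 1 in order to match \<open>cov_mat\<close> in the
  reference ensemble; any member gives the same value, because the three families have common
  means.\<close>

lemma mconv_sample_covariance:
  assumes X: "mconv M (ensemble_filter F S) X (\<lambda>p. U (snd p))"
    and Y: "mconv M (ensemble_filter F S) Y (\<lambda>p. V (snd p))"
    and U: "lln_family M U u" and V: "lln_family M V v"
    and UV: "lln_family M (\<lambda>n \<omega>. U n \<omega> * V n \<omega>) w"
    and S: "filterlim S at_top F"
  shows "mconv M F
    (\<lambda>i \<omega>. (\<Sum>n=1..S i. (X (i, n) \<omega> - (\<Sum>n=1..S i. X (i, n) \<omega>) / real (S i))
        * (Y (i, n) \<omega> - (\<Sum>n=1..S i. Y (i, n) \<omega>) / real (S i))) / (real (S i) - 1))
    (\<lambda>i \<omega>. \<integral>\<omega>. (U 1 \<omega> - (\<integral>\<omega>. U 1 \<omega> \<partial>M)) * (V 1 \<omega> - (\<integral>\<omega>. V 1 \<omega> \<partial>M)) \<partial>M)"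
proof -
  have lim: "((\<lambda>i. real (S i) / (real (S i) - 1)) \<longlongrightarrow> 1) F"
  proof (rule filterlim_compose[OF _ S])
    \<comment> \<open>Shifted by one, the factor N / (N - 1) reads (N + 1) / N.\<close>
    have "(\<lambda>N. real (Suc N) / (real (Suc N) - 1)) \<longlonglongrightarrow> 1"
      using LIMSEQ_Suc_n_over_n by simp
    then show "(\<lambda>N. real N / (real N - 1)) \<longlonglongrightarrow> 1"
      by (rule filterlim_sequentially_Suc[THEN iffD1])
  qed
  have "mconv M F
      (\<lambda>i \<omega>. real (S i) / (real (S i) - 1) * ((\<Sum>n=1..S i. X (i, n) \<omega> * Y (i, n) \<omega>) / real (S i)
        - ((\<Sum>n=1..S i. X (i, n) \<omega>) / real (S i)) * ((\<Sum>n=1..S i. Y (i, n) \<omega>) / real (S i))))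
      (\<lambda>i \<omega>. 1 * (w - u * v))"
    by (intro mconv_mult mconv_diff mconv_deterministic[OF lim] mconv_mean[OF X U S]
        mconv_mean[OF Y V S] mconv_mean[OF _ UV S] X Y)
  then show ?thesis
  proof (rule mconv_cong)
    have S2: "\<forall>\<^sub>F i in F. 2 \<le> S i" using S by (simp add: filterlim_at_top)
    show "\<forall>\<^sub>F i in F. \<forall>\<omega>\<in>space M.
      real (S i) / (real (S i) - 1) * ((\<Sum>n=1..S i. X (i, n) \<omega> * Y (i, n) \<omega>) / real (S i)
        - ((\<Sum>n=1..S i. X (i, n) \<omega>) / real (S i)) * ((\<Sum>n=1..S i. Y (i, n) \<omega>) / real (S i)))
      = (\<Sum>n=1..S i. (X (i, n) \<omega> - (\<Sum>n=1..S i. X (i, n) \<omega>) / real (S i))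
        * (Y (i, n) \<omega> - (\<Sum>n=1..S i. Y (i, n) \<omega>) / real (S i))) / (real (S i) - 1)"
      using S2
      by eventually_elim (intro ballI sample_covariance_eq)
    have mU: "all_moments M (U 1)" "(\<integral>\<omega>. U 1 \<omega> \<partial>M) = u" and mV: "all_moments M (V 1)" "(\<integral>\<omega>. V 1 \<omega> \<partial>M) = v"
      using lln_family_moments[OF U, of 1] lln_family_moments[OF V, of 1]
        lln_family_expectation[OF U, of 1] lln_family_expectation[OF V, of 1] by simp_all
    have "(\<integral>\<omega>. (U 1 \<omega> - u) * (V 1 \<omega> - v) \<partial>M) = (\<integral>\<omega>. U 1 \<omega> * V 1 \<omega> - u * V 1 \<omega> - v * U 1 \<omega> + u * v \<partial>M)"
      by (simp add: algebra_simps)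
    also have "\<dots> = w - u * v"
      using mU mV lln_family_expectation[OF UV, of 1]
      by (simp add: all_moments_integrable all_moments_mult prob_space)
    finally show "\<forall>\<^sub>F i in F. \<forall>\<omega>\<in>space M. 1 * (w - u * v)
      = (\<integral>\<omega>. (U 1 \<omega> - (\<integral>\<omega>. U 1 \<omega> \<partial>M)) * (V 1 \<omega> - (\<integral>\<omega>. V 1 \<omega> \<partial>M)) \<partial>M)"
      using mU(2) mV(2) by simp
  qed
qed

lemma lln_family_affine:
  assumes \<Gamma>: "\<And>g. g \<in> \<Gamma> \<Longrightarrow> \<exists>w. lln_family M g w" and U: "affine_family M \<Gamma> U"
  shows "\<exists>w. lln_family M U w"
  using U
proof induction
  case (const c)
  show ?case using lln_family_const by blast
next
  case (generator g)
  then show ?case by (rule \<Gamma>)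
next
  case (add U V)
  then show ?case using lln_family_add by blast
next
  case (cmult U c)
  then show ?case using lln_family_cmult by blast
next
  case (cong U V)
  then show ?case using lln_family_cong by metis
qed

text \<open>The product is bilinear: the inner induction runs over \<open>V\<close> against a single
  generator, the outer one over \<open>U\<close>. Only pairwise products of generators remain to be
  supplied.\<close>

lemma lln_family_affine_mult:
  assumes \<Gamma>: "\<And>g. g \<in> \<Gamma> \<Longrightarrow> \<exists>w. lln_family M g w"
    and \<Gamma>2: "\<And>g h. g \<in> \<Gamma> \<Longrightarrow> h \<in> \<Gamma> \<Longrightarrow> \<exists>w. lln_family M (\<lambda>n \<omega>. g n \<omega> * h n \<omega>) w"
    and U: "affine_family M \<Gamma> U" and V: "affine_family M \<Gamma> V"
  shows "\<exists>w. lln_family M (\<lambda>n \<omega>. U n \<omega> * V n \<omega>) w"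
proof -
  have gen: "\<exists>w. lln_family M (\<lambda>n \<omega>. g n \<omega> * V n \<omega>) w" if g: "g \<in> \<Gamma>" for g
    using V
  proof induction
    case (const c)
    then show ?case using \<Gamma>[OF g] lln_family_cmult[of g _ c] by (auto simp: mult.commute)
  next
    case (generator h)
    then show ?case using \<Gamma>2 g by blast
  next
    case (add U U')
    then obtain w w' where "lln_family M (\<lambda>n \<omega>. g n \<omega> * U n \<omega>) w" "lln_family M (\<lambda>n \<omega>. g n \<omega> * U' n \<omega>) w'"
      by blast
    from lln_family_add[OF this] show ?case by (auto simp: distrib_left)
  next
    case (cmult U c)
    then obtain w where "lln_family M (\<lambda>n \<omega>. g n \<omega> * U n \<omega>) w" by blast
    from lln_family_cmult[OF this, of c] show ?case by (auto simp: mult.left_commute)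
  next
    case (cong U V)
    then obtain w where "lln_family M (\<lambda>n \<omega>. g n \<omega> * U n \<omega>) w" by blast
    from lln_family_cong[OF this, of "\<lambda>n \<omega>. g n \<omega> * V n \<omega>"] show ?case using cong by auto
  qed
  show ?thesis
    using U
  proof induction
    case (const c)
    then show ?case using lln_family_affine[OF \<Gamma> V] lln_family_cmult[of V _ c] by blast
  next
    case (generator h)
    then show ?case by (rule gen)
  next
    case (add U U')
    then obtain w w' where "lln_family M (\<lambda>n \<omega>. U n \<omega> * V n \<omega>) w" "lln_family M (\<lambda>n \<omega>. U' n \<omega> * V n \<omega>) w'"
      by blast
    from lln_family_add[OF this] show ?case by (auto simp: distrib_right)
  next
    case (cmult U c)
    then obtain w where "lln_family M (\<lambda>n \<omega>. U n \<omega> * V n \<omega>) w" by blast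
    from lln_family_cmult[OF this, of c] show ?case by (auto simp: mult.assoc)
  next
    case (cong U U')
    then obtain w where "lln_family M (\<lambda>n \<omega>. U n \<omega> * V n \<omega>) w" by blast
    from lln_family_cong[OF this, of "\<lambda>n \<omega>. U' n \<omega> * V n \<omega>"] show ?case using cong by auto
  qed
qed

end


section \<open>Continuous functions of random vectors\<close>

lemma space_borel_vec: "space (borel_vec n) = carrier_vec n"
  by (auto simp: borel_vec_def intro!: space_measure_of)

lemma borel_vec_halfspace: "a < n \<Longrightarrow> {v \<in> carrier_vec n. v $ a \<le> c} \<in> sets (borel_vec n)"
  unfolding borel_vec_def by (subst sets_measure_of) auto

lemma measurable_borel_vec_iff:
  "X \<in> measurable M (borel_vec n) \<longleftrightarrow>
    (\<forall>\<omega>\<in>space M. X \<omega> \<in> carrier_vec n) \<and> (\<forall>a<n. (\<lambda>\<omega>. X \<omega> $ a) \<in> borel_measurable M)"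
proof safe
  assume X: "X \<in> measurable M (borel_vec n)"
  show "X \<omega> \<in> carrier_vec n" if "\<omega> \<in> space M" for \<omega>
    using measurable_space[OF X that] by (simp add: space_borel_vec)
  fix a assume "a < n"
  then have "(\<lambda>v. v $ a) \<in> borel_measurable (borel_vec n)"
    by (subst borel_measurable_iff_le) (simp add: space_borel_vec borel_vec_halfspace)
  then show "(\<lambda>\<omega>. X \<omega> $ a) \<in> borel_measurable M"
    by (rule measurable_compose[OF X])
next
  assume c: "\<forall>\<omega>\<in>space M. X \<omega> \<in> carrier_vec n" and m: "\<forall>a<n. (\<lambda>\<omega>. X \<omega> $ a) \<in> borel_measurable M"
  show "X \<in> measurable M (borel_vec n)"
    unfolding borel_vec_def
  proof (rule measurable_measure_of)
    show "{{v \<in> carrier_vec n. v $ a \<le> c} |a c. a < n} \<subseteq> Pow (carrier_vec n)" by auto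
    show "X \<in> space M \<rightarrow> carrier_vec n" using c by auto
    fix A :: "rvec set" assume "A \<in> {{v \<in> carrier_vec n. v $ a \<le> c} |a c. a < n}"
    then obtain a c' where A: "A = {v \<in> carrier_vec n. v $ a \<le> c'}" "a < n" by blast
    have "X -` A \<inter> space M = {\<omega> \<in> space M. X \<omega> $ a \<le> c'}"
      using c A by auto
    then show "X -` A \<inter> space M \<in> sets M"
      using m A borel_measurable_iff_le by auto
  qed
qed

lemma enorm_nonneg: "0 \<le> enorm v"
  by (simp add: enorm_def scalar_prod_def sum_nonneg)

text \<open>Together with \<open>enorm_le_sum\<close> this allows convergence of vectors to be
  treated coordinate by coordinate.\<close>

lemma abs_component_le_enorm: "v \<in> carrier_vec n \<Longrightarrow> a < n \<Longrightarrow> \<bar>v $ a\<bar> \<le> enorm v"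
  unfolding enorm_def scalar_prod_def
  using member_le_sum[of a "{0..<dim_vec v}" "\<lambda>i. v $ i * v $ i"]
  by (intro real_le_rsqrt) (auto simp: power2_eq_square)

lemma enorm_le_sum: "v \<in> carrier_vec n \<Longrightarrow> enorm v \<le> (\<Sum>a<n. \<bar>v $ a\<bar>)"
  unfolding enorm_def scalar_prod_def
  using L2_set_le_sum_abs[of "\<lambda>a. v $ a" "{..<n}"]
  by (auto simp: L2_set_def power2_eq_square atLeast0LessThan)

text \<open>Continuity is relative to \<open>carrier_vec n\<close>, since the type contains vectors
  of every length.\<close>

definition vcontinuous :: "nat \<Rightarrow> (rvec \<Rightarrow> real) \<Rightarrow> bool" where
  "vcontinuous n f \<longleftrightarrow> (\<forall>x\<in>carrier_vec n. \<forall>\<epsilon>>0. \<exists>\<delta>>0. \<forall>y\<in>carrier_vec n.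
     enorm (y - x) < \<delta> \<longrightarrow> \<bar>f y - f x\<bar> < \<epsilon>)"

text \<open>The natural exponent lets the bounds on natural moments apply without
  interpolation.\<close>

definition poly_growth :: "nat \<Rightarrow> (rvec \<Rightarrow> real) \<Rightarrow> bool" where
  "poly_growth n f \<longleftrightarrow> (\<exists>c r. 0 \<le> c \<and> (\<forall>x\<in>carrier_vec n. \<bar>f x\<bar> \<le> c * (1 + enorm x) ^ r))"

text \<open>The question is moved to real sequences with the product topology: read there, the
  function is continuous because it depends on the first n coordinates only, and measurability into
  the countable product is checked coordinatewise.\<close>

lemma borel_measurable_vcontinuous:
  assumes f: "vcontinuous n f" and X: "X \<in> measurable M (borel_vec n)"
  shows "(\<lambda>\<omega>. f (X \<omega>)) \<in> borel_measurable M"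
proof -
  have "isCont (\<lambda>y. f (Matrix.vec n y)) x" for x :: "nat \<Rightarrow> real"
    unfolding isCont_def
  proof (rule tendstoI)
    fix e :: real assume "0 < e"
    then have "\<exists>\<delta>>0. \<forall>y\<in>carrier_vec n. enorm (y - Matrix.vec n x) < \<delta> \<longrightarrow> \<bar>f y - f (Matrix.vec n x)\<bar> < e"
      using bspec[OF f[unfolded vcontinuous_def] vec_carrier[of n x]] by blast
    then obtain \<delta> where \<delta>: "\<delta> > 0"
      and d: "\<forall>y\<in>carrier_vec n. enorm (y - Matrix.vec n x) < \<delta> \<longrightarrow> \<bar>f y - f (Matrix.vec n x)\<bar> < e"
      by (elim exE conjE)
    have "((\<lambda>y. \<Sum>a<n. \<bar>y a - x a\<bar>) \<longlongrightarrow> (\<Sum>a<n. \<bar>x a - x a\<bar>)) (at x)"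
      using continuous_on_product_coordinates[THEN continuous_on_eq_continuous_at[OF open_UNIV, THEN iffD1]]
      by (intro tendsto_intros) (auto simp: isCont_def)
    then have "\<forall>\<^sub>F y in at x. (\<Sum>a<n. \<bar>y a - x a\<bar>) < \<delta>"
      using \<delta> by (intro order_tendstoD(2)) auto
    then show "\<forall>\<^sub>F y in at x. dist (f (Matrix.vec n y)) (f (Matrix.vec n x)) < e"
    proof eventually_elim
      case (elim y)
      have "enorm (Matrix.vec n y - Matrix.vec n x) \<le> (\<Sum>a<n. \<bar>y a - x a\<bar>)"
        using enorm_le_sum[of "Matrix.vec n y - Matrix.vec n x" n] by simp
      then show ?case using elim d by (simp add: dist_real_def)
    qed
  qed
  then have "(\<lambda>y. f (Matrix.vec n y)) \<in> borel_measurable borel"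
    by (intro borel_measurable_continuous_onI continuous_at_imp_continuous_on) auto
  \<comment> \<open>Padding by zero turns the random vector into a random sequence without changing
    its first n coordinates.\<close>
  moreover have "(\<lambda>\<omega> a. if a < n then X \<omega> $ a else 0) \<in> borel_measurable M"
  proof (rule measurable_coordinatewise_then_product)
    show "(\<lambda>\<omega>. if a < n then X \<omega> $ a else 0) \<in> borel_measurable M" for a
      using X by (cases "a < n") (auto simp: measurable_borel_vec_iff)
  qed
  ultimately have "(\<lambda>\<omega>. f (Matrix.vec n (\<lambda>a. if a < n then X \<omega> $ a else 0))) \<in> borel_measurable M"
    by (rule measurable_compose[rotated])
  moreover have "Matrix.vec n (\<lambda>a. if a < n then X \<omega> $ a else 0) = X \<omega>" if "\<omega> \<in> space M" for \<omega>
    using X that by (intro eq_vecI) (auto simp: measurable_borel_vec_iff)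
  ultimately show ?thesis by (simp cong: measurable_cong)
qed

lemma enorm_mult_mat_vec_le:
  assumes A: "A \<in> carrier_mat q p" and v: "v \<in> carrier_vec p"
  shows "enorm (A *\<^sub>v v) \<le> (\<Sum>a<q. \<Sum>b<p. \<bar>A $$ (a, b)\<bar>) * enorm v"
proof -
  have "enorm (A *\<^sub>v v) \<le> (\<Sum>a<q. \<bar>(A *\<^sub>v v) $ a\<bar>)"
    using A v by (intro enorm_le_sum) auto
  also have "\<dots> \<le> (\<Sum>a<q. \<Sum>b<p. \<bar>A $$ (a, b)\<bar> * enorm v)"
  proof (rule sum_mono)
    fix a assume a: "a \<in> {..<q}"
    have "(A *\<^sub>v v) $ a = (\<Sum>b<p. A $$ (a, b) * v $ b)"
      using A v a by (auto simp: scalar_prod_def atLeast0LessThan intro!: sum.cong)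
    then have "\<bar>(A *\<^sub>v v) $ a\<bar> \<le> (\<Sum>b<p. \<bar>A $$ (a, b) * v $ b\<bar>)" by simp
    also have "\<dots> \<le> (\<Sum>b<p. \<bar>A $$ (a, b)\<bar> * enorm v)"
      using v by (intro sum_mono) (auto simp: abs_mult intro!: mult_left_mono abs_component_le_enorm)
    finally show "\<bar>(A *\<^sub>v v) $ a\<bar> \<le> (\<Sum>b<p. \<bar>A $$ (a, b)\<bar> * enorm v)" .
  qed
  finally show ?thesis by (simp add: sum_distrib_right)
qed

text \<open>The entry is a coordinate of the image of a unit vector.\<close>

lemma abs_entry_le_spectral_norm:
  assumes A: "A \<in> carrier_mat q p" and a: "a < q" and b: "b < p"
  shows "\<bar>A $$ (a, b)\<bar> \<le> spectral_norm A"
proof -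
  have u: "unit_vec p b \<in> carrier_vec p" "enorm (unit_vec p b) \<le> 1"
    using b by (simp_all add: enorm_def)
  have "A $$ (a, b) = (A *\<^sub>v unit_vec p b) $ a"
    using A a b by (auto simp: scalar_prod_right_unit)
  also have "\<bar>\<dots>\<bar> \<le> enorm (A *\<^sub>v unit_vec p b)"
    using A a by (intro abs_component_le_enorm) auto
  also have "\<dots> \<le> spectral_norm A"
    unfolding spectral_norm_def
  proof (rule cSUP_upper)
    show "unit_vec p b \<in> {v \<in> carrier_vec (dim_col A). enorm v \<le> 1}" using u A by auto
    \<comment> \<open>A supremum of reals is an upper bound only if the set is bounded above; on the
      unit ball the sum of all absolute entries is such a bound.\<close>
    show "bdd_above ((\<lambda>v. enorm (A *\<^sub>v v)) ` {v \<in> carrier_vec (dim_col A). enorm v \<le> 1})"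
    proof (rule bdd_aboveI2)
      fix v assume v: "v \<in> {v \<in> carrier_vec (dim_col A). enorm v \<le> 1}"
      have "enorm (A *\<^sub>v v) \<le> (\<Sum>a<q. \<Sum>b<p. \<bar>A $$ (a, b)\<bar>) * enorm v"
        using A v by (intro enorm_mult_mat_vec_le) auto
      also have "\<dots> \<le> (\<Sum>a<q. \<Sum>b<p. \<bar>A $$ (a, b)\<bar>) * 1"
        using v by (intro mult_left_mono) (auto intro!: sum_nonneg)
      finally show "enorm (A *\<^sub>v v) \<le> (\<Sum>a<q. \<Sum>b<p. \<bar>A $$ (a, b)\<bar>)" by simp
    qed
  qed
  finally show ?thesis .
qed

lemma vcontinuous_differentiable:
  assumes f: "has_jacobian p q f J" and a: "a < q"
  shows "vcontinuous p (\<lambda>x. f x $ a)"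
  unfolding vcontinuous_def
proof (intro ballI allI impI)
  fix x :: rvec and \<epsilon> :: real assume x: "x \<in> carrier_vec p" and \<epsilon>: "0 < \<epsilon>"
  have Jx: "J x \<in> carrier_mat q p" and fc: "\<And>x. x \<in> carrier_vec p \<Longrightarrow> f x \<in> carrier_vec q"
    using f x by (auto simp: has_jacobian_def)
  \<comment> \<open>Error 1 in the definition of the derivative gives |f y - f x| \<le> K |y - x|
    near x, where the entry sum serves as a norm of J x. The leading 1 comes from that error and
    also keeps K positive.\<close>
  define K where "K = 1 + (\<Sum>a<q. \<Sum>b<p. \<bar>J x $$ (a, b)\<bar>)"
  have K: "0 < K" unfolding K_def by (intro add_pos_nonneg sum_nonneg) auto
  have "\<forall>\<epsilon>>0. \<exists>\<delta>>0. \<forall>h\<in>carrier_vec p. enorm h < \<delta> \<longrightarrow>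
      enorm (f (x + h) - f x - J x *\<^sub>v h) \<le> \<epsilon> * enorm h"
    using f x unfolding has_jacobian_def by blast
  from this[THEN spec, THEN mp, OF less_numeral_extra(1)] obtain \<delta> where \<delta>: "\<delta> > 0"
    and d: "\<forall>h\<in>carrier_vec p. enorm h < \<delta> \<longrightarrow> enorm (f (x + h) - f x - J x *\<^sub>v h) \<le> 1 * enorm h"
    by (elim exE conjE)
  show "\<exists>\<delta>>0. \<forall>y\<in>carrier_vec p. enorm (y - x) < \<delta> \<longrightarrow> \<bar>f y $ a - f x $ a\<bar> < \<epsilon>"
  proof (intro exI[of _ "min \<delta> (\<epsilon> / K)"] conjI ballI impI)
    show "0 < min \<delta> (\<epsilon> / K)" using \<delta> \<epsilon> K by simp
    fix y assume y: "y \<in> carrier_vec p" and lt: "enorm (y - x) < min \<delta> (\<epsilon> / K)"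
    define h where "h = y - x"
    have h: "h \<in> carrier_vec p" and yx: "y = x + h" using x y by (auto simp: h_def)
    have fy: "f y \<in> carrier_vec q" "f x \<in> carrier_vec q" using fc x y by auto
    have "f y $ a - f x $ a = (f y - f x - J x *\<^sub>v h) $ a + (J x *\<^sub>v h) $ a"
      using fy Jx a by auto
    also have "\<bar>\<dots>\<bar> \<le> \<bar>(f y - f x - J x *\<^sub>v h) $ a\<bar> + \<bar>(J x *\<^sub>v h) $ a\<bar>" by (rule abs_triangle_ineq)
    also have "\<dots> \<le> enorm (f y - f x - J x *\<^sub>v h) + enorm (J x *\<^sub>v h)"
      using fy Jx h a by (intro add_mono abs_component_le_enorm) auto
    also have "\<dots> \<le> 1 * enorm h + (\<Sum>a<q. \<Sum>b<p. \<bar>J x $$ (a, b)\<bar>) * enorm h"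
    proof (rule add_mono)
      show "enorm (f y - f x - J x *\<^sub>v h) \<le> 1 * enorm h"
        using d[rule_format, OF h] lt unfolding yx[symmetric] h_def[symmetric] by simp
    qed (rule enorm_mult_mat_vec_le[OF Jx h])
    also have "\<dots> = K * enorm h" by (simp add: K_def algebra_simps)
    also have "\<dots> < \<epsilon>" using lt K by (simp add: h_def field_simps)
    finally show "\<bar>f y $ a - f x $ a\<bar> < \<epsilon>" .
  qed
qed

lemma vcontinuous_jacobian:
  assumes f: "cont_diff p q f J" and a: "a < q" and b: "b < p"
  shows "vcontinuous p (\<lambda>x. J x $$ (a, b))"
  unfolding vcontinuous_def
proof (intro ballI allI impI)
  fix x :: rvec and \<epsilon> :: real assume x: "x \<in> carrier_vec p" and \<epsilon>: "0 < \<epsilon>"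
  have J: "\<And>x. x \<in> carrier_vec p \<Longrightarrow> J x \<in> carrier_mat q p"
    using f by (auto simp: has_jacobian_def cont_diff_def)
  have "\<forall>\<epsilon>>0. \<exists>\<delta>>0. \<forall>y\<in>carrier_vec p. enorm (y - x) < \<delta> \<longrightarrow> spectral_norm (J y - J x) < \<epsilon>"
    using f x unfolding cont_diff_def by blast
  from this[THEN spec, THEN mp, OF \<epsilon>] obtain \<delta> where \<delta>: "\<delta> > 0"
    and d: "\<forall>y\<in>carrier_vec p. enorm (y - x) < \<delta> \<longrightarrow> spectral_norm (J y - J x) < \<epsilon>"
    by (elim exE conjE)
  have "\<bar>J y $$ (a, b) - J x $$ (a, b)\<bar> < \<epsilon>" if "y \<in> carrier_vec p" "enorm (y - x) < \<delta>" for y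
  proof -
    have "J y - J x \<in> carrier_mat q p" using J[OF x] by (rule minus_carrier_mat)
    from abs_entry_le_spectral_norm[OF this a b] have "\<bar>J y $$ (a, b) - J x $$ (a, b)\<bar> \<le> spectral_norm (J y - J x)"
      using J[OF that(1)] J[OF x] a b by simp
    then show ?thesis using d[rule_format, OF that] by simp
  qed
  then show "\<exists>\<delta>>0. \<forall>y\<in>carrier_vec p. enorm (y - x) < \<delta> \<longrightarrow> \<bar>J y $$ (a, b) - J x $$ (a, b)\<bar> < \<epsilon>"
    using \<delta> by blast
qed

text \<open>Since 1 + |x| \<ge> 1, the exponent may be rounded up to a natural number; the factor 2
  absorbs the summand 1.\<close>

lemma poly_growth_rpow:
  assumes \<kappa>: "0 < \<kappa>" and s: "0 \<le> s"
    and f: "\<And>x. x \<in> carrier_vec n \<Longrightarrow> \<bar>f x\<bar> \<le> \<kappa> * (1 + rpow (enorm x) s)"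
  shows "poly_growth n f"
  unfolding poly_growth_def
proof (intro exI conjI ballI)
  show "0 \<le> 2 * \<kappa>" using \<kappa> by simp
  fix x :: rvec assume x: "x \<in> carrier_vec n"
  let ?r = "nat \<lceil>s\<rceil>"
  have r: "s \<le> real ?r" using s by linarith
  have "rpow (enorm x) s \<le> (1 + enorm x) ^ ?r"
  proof (cases "s = 0")
    case False
    have "enorm x powr s \<le> (1 + enorm x) powr s"
      using s enorm_nonneg[of x] by (intro powr_mono2) auto
    also have "\<dots> \<le> (1 + enorm x) powr real ?r"
      using r enorm_nonneg[of x] by (intro powr_mono) auto
    also have "\<dots> = (1 + enorm x) ^ ?r"
      using enorm_nonneg[of x] by (intro powr_realpow) auto
    finally show ?thesis using False by (simp add: rpow_def)
  qed (simp add: rpow_def)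
  moreover have "1 \<le> (1 + enorm x) ^ ?r"
    using enorm_nonneg[of x] by (intro one_le_power) auto
  ultimately have "1 + rpow (enorm x) s \<le> 2 * (1 + enorm x) ^ ?r" by simp
  then have "\<kappa> * (1 + rpow (enorm x) s) \<le> \<kappa> * (2 * (1 + enorm x) ^ ?r)"
    using \<kappa> by (intro mult_left_mono) auto
  then show "\<bar>f x\<bar> \<le> 2 * \<kappa> * (1 + enorm x) ^ ?r" using f[OF x] by simp
qed

text \<open>Convergence is coordinatewise. The dimensions belong to the notion because coordinates
  beyond the length of a vector are unspecified; they are required eventually and on the space
  only.\<close>

definition vconv ::
  "'w measure \<Rightarrow> 'i filter \<Rightarrow> nat \<Rightarrow> ('i \<Rightarrow> 'w \<Rightarrow> rvec) \<Rightarrow> ('i \<Rightarrow> 'w \<Rightarrow> rvec) \<Rightarrow> bool" where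
  "vconv M G n X U \<longleftrightarrow>
     (\<forall>\<^sub>F i in G. \<forall>\<omega>\<in>space M. X i \<omega> \<in> carrier_vec n \<and> U i \<omega> \<in> carrier_vec n) \<and>
     (\<forall>a<n. mconv M G (\<lambda>i \<omega>. X i \<omega> $ a) (\<lambda>i \<omega>. U i \<omega> $ a))"

definition matconv ::
  "'w measure \<Rightarrow> 'i filter \<Rightarrow> nat \<Rightarrow> nat \<Rightarrow> ('i \<Rightarrow> 'w \<Rightarrow> rmat) \<Rightarrow> ('i \<Rightarrow> 'w \<Rightarrow> rmat) \<Rightarrow> bool" where
  "matconv M G r c A B \<longleftrightarrow>
     (\<forall>\<^sub>F i in G. \<forall>\<omega>\<in>space M. A i \<omega> \<in> carrier_mat r c \<and> B i \<omega> \<in> carrier_mat r c) \<and>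
     (\<forall>a<r. \<forall>b<c. mconv M G (\<lambda>i \<omega>. A i \<omega> $$ (a, b)) (\<lambda>i \<omega>. B i \<omega> $$ (a, b)))"

lemma vconv_carrier:
  "vconv M G n X U \<Longrightarrow> \<forall>\<^sub>F i in G. \<forall>\<omega>\<in>space M. X i \<omega> \<in> carrier_vec n \<and> U i \<omega> \<in> carrier_vec n"
  by (simp add: vconv_def)

lemma vconv_component: "vconv M G n X U \<Longrightarrow> a < n \<Longrightarrow> mconv M G (\<lambda>i \<omega>. X i \<omega> $ a) (\<lambda>i \<omega>. U i \<omega> $ a)"
  by (simp add: vconv_def)

lemma matconv_carrier:
  "matconv M G r c A B \<Longrightarrow> \<forall>\<^sub>F i in G. \<forall>\<omega>\<in>space M. A i \<omega> \<in> carrier_mat r c \<and> B i \<omega> \<in> carrier_mat r c"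
  by (simp add: matconv_def)

lemma matconv_entry:
  "matconv M G r c A B \<Longrightarrow> a < r \<Longrightarrow> b < c \<Longrightarrow> mconv M G (\<lambda>i \<omega>. A i \<omega> $$ (a, b)) (\<lambda>i \<omega>. B i \<omega> $$ (a, b))"
  by (simp add: matconv_def)

context prob_space
begin

lemma vconv_measurable:
  assumes "vconv M G n X U"
  shows "\<forall>\<^sub>F i in G. X i \<in> measurable M (borel_vec n)"
proof -
  have "\<forall>\<^sub>F i in G. \<forall>a\<in>{..<n}. (\<lambda>\<omega>. X i \<omega> $ a) \<in> borel_measurable M"
  proof (rule eventually_ball_finite)
    show "\<forall>a\<in>{..<n}. \<forall>\<^sub>F i in G. (\<lambda>\<omega>. X i \<omega> $ a) \<in> borel_measurable M"
    proof
      fix a assume "a \<in> {..<n}"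
      then have "\<forall>\<^sub>F i in G. all_moments M (\<lambda>\<omega>. X i \<omega> $ a)"
        using bounded_moments_moments[OF mconv_bounded[OF vconv_component[OF assms]]] by simp
      then show "\<forall>\<^sub>F i in G. (\<lambda>\<omega>. X i \<omega> $ a) \<in> borel_measurable M"
        by eventually_elim (rule all_moments_measurable)
    qed
  qed simp
  then show ?thesis
    using vconv_carrier[OF assms] by eventually_elim (simp add: measurable_borel_vec_iff)
qed

text \<open>As the limit is deterministic, a modulus of continuity at the single point
  \<open>u\<close> decides. Polynomial growth turns bounded moments of \<open>Z\<close> into bounded
  moments of its image, which pays for the rare outcomes far from \<open>u\<close>.\<close>

lemma mconv_continuous:
  assumes Z: "vconv M G n Z (\<lambda>i \<omega>. u)" and u: "u \<in> carrier_vec n"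
    and f: "vcontinuous n f" and growth: "poly_growth n f"
  shows "mconv M G (\<lambda>i \<omega>. f (Z i \<omega>)) (\<lambda>i \<omega>. f u)"
proof -
  have car: "\<forall>\<^sub>F i in G. \<forall>\<omega>\<in>space M. Z i \<omega> \<in> carrier_vec n"
    using vconv_carrier[OF Z] by eventually_elim auto
  have meas: "\<forall>\<^sub>F i in G. (\<lambda>\<omega>. f (Z i \<omega>)) \<in> borel_measurable M"
    using vconv_measurable[OF Z] by eventually_elim (rule borel_measurable_vcontinuous[OF f])
  obtain c r where c: "0 \<le> c" and g: "\<And>x. x \<in> carrier_vec n \<Longrightarrow> \<bar>f x\<bar> \<le> c * (1 + enorm x) ^ r"
    using growth unfolding poly_growth_def by blast
  have bf: "bounded_moments M G (\<lambda>i \<omega>. f (Z i \<omega>))"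
  proof (rule bounded_moments_dominated[OF _ meas])
    show "bounded_moments M G (\<lambda>i \<omega>. c * (1 + (\<Sum>a<n. \<bar>Z i \<omega> $ a\<bar>)) ^ r)"
      by (intro bounded_moments_cmult bounded_moments_power bounded_moments_add bounded_moments_const
          all_moments_const bounded_moments_sum bounded_moments_abs mconv_bounded[OF vconv_component[OF Z]]) simp
    show "\<forall>\<^sub>F i in G. \<forall>\<omega>\<in>space M. \<bar>f (Z i \<omega>)\<bar> \<le> \<bar>c * (1 + (\<Sum>a<n. \<bar>Z i \<omega> $ a\<bar>)) ^ r\<bar>"
      using car
    proof eventually_elim
      case (elim i)
      show ?case
      proof
        fix \<omega> assume "\<omega> \<in> space M"
        then have z: "Z i \<omega> \<in> carrier_vec n" using elim by blast
        have "\<bar>f (Z i \<omega>)\<bar> \<le> c * (1 + enorm (Z i \<omega>)) ^ r" by (rule g[OF z])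
        also have "\<dots> \<le> c * (1 + (\<Sum>a<n. \<bar>Z i \<omega> $ a\<bar>)) ^ r"
          using enorm_le_sum[OF z] enorm_nonneg[of "Z i \<omega>"] c by (intro mult_left_mono power_mono) auto
        finally show "\<bar>f (Z i \<omega>)\<bar> \<le> \<bar>c * (1 + (\<Sum>a<n. \<bar>Z i \<omega> $ a\<bar>)) ^ r\<bar>" by linarith
      qed
    qed
  qed
  then have bd: "bounded_moments M G (\<lambda>i \<omega>. f (Z i \<omega>) - f u)"
    by (intro bounded_moments_diff bounded_moments_const all_moments_const)
  have "vanishing M G (\<lambda>i \<omega>. f (Z i \<omega>) - f u)"
  proof (rule vanishing_approx[OF bd])
    fix \<epsilon> :: real assume \<epsilon>: "0 < \<epsilon>"
    then have "\<exists>\<delta>>0. \<forall>y\<in>carrier_vec n. enorm (y - u) < \<delta> \<longrightarrow> \<bar>f y - f u\<bar> < \<epsilon>"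
      using bspec[OF f[unfolded vcontinuous_def] u] by blast
    then obtain \<delta> where \<delta>: "\<delta> > 0"
      and d: "\<forall>y\<in>carrier_vec n. enorm (y - u) < \<delta> \<longrightarrow> \<bar>f y - f u\<bar> < \<epsilon>"
      by (elim exE conjE)
    \<comment> \<open>Where Z is at least \<delta> away from u, the sum of the coordinate
      differences divided by \<delta> is at least 1, so multiplying the error by it only enlarges
      the error. The product vanishes because Z - u does.\<close>
    let ?Y = "\<lambda>i \<omega>. (1 / \<delta>) * ((\<Sum>a<n. \<bar>Z i \<omega> $ a - u $ a\<bar>) * (f (Z i \<omega>) - f u))"
    have "vanishing M G ?Y"
      by (intro vanishing_cmult vanishing_mult[OF _ bd] vanishing_sum vanishing_abs
          mconv_vanishing[OF vconv_component[OF Z]]) simp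
    moreover have "\<forall>\<^sub>F i in G. \<forall>\<omega>\<in>space M. \<bar>f (Z i \<omega>) - f u\<bar> \<le> \<epsilon> + \<bar>?Y i \<omega>\<bar>"
      using car
    proof eventually_elim
      case (elim i)
      show ?case
      proof
        fix \<omega> assume "\<omega> \<in> space M"
        then have z: "Z i \<omega> \<in> carrier_vec n" using elim by blast
        show "\<bar>f (Z i \<omega>) - f u\<bar> \<le> \<epsilon> + \<bar>?Y i \<omega>\<bar>"
        proof (cases "enorm (Z i \<omega> - u) < \<delta>")
          case True
          then show ?thesis using d[rule_format, OF z True] by linarith
        next
          case False
          have "\<delta> \<le> (\<Sum>a<n. \<bar>Z i \<omega> $ a - u $ a\<bar>)"
            using False enorm_le_sum[of "Z i \<omega> - u" n] z u by simp
          then have "1 \<le> (1 / \<delta>) * (\<Sum>a<n. \<bar>Z i \<omega> $ a - u $ a\<bar>)"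
            using \<delta> by (simp add: field_simps)
          then have "1 * \<bar>f (Z i \<omega>) - f u\<bar> \<le> ((1 / \<delta>) * (\<Sum>a<n. \<bar>Z i \<omega> $ a - u $ a\<bar>)) * \<bar>f (Z i \<omega>) - f u\<bar>"
            by (intro mult_right_mono) auto
          also have "\<dots> = \<bar>?Y i \<omega>\<bar>"
            using \<delta> by (simp add: abs_mult sum_nonneg)
          finally show ?thesis using \<epsilon> by simp
        qed
      qed
    qed
    ultimately show "\<exists>Y. vanishing M G Y \<and> (\<forall>\<^sub>F i in G. \<forall>\<omega>\<in>space M. \<bar>f (Z i \<omega>) - f u\<bar> \<le> \<epsilon> + \<bar>Y i \<omega>\<bar>)"
      by blast
  qed
  then show ?thesis by (simp add: mconv_def bounded_moments_const all_moments_const)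
qed

end


section \<open>Gaussian inputs\<close>

text \<open>The density case of \<open>normal_vec\<close> only says that the variance is nonzero,
  and \<open>sqrt\<close> of a negative real is negative. Passing to the absolute value makes facts
  about positive \<sigma> applicable.\<close>

lemma normal_density_abs: "normal_density \<mu> \<sigma> = normal_density \<mu> \<bar>\<sigma>\<bar>"
  by (simp add: normal_density_def fun_eq_iff)

lemma integrable_normal_abs_power:
  assumes "\<sigma> \<noteq> 0"
  shows "integrable lborel (\<lambda>x. normal_density \<mu> \<sigma> x * \<bar>x\<bar> ^ q)"
proof (rule Bochner_Integration.integrable_bound)
  have s: "0 < \<bar>\<sigma>\<bar>" using assms by simp
  have i: "integrable lborel (\<lambda>x. normal_density \<mu> \<sigma> x * \<bar>x - \<mu>\<bar> ^ k)" for k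
    using integrable_normal_moment_abs[OF s, of \<mu> k] by (simp only: normal_density_abs[of \<mu> \<sigma>, symmetric])
  \<comment> \<open>The zeroth power keeps the constant term in the form of a central moment, so its
    integrability is the case k = 0.\<close>
  show "integrable lborel (\<lambda>x. 2 ^ q * (normal_density \<mu> \<sigma> x * \<bar>x - \<mu>\<bar> ^ q + normal_density \<mu> \<sigma> x * \<bar>x - \<mu>\<bar> ^ 0 * \<bar>\<mu>\<bar> ^ q))"
    using i[of q] i[of 0] by (simp del: power_0)
  have "normal_density \<mu> \<sigma> x * \<bar>x\<bar> ^ q \<le> normal_density \<mu> \<sigma> x * (2 ^ q * (\<bar>x - \<mu>\<bar> ^ q + \<bar>\<mu>\<bar> ^ q))" for x
    using abs_add_power_le[of "x - \<mu>" \<mu> q] by (intro mult_left_mono) (auto simp: normal_density_nonneg)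
  then have le: "normal_density \<mu> \<sigma> x * \<bar>x\<bar> ^ q
      \<le> 2 ^ q * (normal_density \<mu> \<sigma> x * \<bar>x - \<mu>\<bar> ^ q + normal_density \<mu> \<sigma> x * \<bar>x - \<mu>\<bar> ^ 0 * \<bar>\<mu>\<bar> ^ q)" for x
    by (simp add: algebra_simps)
  have nn: "0 \<le> normal_density \<mu> \<sigma> x * \<bar>x\<bar> ^ q" for x by (simp add: normal_density_nonneg)
  have "norm (normal_density \<mu> \<sigma> x * \<bar>x\<bar> ^ q)
      \<le> norm (2 ^ q * (normal_density \<mu> \<sigma> x * \<bar>x - \<mu>\<bar> ^ q + normal_density \<mu> \<sigma> x * \<bar>x - \<mu>\<bar> ^ 0 * \<bar>\<mu>\<bar> ^ q))" for x
    by (simp only: real_norm_def abs_of_nonneg[OF nn] abs_of_nonneg[OF order_trans[OF nn le]] le)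
  then show "AE x in lborel. norm (normal_density \<mu> \<sigma> x * \<bar>x\<bar> ^ q)
      \<le> norm (2 ^ q * (normal_density \<mu> \<sigma> x * \<bar>x - \<mu>\<bar> ^ q + normal_density \<mu> \<sigma> x * \<bar>x - \<mu>\<bar> ^ 0 * \<bar>\<mu>\<bar> ^ q))"
    by blast
qed measurable

lemma borel_measurable_scalar_prod:
  assumes X: "X \<in> measurable M (borel_vec n)"
  shows "(\<lambda>\<omega>. c \<bullet> X \<omega>) \<in> borel_measurable M"
proof -
  have "(\<lambda>\<omega>. \<Sum>a<n. c $ a * X \<omega> $ a) \<in> borel_measurable M"
    using X by (intro borel_measurable_sum) (auto simp: measurable_borel_vec_iff)
  moreover have "(\<Sum>a<n. c $ a * X \<omega> $ a) = c \<bullet> X \<omega>" if "\<omega> \<in> space M" for \<omega>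
    using X that by (auto simp: measurable_borel_vec_iff scalar_prod_def atLeast0LessThan)
  ultimately show ?thesis by (simp cong: measurable_cong)
qed

context prob_space
begin

lemma normal_vec_moments:
  assumes X: "normal_vec M n X \<mu> \<Sigma>" and c: "c \<in> carrier_vec n"
  shows "all_moments M (\<lambda>\<omega>. c \<bullet> X \<omega>)"
  unfolding all_moments_def
proof (intro conjI allI)
  show m[measurable]: "(\<lambda>\<omega>. c \<bullet> X \<omega>) \<in> borel_measurable M"
    using X by (intro borel_measurable_scalar_prod[of _ _ n]) (simp add: normal_vec_def)
  fix q
  show "integrable M (\<lambda>\<omega>. \<bar>c \<bullet> X \<omega>\<bar> ^ q)"
  proof (cases "c \<bullet> (\<Sigma> *\<^sub>v c) = 0")
    case True
    then have "AE \<omega> in M. c \<bullet> X \<omega> = c \<bullet> \<mu>" using X c by (auto simp: normal_vec_def)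
    then have "AE \<omega> in M. \<bar>c \<bullet> X \<omega>\<bar> ^ q = \<bar>c \<bullet> \<mu>\<bar> ^ q" by eventually_elim simp
    then have "integrable M (\<lambda>\<omega>. \<bar>c \<bullet> X \<omega>\<bar> ^ q) \<longleftrightarrow> integrable M (\<lambda>\<omega>. \<bar>c \<bullet> \<mu>\<bar> ^ q)"
      by (intro integrable_cong_AE) auto
    then show ?thesis by simp
  next
    case False
    then have "distributed M lborel (\<lambda>\<omega>. c \<bullet> X \<omega>) (normal_density (c \<bullet> \<mu>) (sqrt (c \<bullet> (\<Sigma> *\<^sub>v c))))"
      using X c by (auto simp: normal_vec_def)
    from distributed_integrable[OF this, of "\<lambda>x. \<bar>x\<bar> ^ q"]
    show ?thesis
      using integrable_normal_abs_power[of "sqrt (c \<bullet> (\<Sigma> *\<^sub>v c))"] False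
      by (simp add: normal_density_nonneg)
  qed
qed

text \<open>Mean and variance determine the law of a single linear form, be it a point mass or a
  density. All comparisons between the laws of different members go back to this.\<close>

lemma normal_vec_expectation_eq:
  assumes X: "normal_vec M n X \<mu> \<Sigma>" and Y: "normal_vec M n Y \<mu> \<Sigma>" and c: "c \<in> carrier_vec n"
    and [measurable]: "g \<in> borel_measurable borel"
  shows "(\<integral>\<omega>. g (c \<bullet> X \<omega>) \<partial>M) = (\<integral>\<omega>. g (c \<bullet> Y \<omega>) \<partial>M :: real)"
proof (cases "c \<bullet> (\<Sigma> *\<^sub>v c) = 0")
  case True
  have "(\<integral>\<omega>. g (c \<bullet> Z \<omega>) \<partial>M) = (\<integral>\<omega>. g (c \<bullet> \<mu>) \<partial>M)" if Z: "normal_vec M n Z \<mu> \<Sigma>" for Z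
  proof -
    have [measurable]: "(\<lambda>\<omega>. c \<bullet> Z \<omega>) \<in> borel_measurable M"
      by (rule all_moments_measurable[OF normal_vec_moments[OF Z c]])
    have "AE \<omega> in M. c \<bullet> Z \<omega> = c \<bullet> \<mu>" using Z c True by (auto simp: normal_vec_def)
    then have "AE \<omega> in M. g (c \<bullet> Z \<omega>) = g (c \<bullet> \<mu>)" by eventually_elim simp
    then show ?thesis by (intro integral_cong_AE) auto
  qed
  then show ?thesis using X Y by simp
next
  case False
  have "(\<integral>\<omega>. g (c \<bullet> Z \<omega>) \<partial>M) = (\<integral>x. normal_density (c \<bullet> \<mu>) (sqrt (c \<bullet> (\<Sigma> *\<^sub>v c))) x * g x \<partial>lborel)"
    if Z: "normal_vec M n Z \<mu> \<Sigma>" for Z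
  proof -
    have "distributed M lborel (\<lambda>\<omega>. c \<bullet> Z \<omega>) (normal_density (c \<bullet> \<mu>) (sqrt (c \<bullet> (\<Sigma> *\<^sub>v c))))"
      using Z c False by (auto simp: normal_vec_def)
    from distributed_integral[OF this, of g] show ?thesis by (simp add: normal_density_nonneg)
  qed
  then show ?thesis using X Y by simp
qed

end

text \<open>A stream lists one kind of input at one time for all members of pass j. As a function it
  separates the member index, over which averages run, from the rest of the label.\<close>

definition streams :: "lm_data \<Rightarrow> nat \<Rightarrow> (nat \<Rightarrow> input) set" where
  "streams D j = {Init j} \<union> {\<lambda>n. Model j n i | i. i \<in> {1..steps D}} \<union> {\<lambda>n. Obs j n i | i. i \<in> {1..steps D}}"

text \<open>Dimensions are constant along a stream, so the label \<open>h 1\<close> can stand for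
  all members.\<close>

definition generators :: "lm_data \<Rightarrow> (input \<Rightarrow> 'w \<Rightarrow> rvec) \<Rightarrow> nat \<Rightarrow> (nat \<Rightarrow> 'w \<Rightarrow> real) set" where
  "generators D \<xi> j = {(\<lambda>n \<omega>. \<xi> (h n) \<omega> $ a) | h a. h \<in> streams D j \<and> a < input_dim D (h 1)}"

lemma streams_inputs: "h \<in> streams D j \<Longrightarrow> 1 \<le> j \<Longrightarrow> 1 \<le> n \<Longrightarrow> h n \<in> inputs D"
  by (auto simp: streams_def inputs_def)

lemma streams_stationary:
  assumes "h \<in> streams D j"
  shows "input_dim D (h n) = input_dim D (h 1)" "input_mean D (h n) = input_mean D (h 1)"
    "input_cov D (h n) = input_cov D (h 1)"
  using assms by (auto simp: streams_def)

text \<open>Hence different members share no input, and different streams of one member have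
  different labels.\<close>

lemma streams_disjoint:
  "h \<in> streams D j \<Longrightarrow> h' \<in> streams D j \<Longrightarrow> h n = h' n' \<Longrightarrow> n = n' \<and> h = h'"
  by (auto simp: streams_def)

lemma random_inputs_normal:
  assumes "random_inputs M D \<xi>" "h \<in> streams D j" "1 \<le> j" "1 \<le> n"
  shows "normal_vec M (input_dim D (h 1)) (\<xi> (h n)) (input_mean D (h 1)) (input_cov D (h 1))"
  using assms streams_inputs[OF assms(2-4)] streams_stationary[OF assms(2), of n]
  by (auto simp: random_inputs_def)

lemma random_inputs_carrier:
  assumes "random_inputs M D \<xi>" "h \<in> streams D j" "1 \<le> j" "1 \<le> n" "\<omega> \<in> space M"
  shows "\<xi> (h n) \<omega> \<in> carrier_vec (input_dim D (h 1))"
  using random_inputs_normal[OF assms(1-4)] assms(5) by (simp add: normal_vec_def measurable_borel_vec_iff)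

section \<open>Laws of large numbers for the inputs and their products\<close>

context prob_space
begin

context
  fixes D :: lm_data and \<xi> :: "input \<Rightarrow> 'a \<Rightarrow> rvec" and j :: nat
  assumes ri: "random_inputs M D \<xi>" and j: "1 \<le> j"
begin

lemma generator_expectation:
  assumes h: "h \<in> streams D j" and c: "c \<in> carrier_vec (input_dim D (h 1))" and n: "1 \<le> n"
    and g: "g \<in> borel_measurable borel"
  shows "(\<integral>\<omega>. g (c \<bullet> \<xi> (h n) \<omega>) \<partial>M) = (\<integral>\<omega>. g (c \<bullet> \<xi> (h 1) \<omega>) \<partial>M :: real)"
  by (rule normal_vec_expectation_eq[OF random_inputs_normal[OF ri h j n] random_inputs_normal[OF ri h j] c g]) simp

lemma generator_component:
  assumes h: "h \<in> streams D j" and a: "a < input_dim D (h 1)" and n: "1 \<le> n"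
  shows "\<And>\<omega>. \<omega> \<in> space M \<Longrightarrow> \<xi> (h n) \<omega> $ a = unit_vec (input_dim D (h 1)) a \<bullet> \<xi> (h n) \<omega>"
    and "all_moments M (\<lambda>\<omega>. \<xi> (h n) \<omega> $ a)"
    and "g \<in> borel_measurable borel \<Longrightarrow>
      (\<integral>\<omega>. g (\<xi> (h n) \<omega> $ a) \<partial>M) = (\<integral>\<omega>. g (\<xi> (h 1) \<omega> $ a) \<partial>M :: real)"
proof -
  have e: "\<xi> (h n) \<omega> $ a = unit_vec (input_dim D (h 1)) a \<bullet> \<xi> (h n) \<omega>" if "\<omega> \<in> space M" "1 \<le> n" for n \<omega>
    using random_inputs_carrier[OF ri h j that(2,1)] a by simp
  show "\<xi> (h n) \<omega> $ a = unit_vec (input_dim D (h 1)) a \<bullet> \<xi> (h n) \<omega>" if "\<omega> \<in> space M" for \<omega>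
    by (rule e[OF that n])
  show "all_moments M (\<lambda>\<omega>. \<xi> (h n) \<omega> $ a)"
    using normal_vec_moments[OF random_inputs_normal[OF ri h j n], of "unit_vec (input_dim D (h 1)) a"]
    by (intro all_moments_cong[OF e[OF _ n], THEN iffD2]) simp_all
  assume g: "g \<in> borel_measurable borel"
  have i: "(\<integral>\<omega>. g (\<xi> (h n) \<omega> $ a) \<partial>M) = (\<integral>\<omega>. g (unit_vec (input_dim D (h 1)) a \<bullet> \<xi> (h n) \<omega>) \<partial>M)"
    if "1 \<le> n" for n
    by (intro Bochner_Integration.integral_cong refl arg_cong[where f = g] e[OF _ that])
  show "(\<integral>\<omega>. g (\<xi> (h n) \<omega> $ a) \<partial>M) = (\<integral>\<omega>. g (\<xi> (h 1) \<omega> $ a) \<partial>M)"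
    using i[OF n] i[of 1] generator_expectation[OF h _ n g, of "unit_vec (input_dim D (h 1)) a"] by simp
qed

text \<open>The bound is the moment of the first member, which all members share.\<close>

lemma bounded_moments_generator:
  assumes "g \<in> generators D \<xi> j"
  shows "bounded_moments M (principal {1..}) g"
proof -
  obtain h a where g: "g = (\<lambda>n \<omega>. \<xi> (h n) \<omega> $ a)" and h: "h \<in> streams D j" and a: "a < input_dim D (h 1)"
    using assms by (auto simp: generators_def)
  have "(\<integral>\<omega>. \<bar>g n \<omega>\<bar> ^ q \<partial>M) \<le> (\<integral>\<omega>. \<bar>g 1 \<omega>\<bar> ^ q \<partial>M)" if "1 \<le> n" for q n
    using generator_component(3)[OF h a that, of "\<lambda>x. \<bar>x\<bar> ^ q"] by (simp add: g)
  then show ?thesis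
    using generator_component(2)[OF h a]
    by (auto simp: bounded_moments_def eventually_principal g)
qed

text \<open>Distinct members draw on disjoint groups of labels, so functions of these groups are
  independent. When both streams agree the group collapses to one label, which covers single inputs
  and products within one vector.\<close>

lemma indep_generator_functions:
  assumes h: "h \<in> streams D j" "a < input_dim D (h 1)" and h': "h' \<in> streams D j" "b < input_dim D (h' 1)"
    and [measurable]: "case_prod \<phi> \<in> borel_measurable (borel \<Otimes>\<^sub>M borel)"
  shows "indep_vars (\<lambda>_. borel) (\<lambda>n \<omega>. \<phi> (\<xi> (h n) \<omega> $ a) (\<xi> (h' n) \<omega> $ b) :: real) {1..}"
proof -
  let ?K = "\<lambda>n. {h n, h' n}"
  let ?B = "\<lambda>l. borel_vec (input_dim D l)"
  have ind: "indep_vars ?B \<xi> (inputs D)" using ri by (simp add: random_inputs_def)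
  have "indep_vars (\<lambda>n. PiM (?K n) ?B) (\<lambda>n \<omega>. restrict (\<lambda>l. \<xi> l \<omega>) (?K n)) {1..}"
  proof (rule indep_vars_restrict[OF ind])
    show "?K n \<subseteq> inputs D" if "n \<in> {1..}" for n
      using that streams_inputs[OF h(1) j, of n] streams_inputs[OF h'(1) j, of n] by auto
    show "disjoint_family_on ?K {1..}"
      using streams_disjoint[OF h(1) h(1)] streams_disjoint[OF h(1) h'(1)]
        streams_disjoint[OF h'(1) h(1)] streams_disjoint[OF h'(1) h'(1)]
      unfolding disjoint_family_on_def by fast
  qed
  then have "indep_vars (\<lambda>_. borel)
      (\<lambda>n \<omega>. (\<lambda>f. \<phi> (f (h n) $ a) (f (h' n) $ b)) (restrict (\<lambda>l. \<xi> l \<omega>) (?K n))) {1..}"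
  proof (rule indep_vars_compose2)
    fix n :: nat assume "n \<in> {1..}"
    have c: "(\<lambda>f. f l $ c) \<in> borel_measurable (PiM (?K n) ?B)"
      if "l \<in> ?K n" "c < input_dim D l" for l c
      using measurable_component_singleton[OF that(1), of ?B] that(2) by (simp add: measurable_borel_vec_iff)
    have [measurable]: "(\<lambda>f. f (h n) $ a) \<in> borel_measurable (PiM (?K n) ?B)"
      "(\<lambda>f. f (h' n) $ b) \<in> borel_measurable (PiM (?K n) ?B)"
      using h(2) h'(2) by (auto intro!: c simp: streams_stationary(1)[OF h(1), of n] streams_stationary(1)[OF h'(1), of n])
    have "(\<lambda>f. case_prod \<phi> (f (h n) $ a, f (h' n) $ b)) \<in> borel_measurable (PiM (?K n) ?B)"
      by measurable
    then show "(\<lambda>f. \<phi> (f (h n) $ a) (f (h' n) $ b)) \<in> borel_measurable (PiM (?K n) ?B)" by simp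
  qed
  then show ?thesis by simp
qed

lemma lln_generator:
  assumes "g \<in> generators D \<xi> j"
  shows "\<exists>w. lln_family M g w"
proof -
  obtain h a where g: "g = (\<lambda>n \<omega>. \<xi> (h n) \<omega> $ a)" and h: "h \<in> streams D j" and a: "a < input_dim D (h 1)"
    using assms by (auto simp: generators_def)
  have "indep_vars (\<lambda>_. borel) g {1..}"
    using indep_generator_functions[OF h a h a, of "\<lambda>x y. x"] by (simp add: g)
  moreover have "(\<integral>\<omega>. g n \<omega> \<partial>M) = (\<integral>\<omega>. g 1 \<omega> \<partial>M)" if "1 \<le> n" for n
    using generator_component(3)[OF h a that, of "\<lambda>x. x"] by (simp add: g)
  ultimately show ?thesis
    using lln_family_independent[OF bounded_moments_generator[OF assms]] by blast
qed

text \<open>Independence across members is at hand; the point is that the mean does not depend on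
  the member. Coordinates of one input are handled by polarization, coordinates of different inputs
  by independence.\<close>

lemma lln_generator_mult:
  assumes "g \<in> generators D \<xi> j" and "g' \<in> generators D \<xi> j"
  shows "\<exists>w. lln_family M (\<lambda>n \<omega>. g n \<omega> * g' n \<omega>) w"
proof -
  obtain h a where g: "g = (\<lambda>n \<omega>. \<xi> (h n) \<omega> $ a)" and h: "h \<in> streams D j" and a: "a < input_dim D (h 1)"
    using assms by (auto simp: generators_def)
  obtain h' b where g': "g' = (\<lambda>n \<omega>. \<xi> (h' n) \<omega> $ b)" and h': "h' \<in> streams D j" and b: "b < input_dim D (h' 1)"
    using assms by (auto simp: generators_def)
  have "indep_vars (\<lambda>_. borel) (\<lambda>n \<omega>. g n \<omega> * g' n \<omega>) {1..}"
    using indep_generator_functions[OF h a h' b, of "\<lambda>x y. x * y"] by (simp add: g g')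
  moreover have "bounded_moments M (principal {1..}) (\<lambda>n \<omega>. g n \<omega> * g' n \<omega>)"
    by (intro bounded_moments_mult bounded_moments_generator assms)
  moreover have "(\<integral>\<omega>. g n \<omega> * g' n \<omega> \<partial>M) = (\<integral>\<omega>. g 1 \<omega> * g' 1 \<omega> \<partial>M)" if n: "1 \<le> n" for n
  proof (cases "h = h'")
    case True
    \<comment> \<open>The law is accessible through linear forms only, so the mean of x_a x_b is
      read off from (x_a + x_b)^2 - x_a^2 - x_b^2. For a = b the form is 2 x_a and the identity
      still holds.\<close>
    let ?c = "unit_vec (input_dim D (h 1)) a + unit_vec (input_dim D (h 1)) b"
    have c: "?c \<in> carrier_vec (input_dim D (h 1))" by simp
    have polar: "(\<integral>\<omega>. g n \<omega> * g' n \<omega> \<partial>M) = ((\<integral>\<omega>. (?c \<bullet> \<xi> (h n) \<omega>)\<^sup>2 \<partial>M)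
        - (\<integral>\<omega>. (\<xi> (h n) \<omega> $ a)\<^sup>2 \<partial>M) - (\<integral>\<omega>. (\<xi> (h n) \<omega> $ b)\<^sup>2 \<partial>M)) / 2" if n: "1 \<le> n" for n
    proof -
      have "?c \<bullet> \<xi> (h n) \<omega> = \<xi> (h n) \<omega> $ a + \<xi> (h n) \<omega> $ b" if "\<omega> \<in> space M" for \<omega>
        using random_inputs_carrier[OF ri h j n that] a b True
        by (subst add_scalar_prod_distrib[of _ "input_dim D (h 1)"]) auto
      then have "(\<integral>\<omega>. g n \<omega> * g' n \<omega> \<partial>M) = (\<integral>\<omega>. ((?c \<bullet> \<xi> (h n) \<omega>)\<^sup>2 - (\<xi> (h n) \<omega> $ a)\<^sup>2 - (\<xi> (h n) \<omega> $ b)\<^sup>2) / 2 \<partial>M)"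
        using True by (intro Bochner_Integration.integral_cong) (auto simp: g g' power2_sum)
      also have "\<dots> = ((\<integral>\<omega>. (?c \<bullet> \<xi> (h n) \<omega>)\<^sup>2 \<partial>M)
        - (\<integral>\<omega>. (\<xi> (h n) \<omega> $ a)\<^sup>2 \<partial>M) - (\<integral>\<omega>. (\<xi> (h n) \<omega> $ b)\<^sup>2 \<partial>M)) / 2"
        using all_moments_integrable_power2[OF normal_vec_moments[OF random_inputs_normal[OF ri h j n] c]]
          all_moments_integrable_power2[OF generator_component(2)[OF h a n]]
          all_moments_integrable_power2[OF generator_component(2)[OF h _ n, of b]] b True
        by simp
      finally show ?thesis .
    qed
    show ?thesis
    proof -
      have b': "b < input_dim D (h 1)" using b True by simp
      have pw: "power2 \<in> borel_measurable (borel :: real measure)" by measurable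
      have "(\<integral>\<omega>. (?c \<bullet> \<xi> (h n) \<omega>)\<^sup>2 \<partial>M) = (\<integral>\<omega>. (?c \<bullet> \<xi> (h 1) \<omega>)\<^sup>2 \<partial>M)"
        "(\<integral>\<omega>. (\<xi> (h n) \<omega> $ a)\<^sup>2 \<partial>M) = (\<integral>\<omega>. (\<xi> (h 1) \<omega> $ a)\<^sup>2 \<partial>M)"
        "(\<integral>\<omega>. (\<xi> (h n) \<omega> $ b)\<^sup>2 \<partial>M) = (\<integral>\<omega>. (\<xi> (h 1) \<omega> $ b)\<^sup>2 \<partial>M)"
        using generator_expectation[OF h c n pw] generator_component(3)[OF h a n pw]
          generator_component(3)[OF h b' n pw] by blast+
      then show ?thesis by (simp only: polar[OF n] polar[OF order_refl])
    qed
  next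
    case False
    have mult: "(\<integral>\<omega>. g n \<omega> * g' n \<omega> \<partial>M) = (\<integral>\<omega>. g n \<omega> \<partial>M) * (\<integral>\<omega>. g' n \<omega> \<partial>M)" if n: "1 \<le> n" for n
    proof -
      \<comment> \<open>Selecting the coordinate by the label turns the two coordinates into one
        family indexed by labels, as \<open>indep_vars\<close> requires; the labels differ, so the
        choice is unambiguous.\<close>
      define X where "X l \<omega> = \<xi> l \<omega> $ (if l = h n then a else b)" for l \<omega>
      have ne: "h n \<noteq> h' n" using streams_disjoint[OF h h'] False by blast
      have "indep_vars (\<lambda>l. borel_vec (input_dim D l)) \<xi> (inputs D)" using ri by (simp add: random_inputs_def)
      then have ind: "indep_vars (\<lambda>l. borel_vec (input_dim D l)) \<xi> {h n, h' n}"
        by (rule indep_vars_subset) (simp add: streams_inputs[OF h j n] streams_inputs[OF h' j n])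
      have "indep_vars (\<lambda>_. borel) X {h n, h' n}"
        unfolding X_def
      proof (rule indep_vars_compose2[OF ind, of "\<lambda>l v. v $ (if l = h n then a else b)"])
        fix l assume "l \<in> {h n, h' n}"
        then have "(if l = h n then a else b) < input_dim D l"
          using a b streams_stationary(1)[OF h, of n] streams_stationary(1)[OF h', of n] by auto
        then show "(\<lambda>v. v $ (if l = h n then a else b)) \<in> borel_measurable (borel_vec (input_dim D l))"
          using measurable_borel_vec_iff[of "\<lambda>v. v" "borel_vec (input_dim D l)" "input_dim D l"] by simp
      qed
      moreover have "X (h n) = g n" "X (h' n) = g' n"
        using ne by (auto simp: X_def g g')
      moreover have "integrable M (g n)" "integrable M (g' n)"
        unfolding g g' by (intro all_moments_integrable generator_component(2)[OF h a n] generator_component(2)[OF h' b n])+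
      ultimately show ?thesis
        using ne indep_vars_expectation_mult[of X "{h n, h' n}" "h n" "h' n"] by simp
    qed
    have "(\<integral>\<omega>. g n \<omega> \<partial>M) = (\<integral>\<omega>. g 1 \<omega> \<partial>M)" "(\<integral>\<omega>. g' n \<omega> \<partial>M) = (\<integral>\<omega>. g' 1 \<omega> \<partial>M)"
      unfolding g g' by (rule generator_component(3)[OF h a n] generator_component(3)[OF h' b n], simp)+
    then show ?thesis by (simp only: mult[OF n] mult[OF order_refl])
  qed
  ultimately show ?thesis
    using lln_family_independent by blast
qed

end

end


section \<open>Random matrices and their inverses\<close>

lemma mult_mat_vec_component:
  "A \<in> carrier_mat q p \<Longrightarrow> v \<in> carrier_vec p \<Longrightarrow> a < q \<Longrightarrow>
    (A *\<^sub>v v) $ a = (\<Sum>b<p. A $$ (a, b) * v $ b)" for A :: rmat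
  by (auto simp: scalar_prod_def atLeast0LessThan intro!: sum.cong)

lemma mult_mat_entry:
  "A \<in> carrier_mat r s \<Longrightarrow> B \<in> carrier_mat s c \<Longrightarrow> a < r \<Longrightarrow> b < c \<Longrightarrow>
    (A * B) $$ (a, b) = (\<Sum>e<s. A $$ (a, e) * B $$ (e, b))" for A B :: rmat
  by (auto simp: scalar_prod_def atLeast0LessThan intro!: sum.cong)

lemma scalar_prod_sum: "v \<in> carrier_vec n \<Longrightarrow> u \<bullet> v = (\<Sum>a<n. u $ a * v $ a)" for u v :: rvec
  by (simp add: scalar_prod_def atLeast0LessThan)

lemma quadratic_form_sum:
  fixes P :: rmat
  assumes P: "P \<in> carrier_mat n n" and y: "y \<in> carrier_vec n"
  shows "y \<bullet> (P *\<^sub>v y) = (\<Sum>a<n. \<Sum>b<n. P $$ (a, b) * (y $ a * y $ b))"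
proof -
  have "P *\<^sub>v y \<in> carrier_vec n" using P y by auto
  then have "y \<bullet> (P *\<^sub>v y) = (\<Sum>a<n. y $ a * (P *\<^sub>v y) $ a)" by (rule scalar_prod_sum)
  also have "\<dots> = (\<Sum>a<n. y $ a * (\<Sum>b<n. P $$ (a, b) * y $ b))"
    by (intro sum.cong refl arg_cong2[where f = "(*)"] mult_mat_vec_component[OF P y]) simp
  finally show ?thesis by (simp add: sum_distrib_left mult_ac)
qed

lemma mat_inverse_nonsingular:
  assumes A: "A \<in> carrier_mat n n" and det: "Determinant.det A \<noteq> 0"
  shows "\<exists>S. mat_inverse A = Some S"
proof (cases "mat_inverse A")
  case None
  \<comment> \<open>The argument \<open>()\<close> instantiates the free parameter of the matrix
    ring, so that both facts speak of the same ring.\<close>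
  from mat_inverse(1)[OF A this, of "()"] det_non_zero_imp_unit[OF A det, of "()"]
  show ?thesis by blast
qed simp

text \<open>
  If \<open>R w = e\<^sub>a\<close>, then nonnegativity of the form \<open>R\<close> at \<open>x - t w\<close> with \<open>t = x\<^sub>a / w\<^sub>a\<close> reads
  \<open>x\<^sub>a\<^sup>2 \<le> w\<^sub>a (x \<bullet> R x)\<close>.
\<close>

lemma sym_pd_component_bound:
  assumes R: "sym_pd n R"
  shows "\<exists>c. \<forall>a<n. 0 \<le> c a \<and> (\<forall>x\<in>carrier_vec n. (x $ a)\<^sup>2 \<le> c a * (x \<bullet> (R *\<^sub>v x)))"
proof -
  have Rc: "R \<in> carrier_mat n n" and RT: "R\<^sup>T = R" using R by (auto simp: sym_pd_def)
  have psd: "0 \<le> x \<bullet> (R *\<^sub>v x)" if "x \<in> carrier_vec n" for x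
    using R that Rc by (cases "x = 0\<^sub>v n") (auto simp: sym_pd_def less_imp_le)
  have "Determinant.det R \<noteq> 0"
  proof
    assume "Determinant.det R = 0"
    then obtain v where "v \<in> carrier_vec n" "v \<noteq> 0\<^sub>v n" "R *\<^sub>v v = 0\<^sub>v n"
      using det_0_iff_vec_prod_zero[OF Rc] by blast
    then show False using R by (auto simp: sym_pd_def)
  qed
  then obtain S where S: "mat_inverse R = Some S"
    using mat_inverse_nonsingular[OF Rc] by blast
  then have RS: "R * S = 1\<^sub>m n" and Sc: "S \<in> carrier_mat n n" using mat_inverse(2)[OF Rc S] by auto
  have "0 \<le> S $$ (a, a) \<and> (\<forall>x\<in>carrier_vec n. (x $ a)\<^sup>2 \<le> S $$ (a, a) * (x \<bullet> (R *\<^sub>v x)))" if a: "a < n" for a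
  proof -
    define w where "w = col S a"
    have w: "w \<in> carrier_vec n" using Sc a by (auto simp: w_def)
    have Rw: "R *\<^sub>v w = unit_vec n a"
      using col_mult2[OF Rc Sc a] RS a by (simp add: w_def)
    have wa: "S $$ (a, a) = w $ a" using Sc a by (simp add: w_def)
    have wRw: "w \<bullet> (R *\<^sub>v w) = w $ a" using w a by (simp add: Rw)
    have w0: "w \<noteq> 0\<^sub>v n"
    proof
      assume "w = 0\<^sub>v n"
      then have "w $ a = 0" using a by simp
      moreover have "(R *\<^sub>v w) $ a = 0"
        using a \<open>w = 0\<^sub>v n\<close> by (subst mult_mat_vec_component[OF Rc w a]) simp
      ultimately show False using a Rw by simp
    qed
    have pos: "0 < w $ a" using R w w0 wRw by (auto simp: sym_pd_def)
    have "(x $ a)\<^sup>2 \<le> w $ a * (x \<bullet> (R *\<^sub>v x))" if x: "x \<in> carrier_vec n" for x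
    proof -
      define t where "t = x $ a / w $ a"
      have wx: "w \<bullet> (R *\<^sub>v x) = x $ a"
        using transpose_vec_mult_scalar[OF Rc x w] x a by (simp add: RT Rw)
      have "0 \<le> (x - t \<cdot>\<^sub>v w) \<bullet> (R *\<^sub>v (x - t \<cdot>\<^sub>v w))"
        using x w by (intro psd) auto
      also have "R *\<^sub>v (x - t \<cdot>\<^sub>v w) = R *\<^sub>v x - t \<cdot>\<^sub>v (R *\<^sub>v w)"
        using mult_minus_distrib_mat_vec[OF Rc x, of "t \<cdot>\<^sub>v w"] mult_mat_vec[OF Rc w] w by simp
      also have "(x - t \<cdot>\<^sub>v w) \<bullet> (R *\<^sub>v x - t \<cdot>\<^sub>v (R *\<^sub>v w))
        = x \<bullet> (R *\<^sub>v x) - t * (x \<bullet> (R *\<^sub>v w)) - t * (w \<bullet> (R *\<^sub>v x)) + t * t * (w \<bullet> (R *\<^sub>v w))"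
      proof -
        have c: "R *\<^sub>v x \<in> carrier_vec n" "R *\<^sub>v w \<in> carrier_vec n" "t \<cdot>\<^sub>v w \<in> carrier_vec n"
          "t \<cdot>\<^sub>v (R *\<^sub>v w) \<in> carrier_vec n"
          using Rc x w by auto
        have "(x - t \<cdot>\<^sub>v w) \<bullet> (R *\<^sub>v x - t \<cdot>\<^sub>v (R *\<^sub>v w))
          = (x \<bullet> (R *\<^sub>v x) - x \<bullet> (t \<cdot>\<^sub>v (R *\<^sub>v w)))
            - ((t \<cdot>\<^sub>v w) \<bullet> (R *\<^sub>v x) - (t \<cdot>\<^sub>v w) \<bullet> (t \<cdot>\<^sub>v (R *\<^sub>v w)))"
          using c x
          by (subst minus_scalar_prod_distrib[of _ n], simp_all add: scalar_prod_minus_distrib[of _ n])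
        also have "\<dots> = x \<bullet> (R *\<^sub>v x) - t * (x \<bullet> (R *\<^sub>v w)) - t * (w \<bullet> (R *\<^sub>v x)) + t * t * (w \<bullet> (R *\<^sub>v w))"
          using c(1,2) x w Rc by simp
        finally show ?thesis .
      qed
      also have "\<dots> = x \<bullet> (R *\<^sub>v x) - t * x $ a - t * x $ a + t * t * w $ a"
        using x a by (simp only: wx wRw Rw scalar_prod_right_unit)
      also have "\<dots> = x \<bullet> (R *\<^sub>v x) - (x $ a)\<^sup>2 / w $ a"
        using pos by (simp add: t_def power2_eq_square field_simps)
      finally show ?thesis using pos by (simp add: field_simps)
    qed
    then show ?thesis using pos wa by simp
  qed
  then show ?thesis by (intro exI[of _ "\<lambda>a. S $$ (a, a)"]) simp
qed

text \<open>A nonzero kernel vector v would give 0 < v \<bullet> R v \<le> v \<bullet> A v = 0. Only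
  with this is \<open>minv A\<close> known to be the inverse.\<close>

lemma minv_dominating:
  assumes R: "sym_pd n R" and A: "A \<in> carrier_mat n n"
    and le: "\<And>x. x \<in> carrier_vec n \<Longrightarrow> x \<bullet> (R *\<^sub>v x) \<le> x \<bullet> (A *\<^sub>v x)"
  shows "Determinant.det A \<noteq> 0" "minv A \<in> carrier_mat n n" "A * minv A = 1\<^sub>m n" "minv A * A = 1\<^sub>m n"
proof -
  show det: "Determinant.det A \<noteq> 0"
  proof
    assume "Determinant.det A = 0"
    then obtain v where v: "v \<in> carrier_vec n" "v \<noteq> 0\<^sub>v n" "A *\<^sub>v v = 0\<^sub>v n"
      using det_0_iff_vec_prod_zero[OF A] by blast
    then have "0 < v \<bullet> (R *\<^sub>v v)" using R by (auto simp: sym_pd_def)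
    also have "\<dots> \<le> v \<bullet> (A *\<^sub>v v)" by (rule le[OF v(1)])
    finally show False using v by simp
  qed
  obtain S where S: "mat_inverse A = Some S" using mat_inverse_nonsingular[OF A det] by blast
  then show "minv A \<in> carrier_mat n n" "A * minv A = 1\<^sub>m n" "minv A * A = 1\<^sub>m n"
    using mat_inverse(2)[OF A S] by (simp_all add: minv_def)
qed

text \<open>The k-th column x of the inverse satisfies x \<bullet> R x \<le> x \<bullet> A x = x_k.
  The component bound gives x_k^2 \<le> c_k x_k, hence x_k \<le> c_k, and then x_i^2 \<le> c_i c_k.
  These constants depend on R alone, so inverses of random matrices have bounded moments.\<close>

lemma minv_dominating_bound:
  assumes R: "sym_pd n R"
  obtains K where "\<And>A a b. A \<in> carrier_mat n n \<Longrightarrow> (\<And>x. x \<in> carrier_vec n \<Longrightarrow> x \<bullet> (R *\<^sub>v x) \<le> x \<bullet> (A *\<^sub>v x)) \<Longrightarrow>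
    a < n \<Longrightarrow> b < n \<Longrightarrow> \<bar>minv A $$ (a, b)\<bar> \<le> K a b"
proof -
  obtain c where c: "\<And>a. a < n \<Longrightarrow> 0 \<le> c a"
    and b: "\<And>a x. a < n \<Longrightarrow> x \<in> carrier_vec n \<Longrightarrow> (x $ a)\<^sup>2 \<le> c a * (x \<bullet> (R *\<^sub>v x))"
    using sym_pd_component_bound[OF R] by blast
  show ?thesis
  proof (rule that[of "\<lambda>a b. sqrt (c a * c b)"])
    fix A :: rmat and i k assume A: "A \<in> carrier_mat n n"
      and le: "\<And>x. x \<in> carrier_vec n \<Longrightarrow> x \<bullet> (R *\<^sub>v x) \<le> x \<bullet> (A *\<^sub>v x)" and i: "i < n" and k: "k < n"
    note inv = minv_dominating[OF R A le]
    define x where "x = col (minv A) k"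
    have x: "x \<in> carrier_vec n" using inv(2) k by (auto simp: x_def)
    have Ax: "A *\<^sub>v x = unit_vec n k"
      using col_mult2[OF A inv(2) k] inv(3) k by (simp add: x_def)
    have "x \<bullet> (A *\<^sub>v x) = x $ k" using x k by (simp add: Ax)
    then have Rx: "x \<bullet> (R *\<^sub>v x) \<le> x $ k" using le[OF x] by simp
    have sq: "(x $ a)\<^sup>2 \<le> c a * x $ k" if "a < n" for a
      using b[OF that x] mult_left_mono[OF Rx c[OF that]] by simp
    have "x $ k \<le> c k"
    proof (cases "x $ k \<le> 0")
      case True
      then show ?thesis using c[OF k] by simp
    next
      case False
      then show ?thesis using sq[OF k] by (simp add: power2_eq_square)
    qed
    then have "(x $ i)\<^sup>2 \<le> c i * c k"
      using sq[OF i] mult_left_mono[OF _ c[OF i]] by fastforce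
    then have "\<bar>x $ i\<bar> \<le> sqrt (c i * c k)" by (intro real_le_rsqrt) simp
    then show "\<bar>minv A $$ (i, k)\<bar> \<le> sqrt (c i * c k)" using inv(2) i k by (simp add: x_def)
  qed
qed

text \<open>Cramer's rule, wanted for measurability: cofactors and determinant are polynomials in
  the entries, whereas \<open>minv\<close> is defined through elimination.\<close>

lemma minv_eq_cofactor:
  assumes A: "A \<in> carrier_mat n n" and inv: "minv A \<in> carrier_mat n n" "minv A * A = 1\<^sub>m n"
    and det: "Determinant.det A \<noteq> 0" and ab: "a < n" "b < n"
  shows "minv A $$ (a, b) = cofactor A b a / Determinant.det A"
proof -
  note adj = adj_mat[OF A]
  have "adj_mat A = minv A * A * adj_mat A" using inv adj by simp
  also have "\<dots> = minv A * (Determinant.det A \<cdot>\<^sub>m 1\<^sub>m n)"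
    using inv(1) A adj by (simp add: assoc_mult_mat[of _ n n _ n _ n])
  also have "\<dots> = Determinant.det A \<cdot>\<^sub>m minv A"
    using inv(1) by (simp add: mult_smult_distrib[of _ n n _ n])
  finally have "adj_mat A $$ (a, b) = Determinant.det A * minv A $$ (a, b)"
    using inv(1) ab by simp
  moreover have "adj_mat A $$ (a, b) = cofactor A b a"
    using A ab by (simp add: adj_mat_def)
  ultimately show ?thesis using det by simp
qed

lemma sym_pd_aug_cov:
  assumes D: "valid_data D" and i: "i \<in> {1..steps D}"
  shows "sym_pd (odim D i + sdim D) (aug_cov D i)"
proof -
  have R: "sym_pd (odim D i) (obs_cov D i)" and \<gamma>: "0 < reg D"
    using D i by (auto simp: valid_data_def)
  then have Rc: "obs_cov D i \<in> carrier_mat (odim D i) (odim D i)" and RT: "(obs_cov D i)\<^sup>T = obs_cov D i"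
    by (auto simp: sym_pd_def)
  let ?I = "(1 / reg D) \<cdot>\<^sub>m 1\<^sub>m (sdim D) :: rmat"
  have IT: "?I\<^sup>T = ?I" by (intro eq_matI) auto
  have Ic: "?I \<in> carrier_mat (sdim D) (sdim D)" by simp
  have pos: "0 < v \<bullet> (aug_cov D i *\<^sub>v v)"
    if v: "v \<in> carrier_vec (odim D i + sdim D)" and v0: "v \<noteq> 0\<^sub>v (odim D i + sdim D)" for v
  proof -
    define x y where "x = vec_first v (odim D i)" and "y = vec_last v (sdim D)"
    have xy: "x \<in> carrier_vec (odim D i)" "y \<in> carrier_vec (sdim D)" "v = x @\<^sub>v y"
      using v by (simp_all add: x_def y_def)
    have "aug_cov D i *\<^sub>v v = (obs_cov D i *\<^sub>v x) @\<^sub>v (?I *\<^sub>v y)"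
      unfolding aug_cov_def xy(3) by (rule mult_mat_vec_split[OF Rc Ic xy(1,2)])
    also have "?I *\<^sub>v y = (1 / reg D) \<cdot>\<^sub>v y"
      using xy(2) by (intro eq_vecI) auto
    finally have q: "v \<bullet> (aug_cov D i *\<^sub>v v) = x \<bullet> (obs_cov D i *\<^sub>v x) + (1 / reg D) * (y \<bullet> y)"
      using xy Rc by (simp add: scalar_prod_append[of _ "odim D i" _ "sdim D"])
    have x0: "0 \<le> x \<bullet> (obs_cov D i *\<^sub>v x)" "x \<noteq> 0\<^sub>v (odim D i) \<Longrightarrow> 0 < x \<bullet> (obs_cov D i *\<^sub>v x)"
      using R xy(1) Rc by (cases "x = 0\<^sub>v (odim D i)"; auto simp: sym_pd_def less_imp_le)+
    have y0: "0 \<le> y \<bullet> y" by (simp add: scalar_prod_def sum_nonneg)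
    show ?thesis
    \<comment> \<open>A nonzero v has a nonzero upper part, where the observation covariance is
      strictly positive, or a nonzero lower part, where the squared length over the regularization
      constant is.\<close>
    proof (cases "x = 0\<^sub>v (odim D i)")
      case True
      have "y \<noteq> 0\<^sub>v (sdim D)"
      proof
        assume "y = 0\<^sub>v (sdim D)"
        then have "v = 0\<^sub>v (odim D i + sdim D)" using True xy(3) by (intro eq_vecI) auto
        then show False using v0 by simp
      qed
      then obtain a where "a < sdim D" "y $ a \<noteq> 0"
        using xy(2) by (metis carrier_vecD eq_vecI index_zero_vec(1) index_zero_vec(2))
      then have "0 < y \<bullet> y"
        unfolding scalar_prod_sum[OF xy(2)]
        by (intro sum_pos2[of _ a]) (auto simp: zero_less_mult_iff linorder_neq_iff)
      then show ?thesis using q x0(1) \<gamma> by (simp add: add_nonneg_pos)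
    next
      case False
      then show ?thesis using q x0(2) y0 \<gamma> by (simp add: add_pos_nonneg)
    qed
  qed
  have car: "aug_cov D i \<in> carrier_mat (odim D i + sdim D) (odim D i + sdim D)"
    using Rc by (simp add: aug_cov_def)
  have "(aug_cov D i)\<^sup>T = aug_cov D i"
    unfolding aug_cov_def
    using transpose_four_block_mat[OF Rc zero_carrier_mat zero_carrier_mat Ic] IT by (simp add: RT)
  then show ?thesis using car pos by (simp add: sym_pd_def)
qed

text \<open>The summand added to the form of \<open>R\<close> at \<open>x\<close> is the form of
  \<open>P\<close> at \<open>G\<^sup>T *\<^sub>v x\<close>, which is nonnegative.\<close>

lemma congruence_dominates:
  fixes P :: rmat
  assumes G: "G \<in> carrier_mat q m" and P: "P \<in> carrier_mat m m" and R: "R \<in> carrier_mat q q"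
    and psd: "\<And>y. y \<in> carrier_vec m \<Longrightarrow> 0 \<le> y \<bullet> (P *\<^sub>v y)" and x: "x \<in> carrier_vec q"
  shows "x \<bullet> (R *\<^sub>v x) \<le> x \<bullet> ((G * P * G\<^sup>T + R) *\<^sub>v x)"
proof -
  have y: "G\<^sup>T *\<^sub>v x \<in> carrier_vec m" using G x by auto
  have "(G * P * G\<^sup>T + R) *\<^sub>v x = G *\<^sub>v (P *\<^sub>v (G\<^sup>T *\<^sub>v x)) + R *\<^sub>v x"
    using G P R x
    by (simp add: add_mult_distrib_mat_vec[of _ q q] assoc_mult_mat_vec[of _ q m _ q] assoc_mult_mat_vec[of _ q m _ m])
  then have "x \<bullet> ((G * P * G\<^sup>T + R) *\<^sub>v x) = x \<bullet> (G *\<^sub>v (P *\<^sub>v (G\<^sup>T *\<^sub>v x))) + x \<bullet> (R *\<^sub>v x)"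
    using G P R x y by (simp add: scalar_prod_add_distrib[of _ q])
  also have "x \<bullet> (G *\<^sub>v (P *\<^sub>v (G\<^sup>T *\<^sub>v x))) = (G\<^sup>T *\<^sub>v x) \<bullet> (P *\<^sub>v (G\<^sup>T *\<^sub>v x))"
    using P y by (intro transpose_vec_mult_scalar[OF G _ x, symmetric]) auto
  finally show ?thesis using psd[OF y] by simp
qed

text \<open>The block row of the last block is its own sample covariance, and its form is a sum over
  members of squared centred linear forms divided by N - 1. This holds for every realization, as
  needed for the inversion of random matrices.\<close>

lemma sample_cov_psd:
  assumes N: "2 \<le> N" and i: "Suc i * m \<le> p" and y: "y \<in> carrier_vec m"
  shows "0 \<le> y \<bullet> (block_row m (sample_cov N p m F (\<lambda>n. block m (F n) i)) i *\<^sub>v y)"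
proof -
  let ?P = "block_row m (sample_cov N p m F (\<lambda>n. block m (F n) i)) i"
  define f where "f n a = F n $ (i * m + a) - (\<Sum>n=1..N. F n $ (i * m + a)) / real N" for n a
  have P: "?P \<in> carrier_mat m m" by (simp add: block_row_def sample_cov_def)
  have e: "?P $$ (a, b) = (\<Sum>n=1..N. f n a * f n b) / (real N - 1)" if "a < m" "b < m" for a b
  proof -
    have "i * m + a < p" using i that by simp
    then show ?thesis using that by (simp add: block_row_def sample_cov_def sample_mean_def block_def f_def)
  qed
  have "y \<bullet> (?P *\<^sub>v y) = (\<Sum>a<m. \<Sum>b<m. (\<Sum>n=1..N. f n a * f n b) / (real N - 1) * (y $ a * y $ b))"
    by (simp add: quadratic_form_sum[OF P y] e)
  also have "\<dots> = (\<Sum>a<m. \<Sum>b<m. \<Sum>n=1..N. (y $ a * f n a) * (y $ b * f n b) / (real N - 1))"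
  proof (intro sum.cong refl)
    fix a b
    have "(\<Sum>n=1..N. f n a * f n b) / (real N - 1) * (y $ a * y $ b)
      = (\<Sum>n=1..N. f n a * f n b / (real N - 1) * (y $ a * y $ b))"
      by (simp only: sum_divide_distrib sum_distrib_right)
    also have "\<dots> = (\<Sum>n=1..N. (y $ a * f n a) * (y $ b * f n b) / (real N - 1))"
      by (intro sum.cong refl) (simp add: mult_ac)
    finally show "(\<Sum>n=1..N. f n a * f n b) / (real N - 1) * (y $ a * y $ b)
      = (\<Sum>n=1..N. (y $ a * f n a) * (y $ b * f n b) / (real N - 1))" .
  qed
  also have "\<dots> = (\<Sum>a<m. \<Sum>n=1..N. \<Sum>b<m. (y $ a * f n a) * (y $ b * f n b) / (real N - 1))"
    by (intro sum.cong refl sum.swap)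
  also have "\<dots> = (\<Sum>n=1..N. \<Sum>a<m. \<Sum>b<m. (y $ a * f n a) * (y $ b * f n b) / (real N - 1))"
    by (rule sum.swap)
  also have "\<dots> = (\<Sum>n=1..N. (\<Sum>a<m. y $ a * f n a)\<^sup>2 / (real N - 1))"
    by (intro sum.cong refl) (simp add: power2_eq_square sum_product sum_divide_distrib)
  also have "\<dots> \<ge> 0" using N by (intro sum_nonneg) auto
  finally show ?thesis .
qed

text \<open>The computation for sample covariances with expectation in place of the average: the
  form is the second moment of a centred linear form. The moment assumption justifies exchanging
  sums and integrals.\<close>

lemma (in prob_space) cov_mat_psd:
  assumes i: "Suc i * m \<le> p" and y: "y \<in> carrier_vec m"
    and F: "\<And>a. a < p \<Longrightarrow> all_moments M (\<lambda>\<omega>. F \<omega> $ a)"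
  shows "0 \<le> y \<bullet> (block_row m (cov_mat M p m F (\<lambda>\<omega>. block m (F \<omega>) i)) i *\<^sub>v y)"
proof -
  let ?P = "block_row m (cov_mat M p m F (\<lambda>\<omega>. block m (F \<omega>) i)) i"
  define f where "f a \<omega> = F \<omega> $ (i * m + a) - (\<integral>\<omega>. F \<omega> $ (i * m + a) \<partial>M)" for a \<omega>
  have lt: "i * m + a < p" if "a < m" for a using i that by simp
  have f: "all_moments M (f a)" if "a < m" for a
    unfolding f_def using lt[OF that] by (intro all_moments_diff all_moments_const F)
  have P: "?P \<in> carrier_mat m m" by (simp add: block_row_def cov_mat_def)
  have e: "?P $$ (a, b) = (\<integral>\<omega>. f a \<omega> * f b \<omega> \<partial>M)" if "a < m" "b < m" for a b
    using that lt by (simp add: block_row_def cov_mat_def mean_vec_def block_def f_def)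
  have i1: "integrable M (\<lambda>\<omega>. f a \<omega> * f b \<omega> * (y $ a * y $ b))" if "a < m" "b < m" for a b
    using that by (intro integrable_mult_left all_moments_integrable all_moments_mult f)
  have "y \<bullet> (?P *\<^sub>v y) = (\<Sum>a<m. \<Sum>b<m. \<integral>\<omega>. f a \<omega> * f b \<omega> * (y $ a * y $ b) \<partial>M)"
    by (simp add: quadratic_form_sum[OF P y] e)
  also have "\<dots> = (\<Sum>a<m. \<integral>\<omega>. (\<Sum>b<m. f a \<omega> * f b \<omega> * (y $ a * y $ b)) \<partial>M)"
    using i1 by (intro sum.cong refl Bochner_Integration.integral_sum[symmetric]) auto
  also have "\<dots> = (\<integral>\<omega>. (\<Sum>a<m. \<Sum>b<m. f a \<omega> * f b \<omega> * (y $ a * y $ b)) \<partial>M)"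
    using i1 by (intro Bochner_Integration.integral_sum[symmetric] Bochner_Integration.integrable_sum) auto
  also have "\<dots> = (\<integral>\<omega>. (\<Sum>a<m. y $ a * f a \<omega>)\<^sup>2 \<partial>M)"
    by (simp add: power2_eq_square sum_product mult_ac)
  also have "\<dots> \<ge> 0" by simp
  finally show ?thesis .
qed

section \<open>Affine families of vectors\<close>

definition vaffine ::
  "'w measure \<Rightarrow> (nat \<Rightarrow> 'w \<Rightarrow> real) set \<Rightarrow> nat \<Rightarrow> (nat \<Rightarrow> 'w \<Rightarrow> rvec) \<Rightarrow> bool" where
  "vaffine M \<Gamma> p U \<longleftrightarrow> (\<forall>n\<ge>1. \<forall>\<omega>\<in>space M. U n \<omega> \<in> carrier_vec p) \<and>
     (\<forall>a<p. affine_family M \<Gamma> (\<lambda>n \<omega>. U n \<omega> $ a))"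

lemma vaffine_carrier: "vaffine M \<Gamma> p U \<Longrightarrow> 1 \<le> n \<Longrightarrow> \<omega> \<in> space M \<Longrightarrow> U n \<omega> \<in> carrier_vec p"
  by (simp add: vaffine_def)

lemma vaffine_component: "vaffine M \<Gamma> p U \<Longrightarrow> a < p \<Longrightarrow> affine_family M \<Gamma> (\<lambda>n \<omega>. U n \<omega> $ a)"
  by (simp add: vaffine_def)

lemma vaffineI:
  assumes "\<And>n \<omega>. 1 \<le> n \<Longrightarrow> \<omega> \<in> space M \<Longrightarrow> U n \<omega> \<in> carrier_vec p"
    and "\<And>n \<omega> a. 1 \<le> n \<Longrightarrow> \<omega> \<in> space M \<Longrightarrow> a < p \<Longrightarrow> U n \<omega> $ a = f a n \<omega>"
    and "\<And>a. a < p \<Longrightarrow> affine_family M \<Gamma> (f a)"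
  shows "vaffine M \<Gamma> p U"
  unfolding vaffine_def
proof (intro conjI allI impI ballI)
  show "affine_family M \<Gamma> (\<lambda>n \<omega>. U n \<omega> $ a)" if "a < p" for a
    by (rule affine_family.cong[OF assms(3)[OF that]]) (simp add: assms(2) that)
qed (rule assms(1))

lemma affine_family_sum:
  assumes "\<And>a. a \<in> A \<Longrightarrow> affine_family M \<Gamma> (f a)"
  shows "affine_family M \<Gamma> (\<lambda>n \<omega>. \<Sum>a\<in>A. f a n \<omega>)"
  using assms
proof (induction A rule: infinite_finite_induct)
  case (insert a A)
  then show ?case using affine_family.add[of M \<Gamma> "f a" "\<lambda>n \<omega>. \<Sum>a\<in>A. f a n \<omega>"] by simp
qed (simp_all add: affine_family.const)

lemma vaffine_const: "c \<in> carrier_vec p \<Longrightarrow> vaffine M \<Gamma> p (\<lambda>n \<omega>. c)"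
  by (simp add: vaffine_def affine_family.const)

lemma vaffine_add:
  assumes "vaffine M \<Gamma> p U" "vaffine M \<Gamma> p V"
  shows "vaffine M \<Gamma> p (\<lambda>n \<omega>. U n \<omega> + V n \<omega>)"
proof (rule vaffineI[where f = "\<lambda>a n \<omega>. U n \<omega> $ a + V n \<omega> $ a"])
  show "affine_family M \<Gamma> (\<lambda>n \<omega>. U n \<omega> $ a + V n \<omega> $ a)" if "a < p" for a
    by (intro affine_family.add vaffine_component[OF assms(1) that] vaffine_component[OF assms(2) that])
  fix n :: nat and \<omega> assume "1 \<le> n" "\<omega> \<in> space M"
  note c = vaffine_carrier[OF assms(1) this] vaffine_carrier[OF assms(2) this]
  show "U n \<omega> + V n \<omega> \<in> carrier_vec p" using c by simp
  show "(U n \<omega> + V n \<omega>) $ a = U n \<omega> $ a + V n \<omega> $ a" if "a < p" for a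
    using c that by simp
qed

lemma vaffine_diff:
  assumes "vaffine M \<Gamma> p U" "vaffine M \<Gamma> p V"
  shows "vaffine M \<Gamma> p (\<lambda>n \<omega>. U n \<omega> - V n \<omega>)"
proof (rule vaffineI[where f = "\<lambda>a n \<omega>. U n \<omega> $ a + (- 1) * V n \<omega> $ a"])
  show "affine_family M \<Gamma> (\<lambda>n \<omega>. U n \<omega> $ a + (- 1) * V n \<omega> $ a)" if "a < p" for a
    by (intro affine_family.add affine_family.cmult vaffine_component[OF assms(1) that] vaffine_component[OF assms(2) that])
  fix n :: nat and \<omega> assume "1 \<le> n" "\<omega> \<in> space M"
  note c = vaffine_carrier[OF assms(1) this] vaffine_carrier[OF assms(2) this]
  show "U n \<omega> - V n \<omega> \<in> carrier_vec p" using c by simp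
  show "(U n \<omega> - V n \<omega>) $ a = U n \<omega> $ a + (- 1) * V n \<omega> $ a" if "a < p" for a
    using c that by simp
qed

lemma vaffine_append:
  assumes "vaffine M \<Gamma> p U" "vaffine M \<Gamma> q V"
  shows "vaffine M \<Gamma> (p + q) (\<lambda>n \<omega>. U n \<omega> @\<^sub>v V n \<omega>)"
proof (rule vaffineI[where f = "\<lambda>a n \<omega>. if a < p then U n \<omega> $ a else V n \<omega> $ (a - p)"])
  show "affine_family M \<Gamma> (\<lambda>n \<omega>. if a < p then U n \<omega> $ a else V n \<omega> $ (a - p))" if "a < p + q" for a
    using that by (cases "a < p") (auto intro: vaffine_component[OF assms(1)] vaffine_component[OF assms(2)])
  show "U n \<omega> @\<^sub>v V n \<omega> \<in> carrier_vec (p + q)" if "1 \<le> n" "\<omega> \<in> space M" for n \<omega>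
    using vaffine_carrier[OF assms(1) that] vaffine_carrier[OF assms(2) that] by auto
  show "(U n \<omega> @\<^sub>v V n \<omega>) $ a = (if a < p then U n \<omega> $ a else V n \<omega> $ (a - p))"
    if "1 \<le> n" "\<omega> \<in> space M" "a < p + q" for n \<omega> a
    using vaffine_carrier[OF assms(1) that(1,2)] vaffine_carrier[OF assms(2) that(1,2)] that(3) by auto
qed

lemma vaffine_block:
  assumes "vaffine M \<Gamma> p U" "Suc i * m \<le> p"
  shows "vaffine M \<Gamma> m (\<lambda>n \<omega>. block m (U n \<omega>) i)"
proof (rule vaffineI[where f = "\<lambda>a n \<omega>. U n \<omega> $ (i * m + a)"])
  show "affine_family M \<Gamma> (\<lambda>n \<omega>. U n \<omega> $ (i * m + a))" if "a < m" for a
    using assms(2) that by (intro vaffine_component[OF assms(1)]) simp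
qed (simp_all add: block_def)

lemma vaffine_mult_mat_vec:
  assumes A: "A \<in> carrier_mat q p" and U: "vaffine M \<Gamma> p U"
  shows "vaffine M \<Gamma> q (\<lambda>n \<omega>. A *\<^sub>v U n \<omega>)"
proof (rule vaffineI[where f = "\<lambda>a n \<omega>. \<Sum>b<p. A $$ (a, b) * U n \<omega> $ b"])
  show "A *\<^sub>v U n \<omega> \<in> carrier_vec q" if "1 \<le> n" "\<omega> \<in> space M" for n \<omega>
    using A vaffine_carrier[OF U that] by auto
  show "(A *\<^sub>v U n \<omega>) $ a = (\<Sum>b<p. A $$ (a, b) * U n \<omega> $ b)" if "1 \<le> n" "\<omega> \<in> space M" "a < q" for n \<omega> a
    by (rule mult_mat_vec_component[OF A vaffine_carrier[OF U that(1,2)] that(3)])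
  show "affine_family M \<Gamma> (\<lambda>n \<omega>. \<Sum>b<p. A $$ (a, b) * U n \<omega> $ b)" for a
    by (intro affine_family_sum affine_family.cmult vaffine_component[OF U]) simp
qed

lemma append_vec_component:
  "x \<in> carrier_vec p \<Longrightarrow> y \<in> carrier_vec q \<Longrightarrow> a < p + q \<Longrightarrow>
    (x @\<^sub>v y) $ a = (if a < p then x $ a else y $ (a - p))"
  using carrier_vecD[of x p] carrier_vecD[of y q] by simp

lemma append_rows_entry:
  "A \<in> carrier_mat p c \<Longrightarrow> B \<in> carrier_mat q c \<Longrightarrow> a < p + q \<Longrightarrow> b < c \<Longrightarrow>
    (A @\<^sub>r B) $$ (a, b) = (if a < p then A $$ (a, b) else B $$ (a - p, b))"
  using carrier_matD[of A p c] carrier_matD[of B q c] by (simp add: append_rows_def)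

section \<open>Measurability of determinants and cofactors\<close>

lemma borel_measurable_det:
  assumes A: "\<And>\<omega>. \<omega> \<in> space M \<Longrightarrow> A \<omega> \<in> carrier_mat n n"
    and m: "\<And>a b. a < n \<Longrightarrow> b < n \<Longrightarrow> (\<lambda>\<omega>. A \<omega> $$ (a, b)) \<in> borel_measurable M"
  shows "(\<lambda>\<omega>. Determinant.det (A \<omega> :: rmat)) \<in> borel_measurable M"
proof -
  \<comment> \<open>Leibniz's formula exhibits the determinant as a polynomial in the
    entries.\<close>
  have "(\<lambda>\<omega>. \<Sum>p\<in>{p. p permutes {0..<n}}. signof p * (\<Prod>i = 0..<n. A \<omega> $$ (i, p i))) \<in> borel_measurable M"
  proof (intro borel_measurable_sum borel_measurable_times borel_measurable_const borel_measurable_prod m)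
    fix p i assume "p \<in> {p. p permutes {0..<n}}" "i \<in> {0..<n}"
    then show "p i < n" using permutes_in_image[of p "{0..<n}" i] by auto
  qed auto
  then show ?thesis
    by (rule measurable_cong[THEN iffD1, rotated]) (simp add: det_def'[OF A])
qed

lemma borel_measurable_cofactor:
  assumes A: "\<And>\<omega>. \<omega> \<in> space M \<Longrightarrow> A \<omega> \<in> carrier_mat n n"
    and m: "\<And>a b. a < n \<Longrightarrow> b < n \<Longrightarrow> (\<lambda>\<omega>. A \<omega> $$ (a, b)) \<in> borel_measurable M"
    and ij: "i < n" "j < n"
  shows "(\<lambda>\<omega>. cofactor (A \<omega> :: rmat) i j) \<in> borel_measurable M"
  unfolding cofactor_def
proof (intro borel_measurable_times borel_measurable_const borel_measurable_det[where n = "n - 1"])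
  show c: "mat_delete (A \<omega>) i j \<in> carrier_mat (n - 1) (n - 1)" if "\<omega> \<in> space M" for \<omega>
    using A[OF that] by (rule mat_delete_carrier)
  fix a b assume ab: "a < n - 1" "b < n - 1"
  let ?a = "if a < i then a else Suc a" and ?b = "if b < j then b else Suc b"
  have "(\<lambda>\<omega>. A \<omega> $$ (?a, ?b)) \<in> borel_measurable M" using ab by (intro m) auto
  then show "(\<lambda>\<omega>. mat_delete (A \<omega>) i j $$ (a, b)) \<in> borel_measurable M"
  proof (rule measurable_cong[THEN iffD1, rotated])
    fix \<omega> assume "\<omega> \<in> space M"
    from A[OF this] show "A \<omega> $$ (?a, ?b) = mat_delete (A \<omega>) i j $$ (a, b)"
      using ab by (simp add: mat_delete_def)
  qed
qed

section \<open>Limit rules for random vectors and matrices\<close>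

context prob_space
begin

lemma vconvI:
  assumes "\<forall>\<^sub>F i in G. \<forall>\<omega>\<in>space M. X i \<omega> \<in> carrier_vec n \<and> U i \<omega> \<in> carrier_vec n"
    and "\<forall>\<^sub>F i in G. \<forall>\<omega>\<in>space M. \<forall>a<n. X i \<omega> $ a = f a i \<omega> \<and> U i \<omega> $ a = g a i \<omega>"
    and "\<And>a. a < n \<Longrightarrow> mconv M G (f a) (g a)"
  shows "vconv M G n X U"
  unfolding vconv_def
proof (intro conjI allI impI assms(1))
  fix a assume a: "a < n"
  show "mconv M G (\<lambda>i \<omega>. X i \<omega> $ a) (\<lambda>i \<omega>. U i \<omega> $ a)"
  proof (rule mconv_cong[OF assms(3)[OF a]])
    show "\<forall>\<^sub>F i in G. \<forall>\<omega>\<in>space M. f a i \<omega> = X i \<omega> $ a"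
      using assms(2) by eventually_elim (simp add: a)
    show "\<forall>\<^sub>F i in G. \<forall>\<omega>\<in>space M. g a i \<omega> = U i \<omega> $ a"
      using assms(2) by eventually_elim (simp add: a)
  qed
qed

lemma matconvI:
  assumes "\<forall>\<^sub>F i in G. \<forall>\<omega>\<in>space M. A i \<omega> \<in> carrier_mat r c \<and> B i \<omega> \<in> carrier_mat r c"
    and "\<forall>\<^sub>F i in G. \<forall>\<omega>\<in>space M. \<forall>a<r. \<forall>b<c. A i \<omega> $$ (a, b) = f a b i \<omega> \<and> B i \<omega> $$ (a, b) = g a b i \<omega>"
    and "\<And>a b. a < r \<Longrightarrow> b < c \<Longrightarrow> mconv M G (f a b) (g a b)"
  shows "matconv M G r c A B"
  unfolding matconv_def
proof (intro conjI allI impI assms(1))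
  fix a b assume ab: "a < r" "b < c"
  show "mconv M G (\<lambda>i \<omega>. A i \<omega> $$ (a, b)) (\<lambda>i \<omega>. B i \<omega> $$ (a, b))"
  proof (rule mconv_cong[OF assms(3)[OF ab]])
    show "\<forall>\<^sub>F i in G. \<forall>\<omega>\<in>space M. f a b i \<omega> = A i \<omega> $$ (a, b)"
      using assms(2) by eventually_elim (simp add: ab)
    show "\<forall>\<^sub>F i in G. \<forall>\<omega>\<in>space M. g a b i \<omega> = B i \<omega> $$ (a, b)"
      using assms(2) by eventually_elim (simp add: ab)
  qed
qed

lemma vconv_filterlim:
  assumes "vconv M G n X U" "filterlim f G F"
  shows "vconv M F n (\<lambda>i. X (f i)) (\<lambda>i. U (f i))"
  unfolding vconv_def
proof (intro conjI allI impI)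
  show "\<forall>\<^sub>F i in F. \<forall>\<omega>\<in>space M. X (f i) \<omega> \<in> carrier_vec n \<and> U (f i) \<omega> \<in> carrier_vec n"
    by (rule eventually_compose_filterlim[OF vconv_carrier[OF assms(1)] assms(2)])
qed (rule mconv_filterlim[OF vconv_component[OF assms(1)] assms(2)])

lemma matconv_filterlim:
  assumes "matconv M G r c A B" "filterlim f G F"
  shows "matconv M F r c (\<lambda>i. A (f i)) (\<lambda>i. B (f i))"
  unfolding matconv_def
proof (intro conjI allI impI)
  show "\<forall>\<^sub>F i in F. \<forall>\<omega>\<in>space M. A (f i) \<omega> \<in> carrier_mat r c \<and> B (f i) \<omega> \<in> carrier_mat r c"
    by (rule eventually_compose_filterlim[OF matconv_carrier[OF assms(1)] assms(2)])
qed (rule mconv_filterlim[OF matconv_entry[OF assms(1)] assms(2)])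

lemma vconv_const: "v \<in> carrier_vec n \<Longrightarrow> vconv M G n (\<lambda>i \<omega>. v) (\<lambda>i \<omega>. v)"
  by (simp add: vconv_def mconv_const)

lemma matconv_const: "A \<in> carrier_mat r c \<Longrightarrow> matconv M G r c (\<lambda>i \<omega>. A) (\<lambda>i \<omega>. A)"
  by (simp add: matconv_def mconv_const)

lemma vconv_add:
  assumes "vconv M G n X U" "vconv M G n Y V"
  shows "vconv M G n (\<lambda>i \<omega>. X i \<omega> + Y i \<omega>) (\<lambda>i \<omega>. U i \<omega> + V i \<omega>)"
proof (rule vconvI)
  show "mconv M G (\<lambda>i \<omega>. X i \<omega> $ a + Y i \<omega> $ a) (\<lambda>i \<omega>. U i \<omega> $ a + V i \<omega> $ a)" if "a < n" for a
    by (intro mconv_add vconv_component[OF assms(1) that] vconv_component[OF assms(2) that])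
  show "\<forall>\<^sub>F i in G. \<forall>\<omega>\<in>space M. X i \<omega> + Y i \<omega> \<in> carrier_vec n \<and> U i \<omega> + V i \<omega> \<in> carrier_vec n"
    using vconv_carrier[OF assms(1)] vconv_carrier[OF assms(2)] by eventually_elim auto
  show "\<forall>\<^sub>F i in G. \<forall>\<omega>\<in>space M. \<forall>a<n. (X i \<omega> + Y i \<omega>) $ a = X i \<omega> $ a + Y i \<omega> $ a \<and>
      (U i \<omega> + V i \<omega>) $ a = U i \<omega> $ a + V i \<omega> $ a"
    using vconv_carrier[OF assms(2)] by eventually_elim auto
qed

lemma vconv_diff:
  assumes "vconv M G n X U" "vconv M G n Y V"
  shows "vconv M G n (\<lambda>i \<omega>. X i \<omega> - Y i \<omega>) (\<lambda>i \<omega>. U i \<omega> - V i \<omega>)"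
proof (rule vconvI)
  show "mconv M G (\<lambda>i \<omega>. X i \<omega> $ a - Y i \<omega> $ a) (\<lambda>i \<omega>. U i \<omega> $ a - V i \<omega> $ a)" if "a < n" for a
    by (intro mconv_diff vconv_component[OF assms(1) that] vconv_component[OF assms(2) that])
  show "\<forall>\<^sub>F i in G. \<forall>\<omega>\<in>space M. X i \<omega> - Y i \<omega> \<in> carrier_vec n \<and> U i \<omega> - V i \<omega> \<in> carrier_vec n"
    using vconv_carrier[OF assms(1)] vconv_carrier[OF assms(2)] by eventually_elim auto
  show "\<forall>\<^sub>F i in G. \<forall>\<omega>\<in>space M. \<forall>a<n. (X i \<omega> - Y i \<omega>) $ a = X i \<omega> $ a - Y i \<omega> $ a \<and>
      (U i \<omega> - V i \<omega>) $ a = U i \<omega> $ a - V i \<omega> $ a"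
    using vconv_carrier[OF assms(2)] by eventually_elim auto
qed

lemma vconv_append:
  assumes "vconv M G p X U" "vconv M G q Y V"
  shows "vconv M G (p + q) (\<lambda>i \<omega>. X i \<omega> @\<^sub>v Y i \<omega>) (\<lambda>i \<omega>. U i \<omega> @\<^sub>v V i \<omega>)"
proof (rule vconvI)
  show "mconv M G (\<lambda>i \<omega>. if a < p then X i \<omega> $ a else Y i \<omega> $ (a - p))
      (\<lambda>i \<omega>. if a < p then U i \<omega> $ a else V i \<omega> $ (a - p))" if "a < p + q" for a
    using that by (cases "a < p") (auto intro: vconv_component[OF assms(1)] vconv_component[OF assms(2)])
  show "\<forall>\<^sub>F i in G. \<forall>\<omega>\<in>space M. X i \<omega> @\<^sub>v Y i \<omega> \<in> carrier_vec (p + q) \<and> U i \<omega> @\<^sub>v V i \<omega> \<in> carrier_vec (p + q)"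
    using vconv_carrier[OF assms(1)] vconv_carrier[OF assms(2)] by eventually_elim auto
  show "\<forall>\<^sub>F i in G. \<forall>\<omega>\<in>space M. \<forall>a<p + q.
      (X i \<omega> @\<^sub>v Y i \<omega>) $ a = (if a < p then X i \<omega> $ a else Y i \<omega> $ (a - p)) \<and>
      (U i \<omega> @\<^sub>v V i \<omega>) $ a = (if a < p then U i \<omega> $ a else V i \<omega> $ (a - p))"
    using vconv_carrier[OF assms(1)] vconv_carrier[OF assms(2)]
    by eventually_elim (simp add: append_vec_component[of _ p _ q] del: index_append_vec)
qed

lemma vconv_block:
  assumes X: "vconv M G p X U" and i: "Suc k * m \<le> p"
  shows "vconv M G m (\<lambda>i \<omega>. block m (X i \<omega>) k) (\<lambda>i \<omega>. block m (U i \<omega>) k)"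
proof (rule vconvI)
  show "mconv M G (\<lambda>i \<omega>. X i \<omega> $ (k * m + a)) (\<lambda>i \<omega>. U i \<omega> $ (k * m + a))" if "a < m" for a
    using i that by (intro vconv_component[OF X]) simp
qed (simp_all add: block_def)

lemma vconv_mult_mat_vec:
  assumes A: "matconv M G q p A B" and X: "vconv M G p X U"
  shows "vconv M G q (\<lambda>i \<omega>. A i \<omega> *\<^sub>v X i \<omega>) (\<lambda>i \<omega>. B i \<omega> *\<^sub>v U i \<omega>)"
proof (rule vconvI)
  show "mconv M G (\<lambda>i \<omega>. \<Sum>b<p. A i \<omega> $$ (a, b) * X i \<omega> $ b) (\<lambda>i \<omega>. \<Sum>b<p. B i \<omega> $$ (a, b) * U i \<omega> $ b)"
    if "a < q" for a
    using that by (intro mconv_sum mconv_mult matconv_entry[OF A] vconv_component[OF X]) auto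
  show "\<forall>\<^sub>F i in G. \<forall>\<omega>\<in>space M. A i \<omega> *\<^sub>v X i \<omega> \<in> carrier_vec q \<and> B i \<omega> *\<^sub>v U i \<omega> \<in> carrier_vec q"
    using matconv_carrier[OF A] vconv_carrier[OF X] by eventually_elim (auto intro: mult_mat_vec_carrier)
  show "\<forall>\<^sub>F i in G. \<forall>\<omega>\<in>space M. \<forall>a<q. (A i \<omega> *\<^sub>v X i \<omega>) $ a = (\<Sum>b<p. A i \<omega> $$ (a, b) * X i \<omega> $ b) \<and>
      (B i \<omega> *\<^sub>v U i \<omega>) $ a = (\<Sum>b<p. B i \<omega> $$ (a, b) * U i \<omega> $ b)"
    using matconv_carrier[OF A] vconv_carrier[OF X]
    by eventually_elim (simp add: mult_mat_vec_component[of _ q p] del: index_mult_mat_vec)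
qed

lemma matconv_mult:
  assumes A: "matconv M G r s A A'" and B: "matconv M G s c B B'"
  shows "matconv M G r c (\<lambda>i \<omega>. A i \<omega> * B i \<omega>) (\<lambda>i \<omega>. A' i \<omega> * B' i \<omega>)"
proof (rule matconvI)
  show "mconv M G (\<lambda>i \<omega>. \<Sum>e<s. A i \<omega> $$ (a, e) * B i \<omega> $$ (e, b)) (\<lambda>i \<omega>. \<Sum>e<s. A' i \<omega> $$ (a, e) * B' i \<omega> $$ (e, b))"
    if "a < r" "b < c" for a b
    using that by (intro mconv_sum mconv_mult matconv_entry[OF A] matconv_entry[OF B]) auto
  show "\<forall>\<^sub>F i in G. \<forall>\<omega>\<in>space M. A i \<omega> * B i \<omega> \<in> carrier_mat r c \<and> A' i \<omega> * B' i \<omega> \<in> carrier_mat r c"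
    using matconv_carrier[OF A] matconv_carrier[OF B] by eventually_elim (auto intro: mult_carrier_mat)
  show "\<forall>\<^sub>F i in G. \<forall>\<omega>\<in>space M. \<forall>a<r. \<forall>b<c.
      (A i \<omega> * B i \<omega>) $$ (a, b) = (\<Sum>e<s. A i \<omega> $$ (a, e) * B i \<omega> $$ (e, b)) \<and>
      (A' i \<omega> * B' i \<omega>) $$ (a, b) = (\<Sum>e<s. A' i \<omega> $$ (a, e) * B' i \<omega> $$ (e, b))"
    using matconv_carrier[OF A] matconv_carrier[OF B]
    by eventually_elim (simp add: mult_mat_entry[of _ r s _ c] del: index_mult_mat)
qed

lemma matconv_add:
  assumes A: "matconv M G r c A A'" and B: "matconv M G r c B B'"
  shows "matconv M G r c (\<lambda>i \<omega>. A i \<omega> + B i \<omega>) (\<lambda>i \<omega>. A' i \<omega> + B' i \<omega>)"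
proof (rule matconvI)
  show "mconv M G (\<lambda>i \<omega>. A i \<omega> $$ (a, b) + B i \<omega> $$ (a, b)) (\<lambda>i \<omega>. A' i \<omega> $$ (a, b) + B' i \<omega> $$ (a, b))"
    if "a < r" "b < c" for a b
    using that by (intro mconv_add matconv_entry[OF A] matconv_entry[OF B])
  show "\<forall>\<^sub>F i in G. \<forall>\<omega>\<in>space M. A i \<omega> + B i \<omega> \<in> carrier_mat r c \<and> A' i \<omega> + B' i \<omega> \<in> carrier_mat r c"
    using matconv_carrier[OF A] matconv_carrier[OF B] by eventually_elim auto
  show "\<forall>\<^sub>F i in G. \<forall>\<omega>\<in>space M. \<forall>a<r. \<forall>b<c.
      (A i \<omega> + B i \<omega>) $$ (a, b) = A i \<omega> $$ (a, b) + B i \<omega> $$ (a, b) \<and>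
      (A' i \<omega> + B' i \<omega>) $$ (a, b) = A' i \<omega> $$ (a, b) + B' i \<omega> $$ (a, b)"
    using matconv_carrier[OF B] by eventually_elim auto
qed

lemma matconv_transpose:
  assumes A: "matconv M G r c A B"
  shows "matconv M G c r (\<lambda>i \<omega>. (A i \<omega>)\<^sup>T) (\<lambda>i \<omega>. (B i \<omega>)\<^sup>T)"
proof (rule matconvI)
  show "mconv M G (\<lambda>i \<omega>. A i \<omega> $$ (b, a)) (\<lambda>i \<omega>. B i \<omega> $$ (b, a))" if "a < c" "b < r" for a b
    using that by (intro matconv_entry[OF A])
  show "\<forall>\<^sub>F i in G. \<forall>\<omega>\<in>space M. (A i \<omega>)\<^sup>T \<in> carrier_mat c r \<and> (B i \<omega>)\<^sup>T \<in> carrier_mat c r"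
    using matconv_carrier[OF A] by eventually_elim auto
  show "\<forall>\<^sub>F i in G. \<forall>\<omega>\<in>space M. \<forall>a<c. \<forall>b<r.
      (A i \<omega>)\<^sup>T $$ (a, b) = A i \<omega> $$ (b, a) \<and> (B i \<omega>)\<^sup>T $$ (a, b) = B i \<omega> $$ (b, a)"
    using matconv_carrier[OF A] by eventually_elim auto
qed

lemma matconv_append_rows:
  assumes A: "matconv M G p c A A'" and B: "matconv M G q c B B'"
  shows "matconv M G (p + q) c (\<lambda>i \<omega>. A i \<omega> @\<^sub>r B i \<omega>) (\<lambda>i \<omega>. A' i \<omega> @\<^sub>r B' i \<omega>)"
proof (rule matconvI)
  show "mconv M G (\<lambda>i \<omega>. if a < p then A i \<omega> $$ (a, b) else B i \<omega> $$ (a - p, b))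
      (\<lambda>i \<omega>. if a < p then A' i \<omega> $$ (a, b) else B' i \<omega> $$ (a - p, b))" if "a < p + q" "b < c" for a b
    using that by (cases "a < p") (auto intro: matconv_entry[OF A] matconv_entry[OF B])
  show "\<forall>\<^sub>F i in G. \<forall>\<omega>\<in>space M. A i \<omega> @\<^sub>r B i \<omega> \<in> carrier_mat (p + q) c \<and> A' i \<omega> @\<^sub>r B' i \<omega> \<in> carrier_mat (p + q) c"
    using matconv_carrier[OF A] matconv_carrier[OF B] by eventually_elim (auto intro: carrier_append_rows)
  show "\<forall>\<^sub>F i in G. \<forall>\<omega>\<in>space M. \<forall>a<p + q. \<forall>b<c.
      (A i \<omega> @\<^sub>r B i \<omega>) $$ (a, b)
        = (if a < p then A i \<omega> $$ (a, b) else B i \<omega> $$ (a - p, b)) \<and>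
      (A' i \<omega> @\<^sub>r B' i \<omega>) $$ (a, b)
        = (if a < p then A' i \<omega> $$ (a, b) else B' i \<omega> $$ (a - p, b))"
    using matconv_carrier[OF A] matconv_carrier[OF B]
    by eventually_elim (simp add: append_rows_entry[of _ p c _ q])
qed

lemma matconv_block_row:
  assumes A: "matconv M G p c A B" and k: "Suc k * m \<le> p"
  shows "matconv M G m c (\<lambda>i \<omega>. block_row m (A i \<omega>) k) (\<lambda>i \<omega>. block_row m (B i \<omega>) k)"
proof (rule matconvI)
  show "mconv M G (\<lambda>i \<omega>. A i \<omega> $$ (k * m + a, b)) (\<lambda>i \<omega>. B i \<omega> $$ (k * m + a, b))" if "a < m" "b < c" for a b
    using that k by (intro matconv_entry[OF A]) auto
  show "\<forall>\<^sub>F i in G. \<forall>\<omega>\<in>space M. block_row m (A i \<omega>) k \<in> carrier_mat m c \<and> block_row m (B i \<omega>) k \<in> carrier_mat m c"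
    using matconv_carrier[OF A] by eventually_elim (auto simp: block_row_def)
  show "\<forall>\<^sub>F i in G. \<forall>\<omega>\<in>space M. \<forall>a<m. \<forall>b<c.
      block_row m (A i \<omega>) k $$ (a, b) = A i \<omega> $$ (k * m + a, b) \<and>
      block_row m (B i \<omega>) k $$ (a, b) = B i \<omega> $$ (k * m + a, b)"
    using matconv_carrier[OF A] by eventually_elim (auto simp: block_row_def)
qed

text \<open>For inverses S of A and T of B the resolvent identity reads S - T = S (B - A) T.
  Entrywise, S is bounded by constants of \<open>R\<close>, B - A vanishes and T is
  deterministic.\<close>

lemma matconv_minv:
  assumes A: "matconv M G n n A (\<lambda>i \<omega>. B)" and B: "B \<in> carrier_mat n n" and R: "sym_pd n R"
    and leA: "\<forall>\<^sub>F i in G. \<forall>\<omega>\<in>space M. \<forall>x\<in>carrier_vec n. x \<bullet> (R *\<^sub>v x) \<le> x \<bullet> (A i \<omega> *\<^sub>v x)"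
    and leB: "\<And>x. x \<in> carrier_vec n \<Longrightarrow> x \<bullet> (R *\<^sub>v x) \<le> x \<bullet> (B *\<^sub>v x)"
  shows "matconv M G n n (\<lambda>i \<omega>. minv (A i \<omega>)) (\<lambda>i \<omega>. minv B)"
proof -
  let ?inv = "\<lambda>A. A \<in> carrier_mat n n \<and> minv A \<in> carrier_mat n n \<and> minv A * A = 1\<^sub>m n \<and>
    Determinant.det A \<noteq> 0"
  obtain K where K: "\<And>A a b. A \<in> carrier_mat n n \<Longrightarrow> (\<And>x. x \<in> carrier_vec n \<Longrightarrow> x \<bullet> (R *\<^sub>v x) \<le> x \<bullet> (A *\<^sub>v x)) \<Longrightarrow>
    a < n \<Longrightarrow> b < n \<Longrightarrow> \<bar>minv A $$ (a, b)\<bar> \<le> K a b"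
    using minv_dominating_bound[OF R] by metis
  note KB = minv_dominating[OF R B leB]
  have KA: "\<forall>\<^sub>F i in G. \<forall>\<omega>\<in>space M. ?inv (A i \<omega>) \<and> (\<forall>a<n. \<forall>b<n. \<bar>minv (A i \<omega>) $$ (a, b)\<bar> \<le> K a b)"
    using matconv_carrier[OF A] leA
  proof eventually_elim
    case (elim i)
    show ?case
    proof
      fix \<omega> assume w: "\<omega> \<in> space M"
      have c: "A i \<omega> \<in> carrier_mat n n" using elim(1) w by blast
      note le = bspec[OF bspec[OF elim(2) w]]
      show "?inv (A i \<omega>) \<and> (\<forall>a<n. \<forall>b<n. \<bar>minv (A i \<omega>) $$ (a, b)\<bar> \<le> K a b)"
        using c minv_dominating[OF R c le] K[OF c le] by simp
    qed
  qed
  have mA: "\<forall>\<^sub>F i in G. \<forall>a\<in>{..<n}. \<forall>b\<in>{..<n}. (\<lambda>\<omega>. A i \<omega> $$ (a, b)) \<in> borel_measurable M"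
  proof (intro eventually_ball_finite ballI finite_lessThan)
    fix a b assume "a \<in> {..<n}" "b \<in> {..<n}"
    then have "\<forall>\<^sub>F i in G. all_moments M (\<lambda>\<omega>. A i \<omega> $$ (a, b))"
      using bounded_moments_moments[OF mconv_bounded[OF matconv_entry[OF A]]] by simp
    then show "\<forall>\<^sub>F i in G. (\<lambda>\<omega>. A i \<omega> $$ (a, b)) \<in> borel_measurable M"
      by eventually_elim (rule all_moments_measurable)
  qed
  \<comment> \<open>The uniform bound settles all moments at once; measurability comes from the
    cofactor formula.\<close>
  have bm: "bounded_moments M G (\<lambda>i \<omega>. minv (A i \<omega>) $$ (a, b))" if ab: "a < n" "b < n" for a b
  proof (rule bounded_moments_dominated)
    show "bounded_moments M G (\<lambda>i \<omega>. K a b)" by (intro bounded_moments_const all_moments_const)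
    show "\<forall>\<^sub>F i in G. \<forall>\<omega>\<in>space M. \<bar>minv (A i \<omega>) $$ (a, b)\<bar> \<le> \<bar>K a b\<bar>"
      using KA by eventually_elim (use ab in fastforce)
    show "\<forall>\<^sub>F i in G. (\<lambda>\<omega>. minv (A i \<omega>) $$ (a, b)) \<in> borel_measurable M"
      using KA mA
    proof eventually_elim
      case (elim i)
      have "(\<lambda>\<omega>. cofactor (A i \<omega>) b a / Determinant.det (A i \<omega>)) \<in> borel_measurable M"
        using elim ab
        by (intro borel_measurable_divide borel_measurable_cofactor[where n = n] borel_measurable_det[where n = n]) auto
      then show ?case
      proof (rule measurable_cong[THEN iffD1, rotated])
        fix \<omega> assume "\<omega> \<in> space M"
        then show "cofactor (A i \<omega>) b a / Determinant.det (A i \<omega>) = minv (A i \<omega>) $$ (a, b)"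
          using elim(1) ab by (intro minv_eq_cofactor[symmetric]) auto
      qed
    qed
  qed
  show ?thesis
    unfolding matconv_def
  proof (intro conjI allI impI)
    show "\<forall>\<^sub>F i in G. \<forall>\<omega>\<in>space M. minv (A i \<omega>) \<in> carrier_mat n n \<and> minv B \<in> carrier_mat n n"
      using KA KB by (auto elim: eventually_mono)
    fix a b assume ab: "a < n" "b < n"
    \<comment> \<open>The resolvent identity in entries, with the vanishing difference placed first
      and its sign reversed to fit the rule for products.\<close>
    have "vanishing M G (\<lambda>i \<omega>. \<Sum>d<n. (\<Sum>e<n. - (A i \<omega> $$ (e, d) - B $$ (e, d)) * minv (A i \<omega>) $$ (a, e)) * minv B $$ (d, b))"
    proof (intro vanishing_sum vanishing_mult bounded_moments_const all_moments_const)
      fix d e assume "d \<in> {..<n}" "e \<in> {..<n}"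
      then show "bounded_moments M G (\<lambda>i \<omega>. minv (A i \<omega>) $$ (a, e))"
        and "vanishing M G (\<lambda>i \<omega>. - (A i \<omega> $$ (e, d) - B $$ (e, d)))"
        using bm ab vanishing_cmult[OF mconv_vanishing[OF matconv_entry[OF A]], of e d "-1"] by auto
    qed
    then have "vanishing M G (\<lambda>i \<omega>. minv (A i \<omega>) $$ (a, b) - minv B $$ (a, b))"
    proof (rule vanishing_cong)
      show "\<forall>\<^sub>F i in G. \<forall>\<omega>\<in>space M.
        (\<Sum>d<n. (\<Sum>e<n. - (A i \<omega> $$ (e, d) - B $$ (e, d)) * minv (A i \<omega>) $$ (a, e)) * minv B $$ (d, b))
          = minv (A i \<omega>) $$ (a, b) - minv B $$ (a, b)"
        using KA
      proof eventually_elim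
        case (elim i)
        show ?case
        proof
          fix \<omega> assume w: "\<omega> \<in> space M"
          let ?A = "A i \<omega>" and ?S = "minv (A i \<omega>)" and ?T = "minv B"
          have c: "?A \<in> carrier_mat n n" "?S \<in> carrier_mat n n" "?T \<in> carrier_mat n n"
            using elim w KB by auto
          have "?S * (B - ?A) * ?T = (?S * B - ?S * ?A) * ?T"
            using c B by (simp add: mult_minus_distrib_mat[of _ n n _ n])
          also have "\<dots> = ?S * B * ?T - ?S * ?A * ?T"
            using c B by (intro minus_mult_distrib_mat[of _ n n _ _ n]) auto
          also have "?S * B * ?T = ?S"
            using c B KB by (simp add: assoc_mult_mat[of _ n n _ n _ n])
          also have "?S * ?A * ?T = ?T"
            using elim w c by simp
          finally have e: "?S * (B - ?A) * ?T = ?S - ?T" .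
          have c2: "?S * (B - ?A) \<in> carrier_mat n n" "B - ?A \<in> carrier_mat n n"
            using c B by (auto intro!: mult_carrier_mat[of _ n n] minus_carrier_mat)
          have "?S $$ (a, b) - ?T $$ (a, b) = (?S * (B - ?A) * ?T) $$ (a, b)"
            using c ab by (simp add: e)
          also have "\<dots> = (\<Sum>d<n. (?S * (B - ?A)) $$ (a, d) * ?T $$ (d, b))"
            by (rule mult_mat_entry[OF c2(1) c(3) ab])
          also have "\<dots> = (\<Sum>d<n. (\<Sum>e<n. ?S $$ (a, e) * (B - ?A) $$ (e, d)) * ?T $$ (d, b))"
            by (intro sum.cong refl arg_cong2[where f = "(*)"] mult_mat_entry[OF c(2) c2(2) ab(1)]) simp
          also have "\<dots> = (\<Sum>d<n. (\<Sum>e<n. - (?A $$ (e, d) - B $$ (e, d)) * ?S $$ (a, e)) * ?T $$ (d, b))"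
          proof (rule sum.cong[OF refl], rule arg_cong2[where f = "(*)", OF _ refl], rule sum.cong[OF refl])
            fix d e assume "d \<in> {..<n}" "e \<in> {..<n}"
            then show "?S $$ (a, e) * (B - ?A) $$ (e, d) = - (?A $$ (e, d) - B $$ (e, d)) * ?S $$ (a, e)"
              using carrier_matD[OF c(1)] by simp
          qed
          finally show "(\<Sum>d<n. (\<Sum>e<n. - (?A $$ (e, d) - B $$ (e, d)) * ?S $$ (a, e)) * ?T $$ (d, b))
            = ?S $$ (a, b) - ?T $$ (a, b)" by simp
        qed
      qed
    qed
    then show "mconv M G (\<lambda>i \<omega>. minv (A i \<omega>) $$ (a, b)) (\<lambda>i \<omega>. minv B $$ (a, b))"
      by (simp add: mconv_def bounded_moments_const all_moments_const)
  qed
qed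

end


section \<open>Convergence of the smoother\<close>

text \<open>Passage from natural to real exponents: the power is at most t below 1 and at most t^r
  above, so the first and the r-th moment control every exponent between 1 and r.\<close>

lemma powr_le_self_plus_power:
  assumes "0 \<le> t" "1 \<le> p" "p \<le> real r"
  shows "t powr p \<le> t + t ^ r"
proof (cases "t \<le> 1")
  case True
  have "t powr p \<le> t powr 1" using assms True by (intro powr_mono') auto
  then show ?thesis using assms by (simp add: add_increasing2)
next
  case False
  have "t powr p \<le> t powr real r" using assms False by (intro powr_mono) auto
  then show ?thesis using assms False by (simp add: powr_realpow add_increasing)
qed

lemma borel_measurable_enorm:
  assumes X: "X \<in> measurable M (borel_vec n)"
  shows "(\<lambda>\<omega>. enorm (X \<omega>)) \<in> borel_measurable M"
proof -
  have [measurable]: "(\<lambda>\<omega>. \<Sum>a<n. X \<omega> $ a * X \<omega> $ a) \<in> borel_measurable M"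
    using X by (intro borel_measurable_sum borel_measurable_times) (auto simp: measurable_borel_vec_iff)
  have "(\<lambda>\<omega>. sqrt (\<Sum>a<n. X \<omega> $ a * X \<omega> $ a)) \<in> borel_measurable M" by measurable
  then show ?thesis
    by (rule measurable_cong[THEN iffD1, rotated])
      (use X in \<open>auto simp: enorm_def measurable_borel_vec_iff scalar_prod_sum\<close>)
qed

text \<open>The least of the sizes bounds each of them from below.\<close>

lemma filterlim_sizes_at_top:
  assumes "l \<in> {1..j}"
  shows "filterlim (\<lambda>N. N l) at_top (sizes_at_top j)"
  unfolding filterlim_at_top
proof
  fix B :: nat
  have "\<forall>\<^sub>F N in filtercomap (\<lambda>N. Min (N ` {1..j})) at_top. B \<le> Min ((N :: nat \<Rightarrow> nat) ` {1..j})"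
    by (rule eventually_filtercomapI) (rule eventually_ge_at_top)
  then have "\<forall>\<^sub>F N in sizes_at_top j. B \<le> Min (N ` {1..j})"
    unfolding sizes_at_top_def by (rule filter_leD[OF inf_le1])
  then show "\<forall>\<^sub>F N in sizes_at_top j. B \<le> N l"
  proof eventually_elim
    case (elim N)
    have "Min (N ` {1..j}) \<le> N l" using assms by (intro Min_le) auto
    then show ?case using elim by simp
  qed
qed

context prob_space
begin

lemma all_moments_enorm_integrable:
  assumes X: "X \<in> measurable M (borel_vec n)" and m: "\<And>a. a < n \<Longrightarrow> all_moments M (\<lambda>\<omega>. X \<omega> $ a)"
    and p: "1 \<le> p"
  shows "integrable M (\<lambda>\<omega>. enorm (X \<omega>) powr p)"
proof (rule Bochner_Integration.integrable_bound)
  let ?Y = "\<lambda>\<omega>. \<Sum>a<n. \<bar>X \<omega> $ a\<bar>" and ?r = "nat \<lceil>p\<rceil>"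
  have Y: "all_moments M ?Y" by (intro all_moments_sum all_moments_abs m) simp
  show "integrable M (\<lambda>\<omega>. ?Y \<omega> + ?Y \<omega> ^ ?r)"
    by (intro Bochner_Integration.integrable_add all_moments_integrable all_moments_power Y)
  show "(\<lambda>\<omega>. enorm (X \<omega>) powr p) \<in> borel_measurable M"
    using borel_measurable_enorm[OF X] by measurable
  show "AE \<omega> in M. norm (enorm (X \<omega>) powr p) \<le> norm (?Y \<omega> + ?Y \<omega> ^ ?r)"
  proof (rule AE_I2)
    fix \<omega> assume "\<omega> \<in> space M"
    then have c: "X \<omega> \<in> carrier_vec n" using X by (simp add: measurable_borel_vec_iff)
    have "enorm (X \<omega>) powr p \<le> ?Y \<omega> powr p"
      using p enorm_le_sum[OF c] enorm_nonneg[of "X \<omega>"] by (intro powr_mono2) auto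
    also have "\<dots> \<le> ?Y \<omega> + ?Y \<omega> ^ ?r"
      using p real_nat_ceiling_ge[of p] by (intro powr_le_self_plus_power sum_nonneg) auto
    finally show "norm (enorm (X \<omega>) powr p) \<le> norm (?Y \<omega> + ?Y \<omega> ^ ?r)" by simp
  qed
qed

lemma in_Lp_all_moments:
  assumes "\<And>\<omega>. \<omega> \<in> space M \<Longrightarrow> X \<omega> \<in> carrier_vec n" "\<And>a. a < n \<Longrightarrow> all_moments M (\<lambda>\<omega>. X \<omega> $ a)" "1 \<le> p"
  shows "in_Lp M p n X"
proof -
  have "X \<in> measurable M (borel_vec n)"
    using assms by (auto simp: measurable_borel_vec_iff intro: all_moments_measurable)
  then show ?thesis using all_moments_enorm_integrable[OF _ assms(2,3)] by (simp add: in_Lp_def)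
qed

text \<open>The Euclidean norm of X - L is at most the sum \<open>?Y\<close> of the coordinate
  errors, and the p-th power of that sum is at most its first plus its r-th power, r being p rounded
  up. Both expectations tend to zero.\<close>

lemma Lp_tendsto_vconv:
  assumes X: "vconv M F n X (\<lambda>i. L)" and L: "\<And>\<omega>. \<omega> \<in> space M \<Longrightarrow> L \<omega> \<in> carrier_vec n"
    and Lm: "\<And>a. a < n \<Longrightarrow> all_moments M (\<lambda>\<omega>. L \<omega> $ a)" and p: "1 \<le> p"
  shows "Lp_tendsto M p n X L F"
  unfolding Lp_tendsto_def
proof (intro conjI)
  show "in_Lp M p n L" by (rule in_Lp_all_moments[OF L Lm p])
  have car: "\<forall>\<^sub>F i in F. \<forall>\<omega>\<in>space M. X i \<omega> \<in> carrier_vec n"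
    using vconv_carrier[OF X] by eventually_elim simp
  have "\<forall>\<^sub>F i in F. \<forall>a\<in>{..<n}. all_moments M (\<lambda>\<omega>. X i \<omega> $ a)"
  proof (intro eventually_ball_finite ballI finite_lessThan)
    show "\<forall>\<^sub>F i in F. all_moments M (\<lambda>\<omega>. X i \<omega> $ a)" if "a \<in> {..<n}" for a
      using bounded_moments_moments[OF mconv_bounded[OF vconv_component[OF X]]] that by simp
  qed
  with car show inLp: "\<forall>\<^sub>F i in F. in_Lp M p n (X i)"
    by eventually_elim (rule in_Lp_all_moments[OF _ _ p]; simp)
  let ?Y = "\<lambda>i \<omega>. \<Sum>a<n. \<bar>X i \<omega> $ a - L \<omega> $ a\<bar>" and ?r = "nat \<lceil>p\<rceil>"
  have r: "1 \<le> ?r" "p \<le> real ?r" using p real_nat_ceiling_ge[of p] by linarith+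
  have Y: "vanishing M F ?Y"
    by (intro vanishing_sum vanishing_abs mconv_vanishing[OF vconv_component[OF X]]) simp
  have lim: "((\<lambda>i. (\<integral>\<omega>. \<bar>?Y i \<omega>\<bar> ^ 1 \<partial>M) + (\<integral>\<omega>. \<bar>?Y i \<omega>\<bar> ^ ?r \<partial>M)) \<longlongrightarrow> 0 + 0) F"
    by (intro tendsto_add vanishing_abs_power[OF Y] r order_refl)
  have "((\<lambda>i. \<integral>\<omega>. enorm (X i \<omega> - L \<omega>) powr p \<partial>M) \<longlongrightarrow> 0) F"
  proof (rule tendsto_sandwich[OF _ _ tendsto_const])
    show "((\<lambda>i. (\<integral>\<omega>. \<bar>?Y i \<omega>\<bar> ^ 1 \<partial>M) + (\<integral>\<omega>. \<bar>?Y i \<omega>\<bar> ^ ?r \<partial>M)) \<longlongrightarrow> 0) F" using lim by simp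
    show "\<forall>\<^sub>F i in F. (\<integral>\<omega>. enorm (X i \<omega> - L \<omega>) powr p \<partial>M)
        \<le> (\<integral>\<omega>. \<bar>?Y i \<omega>\<bar> ^ 1 \<partial>M) + (\<integral>\<omega>. \<bar>?Y i \<omega>\<bar> ^ ?r \<partial>M)"
      using bounded_moments_moments[OF vanishing_bounded[OF Y]] car
    proof eventually_elim
      case (elim i)
      note am = all_moments_abs_power[OF elim(1)]
      have "(\<integral>\<omega>. enorm (X i \<omega> - L \<omega>) powr p \<partial>M) \<le> (\<integral>\<omega>. \<bar>?Y i \<omega>\<bar> ^ 1 + \<bar>?Y i \<omega>\<bar> ^ ?r \<partial>M)"
      \<comment> \<open>This form of monotonicity asks for integrability of the larger function and
        its nonnegativity.\<close>
      proof (rule integral_mono_AE')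
        show "integrable M (\<lambda>\<omega>. \<bar>?Y i \<omega>\<bar> ^ 1 + \<bar>?Y i \<omega>\<bar> ^ ?r)"
          by (intro Bochner_Integration.integrable_add am)
        show "AE \<omega> in M. enorm (X i \<omega> - L \<omega>) powr p \<le> \<bar>?Y i \<omega>\<bar> ^ 1 + \<bar>?Y i \<omega>\<bar> ^ ?r"
        proof (rule AE_I2)
          fix \<omega> assume w: "\<omega> \<in> space M"
          have c: "X i \<omega> - L \<omega> \<in> carrier_vec n" using elim(2) L w by auto
          have "enorm (X i \<omega> - L \<omega>) \<le> (\<Sum>a<n. \<bar>(X i \<omega> - L \<omega>) $ a\<bar>)" by (rule enorm_le_sum[OF c])
          also have "\<dots> = ?Y i \<omega>" using carrier_vecD[OF L[OF w]] by (intro sum.cong) auto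
          finally have "enorm (X i \<omega> - L \<omega>) powr p \<le> ?Y i \<omega> powr p"
            using p enorm_nonneg by (intro powr_mono2) auto
          also have "\<dots> \<le> ?Y i \<omega> + ?Y i \<omega> ^ ?r"
            using p r by (intro powr_le_self_plus_power sum_nonneg) auto
          finally show "enorm (X i \<omega> - L \<omega>) powr p \<le> \<bar>?Y i \<omega>\<bar> ^ 1 + \<bar>?Y i \<omega>\<bar> ^ ?r"
            by (simp add: sum_nonneg)
        qed
      qed simp
      also have "\<dots> = (\<integral>\<omega>. \<bar>?Y i \<omega>\<bar> ^ 1 \<partial>M) + (\<integral>\<omega>. \<bar>?Y i \<omega>\<bar> ^ ?r \<partial>M)"
        by (intro Bochner_Integration.integral_add am)
      finally show ?case .
    qed
  qed simp
  then show "((\<lambda>i. Lp_norm M p (\<lambda>\<omega>. X i \<omega> - L \<omega>)) \<longlongrightarrow> 0) F"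
    unfolding Lp_norm_def using p by (intro tendsto_zero_powrI[where b = "1 / p"]) auto
qed

text \<open>Each coordinate is continuous by differentiability, and the growth bound on the norm of
  the map bounds every coordinate.\<close>

lemma vconv_map:
  assumes f: "cont_diff p q f J" and \<kappa>: "0 < \<kappa>" "0 \<le> s"
    and g: "\<And>x. x \<in> carrier_vec p \<Longrightarrow> enorm (f x) \<le> \<kappa> * (1 + rpow (enorm x) s)"
    and Z: "vconv M G p Z (\<lambda>i \<omega>. u)" and u: "u \<in> carrier_vec p"
  shows "vconv M G q (\<lambda>i \<omega>. f (Z i \<omega>)) (\<lambda>i \<omega>. f u)"
  unfolding vconv_def
proof (intro conjI allI impI)
  have fc: "f x \<in> carrier_vec q" if "x \<in> carrier_vec p" for x
    using f that by (auto simp: cont_diff_def has_jacobian_def)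
  show "\<forall>\<^sub>F i in G. \<forall>\<omega>\<in>space M. f (Z i \<omega>) \<in> carrier_vec q \<and> f u \<in> carrier_vec q"
    using vconv_carrier[OF Z] by eventually_elim (simp add: fc u)
  fix a assume a: "a < q"
  show "mconv M G (\<lambda>i \<omega>. f (Z i \<omega>) $ a) (\<lambda>i \<omega>. f u $ a)"
  proof (rule mconv_continuous[OF Z u])
    show "vcontinuous p (\<lambda>x. f x $ a)"
      using f[unfolded cont_diff_def] by (intro vcontinuous_differentiable[where J = J, OF _ a]) simp
    show "poly_growth p (\<lambda>x. f x $ a)"
      by (rule poly_growth_rpow[OF \<kappa>]) (rule order_trans[OF abs_component_le_enorm[OF fc a] g])
  qed
qed

lemma matconv_map:
  assumes f: "cont_diff p q f J" and \<kappa>: "0 < \<kappa>" "0 \<le> s"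
    and g: "\<And>x. x \<in> carrier_vec p \<Longrightarrow> spectral_norm (J x) \<le> \<kappa> * (1 + rpow (enorm x) s)"
    and Z: "vconv M G p Z (\<lambda>i \<omega>. u)" and u: "u \<in> carrier_vec p"
  shows "matconv M G q p (\<lambda>i \<omega>. J (Z i \<omega>)) (\<lambda>i \<omega>. J u)"
  unfolding matconv_def
proof (intro conjI allI impI)
  have Jc: "J x \<in> carrier_mat q p" if "x \<in> carrier_vec p" for x
    using f that by (auto simp: cont_diff_def has_jacobian_def)
  show "\<forall>\<^sub>F i in G. \<forall>\<omega>\<in>space M. J (Z i \<omega>) \<in> carrier_mat q p \<and> J u \<in> carrier_mat q p"
    using vconv_carrier[OF Z] by eventually_elim (simp add: Jc u)
  fix a b assume ab: "a < q" "b < p"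
  show "mconv M G (\<lambda>i \<omega>. J (Z i \<omega>) $$ (a, b)) (\<lambda>i \<omega>. J u $$ (a, b))"
  proof (rule mconv_continuous[OF Z u])
    show "vcontinuous p (\<lambda>x. J x $$ (a, b))" by (rule vcontinuous_jacobian[OF f ab])
    show "poly_growth p (\<lambda>x. J x $$ (a, b))"
      by (rule poly_growth_rpow[OF \<kappa>]) (rule order_trans[OF abs_entry_le_spectral_norm[OF Jc ab] g])
  qed
qed

section \<open>Sample means and covariances of ensembles with affine references\<close>

context
  fixes \<Gamma> :: "(nat \<Rightarrow> 'a \<Rightarrow> real) set"
  assumes \<Gamma>: "\<And>g. g \<in> \<Gamma> \<Longrightarrow> \<exists>w. lln_family M g w"
    and \<Gamma>2: "\<And>g h. g \<in> \<Gamma> \<Longrightarrow> h \<in> \<Gamma> \<Longrightarrow> \<exists>w. lln_family M (\<lambda>n \<omega>. g n \<omega> * h n \<omega>) w"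
begin

lemma vaffine_lln:
  assumes "vaffine M \<Gamma> p U" "a < p"
  shows "lln_family M (\<lambda>n \<omega>. U n \<omega> $ a) (\<integral>\<omega>. U 1 \<omega> $ a \<partial>M)"
proof -
  obtain w where w: "lln_family M (\<lambda>n \<omega>. U n \<omega> $ a) w"
    using lln_family_affine[OF \<Gamma> vaffine_component[OF assms]] by blast
  then show ?thesis using lln_family_expectation[OF w order_refl] by simp
qed

lemma vaffine_moments: "vaffine M \<Gamma> p U \<Longrightarrow> a < p \<Longrightarrow> 1 \<le> n \<Longrightarrow> all_moments M (\<lambda>\<omega>. U n \<omega> $ a)"
  using lln_family_moments[OF vaffine_lln] by blast

text \<open>Inputs enter the algorithm and the reference identically and so converge to themselves;
  what is at stake is a moment bound uniform in the members.\<close>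

lemma vconv_vaffine:
  assumes "vaffine M \<Gamma> p U"
  shows "vconv M (ensemble_filter F S) p (\<lambda>r. U (snd r)) (\<lambda>r. U (snd r))"
  unfolding vconv_def
proof (intro conjI allI impI mconv_refl)
  show "\<forall>\<^sub>F r in ensemble_filter F S. \<forall>\<omega>\<in>space M. U (snd r) \<omega> \<in> carrier_vec p \<and> U (snd r) \<omega> \<in> carrier_vec p"
    using vaffine_carrier[OF assms] by (auto simp: eventually_ensemble_filter)
  show "bounded_moments M (ensemble_filter F S) (\<lambda>r \<omega>. U (snd r) \<omega> $ a)" if "a < p" for a
    by (rule bounded_moments_filterlim[OF lln_family_bounded[OF vaffine_lln[OF assms that]] filterlim_ensemble_snd])
qed

lemma vconv_sample_mean:
  assumes X: "vconv M (ensemble_filter F S) p X (\<lambda>r. U (snd r))" and U: "vaffine M \<Gamma> p U"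
    and S: "filterlim S at_top F"
  shows "vconv M F p (\<lambda>i \<omega>. sample_mean (S i) p (\<lambda>n. X (i, n) \<omega>)) (\<lambda>i \<omega>. mean_vec M p (U 1))"
proof (rule vconvI)
  show "mconv M F (\<lambda>i \<omega>. (\<Sum>n=1..S i. X (i, n) \<omega> $ a) / real (S i)) (\<lambda>i \<omega>. \<integral>\<omega>. U 1 \<omega> $ a \<partial>M)" if "a < p" for a
    by (rule mconv_mean[OF vconv_component[OF X that] vaffine_lln[OF U that] S])
qed (simp_all add: sample_mean_def mean_vec_def)

lemma matconv_sample_cov:
  assumes X: "vconv M (ensemble_filter F S) p X (\<lambda>r. U (snd r))" and U: "vaffine M \<Gamma> p U"
    and Y: "vconv M (ensemble_filter F S) q Y (\<lambda>r. V (snd r))" and V: "vaffine M \<Gamma> q V"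
    and S: "filterlim S at_top F"
  shows "matconv M F p q (\<lambda>i \<omega>. sample_cov (S i) p q (\<lambda>n. X (i, n) \<omega>) (\<lambda>n. Y (i, n) \<omega>))
    (\<lambda>i \<omega>. cov_mat M p q (U 1) (V 1))"
proof (rule matconvI)
  fix a b assume a: "a < p" and b: "b < q"
  obtain w where w: "lln_family M (\<lambda>n \<omega>. U n \<omega> $ a * V n \<omega> $ b) w"
    using lln_family_affine_mult[OF \<Gamma> \<Gamma>2 vaffine_component[OF U a] vaffine_component[OF V b]] by blast
  show "mconv M F
    (\<lambda>i \<omega>. (\<Sum>n=1..S i. (X (i, n) \<omega> $ a - (\<Sum>n=1..S i. X (i, n) \<omega> $ a) / real (S i))
        * (Y (i, n) \<omega> $ b - (\<Sum>n=1..S i. Y (i, n) \<omega> $ b) / real (S i))) / (real (S i) - 1))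
    (\<lambda>i \<omega>. \<integral>\<omega>. (U 1 \<omega> $ a - (\<integral>\<omega>. U 1 \<omega> $ a \<partial>M)) * (V 1 \<omega> $ b - (\<integral>\<omega>. V 1 \<omega> $ b \<partial>M)) \<partial>M)"
    by (rule mconv_sample_covariance[OF vconv_component[OF X a] vconv_component[OF Y b]
          vaffine_lln[OF U a] vaffine_lln[OF V b] w S])
qed (simp_all add: sample_cov_def cov_mat_def sample_mean_def mean_vec_def)

end

end

section \<open>One forecast and one analysis step\<close>

context prob_space
begin

context
  fixes D :: lm_data and \<kappa> s :: real
  assumes D: "valid_data D" and \<kappa>: "0 < \<kappa>" "0 \<le> s" and growth: "growth_bound D \<kappa> s"
begin

lemma evol_conv:
  assumes i: "i \<in> {1..steps D}" and Z: "vconv M G (sdim D) Z (\<lambda>i \<omega>. u)" and u: "u \<in> carrier_vec (sdim D)"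
  shows "vconv M G (sdim D) (\<lambda>r \<omega>. evol D i (Z r \<omega>)) (\<lambda>r \<omega>. evol D i u)"
    and "matconv M G (sdim D) (sdim D) (\<lambda>r \<omega>. evol_jac D i (Z r \<omega>)) (\<lambda>r \<omega>. evol_jac D i u)"
proof -
  have c: "cont_diff (sdim D) (sdim D) (evol D i) (evol_jac D i)" using D i by (simp add: valid_data_def)
  show "vconv M G (sdim D) (\<lambda>r \<omega>. evol D i (Z r \<omega>)) (\<lambda>r \<omega>. evol D i u)"
    by (rule vconv_map[OF c \<kappa> _ Z u]) (use growth i in \<open>simp add: growth_bound_def\<close>)
  show "matconv M G (sdim D) (sdim D) (\<lambda>r \<omega>. evol_jac D i (Z r \<omega>)) (\<lambda>r \<omega>. evol_jac D i u)"
    by (rule matconv_map[OF c \<kappa> _ Z u]) (use growth i in \<open>simp add: growth_bound_def\<close>)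
qed

lemma aug_obs_conv:
  assumes i: "i \<in> {1..steps D}" and Z: "vconv M G (sdim D) Z (\<lambda>i \<omega>. u)" and u: "u \<in> carrier_vec (sdim D)"
  shows "vconv M G (odim D i + sdim D) (\<lambda>r \<omega>. aug_obs D i (Z r \<omega>)) (\<lambda>r \<omega>. aug_obs D i u)"
    and "matconv M G (odim D i + sdim D) (sdim D) (\<lambda>r \<omega>. aug_jac D i (Z r \<omega>)) (\<lambda>r \<omega>. aug_jac D i u)"
proof -
  have c: "cont_diff (sdim D) (odim D i) (obs D i) (obs_jac D i)" using D i by (simp add: valid_data_def)
  have "vconv M G (odim D i) (\<lambda>r \<omega>. obs D i (Z r \<omega>)) (\<lambda>r \<omega>. obs D i u)"
    by (rule vconv_map[OF c \<kappa> _ Z u]) (use growth i in \<open>simp add: growth_bound_def\<close>)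
  then show "vconv M G (odim D i + sdim D) (\<lambda>r \<omega>. aug_obs D i (Z r \<omega>)) (\<lambda>r \<omega>. aug_obs D i u)"
    unfolding aug_obs_def by (intro vconv_append Z)
  have "matconv M G (odim D i) (sdim D) (\<lambda>r \<omega>. obs_jac D i (Z r \<omega>)) (\<lambda>r \<omega>. obs_jac D i u)"
    by (rule matconv_map[OF c \<kappa> _ Z u]) (use growth i in \<open>simp add: growth_bound_def\<close>)
  then show "matconv M G (odim D i + sdim D) (sdim D) (\<lambda>r \<omega>. aug_jac D i (Z r \<omega>)) (\<lambda>r \<omega>. aug_jac D i u)"
    unfolding aug_jac_def by (intro matconv_append_rows matconv_const one_carrier_mat)
qed

lemma linearization_carrier:
  assumes i: "i \<in> {1..steps D}" and u: "u \<in> carrier_vec (sdim D)"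
  shows "evol D i u \<in> carrier_vec (sdim D)" "evol_jac D i u \<in> carrier_mat (sdim D) (sdim D)"
    "aug_obs D i u \<in> carrier_vec (odim D i + sdim D)" "aug_jac D i u \<in> carrier_mat (odim D i + sdim D) (sdim D)"
proof -
  have c: "cont_diff (sdim D) (sdim D) (evol D i) (evol_jac D i)"
    "cont_diff (sdim D) (odim D i) (obs D i) (obs_jac D i)" using D i by (simp_all add: valid_data_def)
  then show "evol D i u \<in> carrier_vec (sdim D)" "evol_jac D i u \<in> carrier_mat (sdim D) (sdim D)"
    using u by (auto simp: cont_diff_def has_jacobian_def)
  have "obs D i u \<in> carrier_vec (odim D i)" "obs_jac D i u \<in> carrier_mat (odim D i) (sdim D)"
    using c u by (auto simp: cont_diff_def has_jacobian_def)
  then show "aug_obs D i u \<in> carrier_vec (odim D i + sdim D)" "aug_jac D i u \<in> carrier_mat (odim D i + sdim D) (sdim D)"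
    using u by (auto simp: aug_obs_def aug_jac_def)
qed

lemma block_carrier: "block m v i \<in> carrier_vec m"
  by (simp add: block_def)

lemma append_forecast_conv:
  assumes i: "Suc i \<in> {1..steps D}"
    and Z: "vconv M G (Suc (steps D) * sdim D) Z (\<lambda>r \<omega>. z)"
    and V: "vconv M G (sdim D) V V'" and X: "vconv M G (Suc i * sdim D) X X'"
  shows "vconv M G (Suc (Suc i) * sdim D)
    (\<lambda>r \<omega>. append_forecast D (Z r \<omega>) (Suc i) (V r \<omega>) (X r \<omega>))
    (\<lambda>r \<omega>. append_forecast D z (Suc i) (V' r \<omega>) (X' r \<omega>))"
proof -
  have "Suc i * sdim D \<le> Suc (steps D) * sdim D" using i by (intro mult_le_mono1) auto
  note Zb = vconv_block[OF Z this]
  note ev = evol_conv[OF i Zb block_carrier]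
  have mu: "forcing D (Suc i) \<in> carrier_vec (sdim D)" using D i by (simp add: valid_data_def)
  have e: "Suc (Suc i) * sdim D = Suc i * sdim D + sdim D" by simp
  show ?thesis
    unfolding append_forecast_def Let_def diff_Suc_1 e
    by (intro vconv_append X vconv_add V vconv_const[OF mu] ev(1) vconv_mult_mat_vec[OF ev(2)] vconv_diff
        vconv_block[OF X] Zb order_refl)
qed

lemma append_forecast_vaffine:
  assumes i: "Suc i \<in> {1..steps D}" and V: "vaffine M \<Gamma> (sdim D) V" and X: "vaffine M \<Gamma> (Suc i * sdim D) X"
  shows "vaffine M \<Gamma> (Suc (Suc i) * sdim D) (\<lambda>n \<omega>. append_forecast D z (Suc i) (V n \<omega>) (X n \<omega>))"
proof -
  have mu: "forcing D (Suc i) \<in> carrier_vec (sdim D)" using D i by (simp add: valid_data_def)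
  note lc = linearization_carrier[OF i block_carrier]
  have e: "Suc (Suc i) * sdim D = Suc i * sdim D + sdim D" by simp
  show ?thesis
    unfolding append_forecast_def Let_def diff_Suc_1 e
    by (intro vaffine_append X vaffine_add V vaffine_const[OF mu] vaffine_const[OF lc(1)]
        vaffine_mult_mat_vec[OF lc(2)] vaffine_diff vaffine_block[OF X] vaffine_const block_carrier order_refl)
qed

text \<open>Inversion preserves the limit because the random and the limiting innovation matrices
  both dominate \<open>aug_cov D i\<close>. Semidefiniteness is assumed for the block row that the
  gain inverts, at every outcome and in the limit.\<close>

lemma gain_conv:
  assumes i: "i \<in> {1..steps D}" and q: "q = odim D i + sdim D" and p: "p = Suc i * sdim D"
    and C: "matconv M G p (sdim D) C (\<lambda>r \<omega>. C')" and C': "C' \<in> carrier_mat p (sdim D)"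
    and H: "matconv M G q (sdim D) H (\<lambda>r \<omega>. H')" and H': "H' \<in> carrier_mat q (sdim D)"
    and psd: "\<forall>\<^sub>F r in G. \<forall>\<omega>\<in>space M. \<forall>y\<in>carrier_vec (sdim D). 0 \<le> y \<bullet> (block_row (sdim D) (C r \<omega>) i *\<^sub>v y)"
    and psd': "\<And>y. y \<in> carrier_vec (sdim D) \<Longrightarrow> 0 \<le> y \<bullet> (block_row (sdim D) C' i *\<^sub>v y)"
  shows "matconv M G p q
    (\<lambda>r \<omega>. C r \<omega> * (H r \<omega>)\<^sup>T * minv (H r \<omega> * block_row (sdim D) (C r \<omega>) i * (H r \<omega>)\<^sup>T + aug_cov D i))
    (\<lambda>r \<omega>. C' * H'\<^sup>T * minv (H' * block_row (sdim D) C' i * H'\<^sup>T + aug_cov D i))"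
proof -
  have R: "sym_pd q (aug_cov D i)" using sym_pd_aug_cov[OF D i] q by simp
  then have Rc: "aug_cov D i \<in> carrier_mat q q" by (simp add: sym_pd_def)
  have br: "block_row (sdim D) A i \<in> carrier_mat (sdim D) (sdim D)" if "A \<in> carrier_mat p (sdim D)" for A
    using that by (simp add: block_row_def)
  have "matconv M G q q (\<lambda>r \<omega>. H r \<omega> * block_row (sdim D) (C r \<omega>) i * (H r \<omega>)\<^sup>T + aug_cov D i)
    (\<lambda>r \<omega>. H' * block_row (sdim D) C' i * H'\<^sup>T + aug_cov D i)"
    by (intro matconv_add matconv_const[OF Rc] matconv_mult[OF matconv_mult[OF H matconv_block_row[OF C]] matconv_transpose[OF H]])
      (simp add: p)
  then have "matconv M G q q (\<lambda>r \<omega>. minv (H r \<omega> * block_row (sdim D) (C r \<omega>) i * (H r \<omega>)\<^sup>T + aug_cov D i))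
    (\<lambda>r \<omega>. minv (H' * block_row (sdim D) C' i * H'\<^sup>T + aug_cov D i))"
  proof (rule matconv_minv[OF _ _ R])
    show "H' * block_row (sdim D) C' i * H'\<^sup>T + aug_cov D i \<in> carrier_mat q q"
      using Rc by simp
    show "x \<bullet> (aug_cov D i *\<^sub>v x) \<le> x \<bullet> ((H' * block_row (sdim D) C' i * H'\<^sup>T + aug_cov D i) *\<^sub>v x)"
      if "x \<in> carrier_vec q" for x
      by (rule congruence_dominates[OF H' br[OF C'] Rc psd' that])
    show "\<forall>\<^sub>F r in G. \<forall>\<omega>\<in>space M. \<forall>x\<in>carrier_vec q. x \<bullet> (aug_cov D i *\<^sub>v x)
      \<le> x \<bullet> ((H r \<omega> * block_row (sdim D) (C r \<omega>) i * (H r \<omega>)\<^sup>T + aug_cov D i) *\<^sub>v x)"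
      using psd matconv_carrier[OF C] matconv_carrier[OF H]
    proof eventually_elim
      case (elim r)
      show ?case
      proof (intro ballI)
        fix \<omega> and x :: rvec assume w: "\<omega> \<in> space M" and x: "x \<in> carrier_vec q"
        show "x \<bullet> (aug_cov D i *\<^sub>v x)
          \<le> x \<bullet> ((H r \<omega> * block_row (sdim D) (C r \<omega>) i * (H r \<omega>)\<^sup>T + aug_cov D i) *\<^sub>v x)"
          using elim w by (intro congruence_dominates[OF _ br Rc _ x]) auto
      qed
    qed
  qed
  then show ?thesis
    by (intro matconv_mult[OF matconv_mult[OF C matconv_transpose[OF H]]])
qed

text \<open>The gain is a function of the whole ensemble and correlated with the residual it
  multiplies, so convergence of their product rests on the moments of both.\<close>

lemma analysis_conv:
  assumes i: "i \<in> {1..steps D}"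
    and Z: "vconv M G (Suc (steps D) * sdim D) Z (\<lambda>r \<omega>. z)"
    and C: "matconv M G (Suc i * sdim D) (sdim D) C (\<lambda>r \<omega>. C')" and C': "C' \<in> carrier_mat (Suc i * sdim D) (sdim D)"
    and psd: "\<forall>\<^sub>F r in G. \<forall>\<omega>\<in>space M. \<forall>y\<in>carrier_vec (sdim D). 0 \<le> y \<bullet> (block_row (sdim D) (C r \<omega>) i *\<^sub>v y)"
    and psd': "\<And>y. y \<in> carrier_vec (sdim D) \<Longrightarrow> 0 \<le> y \<bullet> (block_row (sdim D) C' i *\<^sub>v y)"
    and W: "vconv M G (odim D i + sdim D) W W'" and X: "vconv M G (Suc i * sdim D) X X'"
  shows "vconv M G (Suc i * sdim D) (\<lambda>r \<omega>. analysis D (Z r \<omega>) i (C r \<omega>) (W r \<omega>) (X r \<omega>))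
    (\<lambda>r \<omega>. analysis D z i C' (W' r \<omega>) (X' r \<omega>))"
proof -
  have "Suc i * sdim D \<le> Suc (steps D) * sdim D" using i by (intro mult_le_mono1) auto
  note Zb = vconv_block[OF Z this]
  note ob = aug_obs_conv[OF i Zb block_carrier]
  have y: "obs_val D i \<in> carrier_vec (odim D i)" using D i by (simp add: valid_data_def)
  note K = gain_conv[OF i refl refl C C' ob(2) linearization_carrier(4)[OF i block_carrier] psd psd']
  show ?thesis
    unfolding analysis_def Let_def
    by (intro vconv_add X vconv_mult_mat_vec[OF K] vconv_diff W ob(1) vconv_append vconv_const[OF y] Zb
        vconv_mult_mat_vec[OF ob(2)] vconv_block[OF X] order_refl)
qed

text \<open>With a deterministic covariance the gain is one fixed matrix for all members, so the
  step maps affine families to affine families.\<close>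

lemma analysis_vaffine:
  assumes i: "i \<in> {1..steps D}" and C: "C \<in> carrier_mat (Suc i * sdim D) (sdim D)"
    and psd: "\<And>y. y \<in> carrier_vec (sdim D) \<Longrightarrow> 0 \<le> y \<bullet> (block_row (sdim D) C i *\<^sub>v y)"
    and W: "vaffine M \<Gamma> (odim D i + sdim D) W" and X: "vaffine M \<Gamma> (Suc i * sdim D) X"
  shows "vaffine M \<Gamma> (Suc i * sdim D) (\<lambda>n \<omega>. analysis D z i C (W n \<omega>) (X n \<omega>))"
proof -
  let ?q = "odim D i + sdim D" and ?H = "aug_jac D i (block (sdim D) z i)"
  have y: "obs_val D i \<in> carrier_vec (odim D i)" using D i by (simp add: valid_data_def)
  note lc = linearization_carrier[OF i block_carrier]
  have R: "sym_pd ?q (aug_cov D i)" by (rule sym_pd_aug_cov[OF D i])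
  then have Rc: "aug_cov D i \<in> carrier_mat ?q ?q" by (simp add: sym_pd_def)
  have br: "block_row (sdim D) C i \<in> carrier_mat (sdim D) (sdim D)" using C by (simp add: block_row_def)
  \<comment> \<open>The shape of \<open>minv\<close> is known for invertible matrices only, hence
    the appeal to domination.\<close>
  have inv: "minv (?H * block_row (sdim D) C i * ?H\<^sup>T + aug_cov D i) \<in> carrier_mat ?q ?q"
    using minv_dominating(2)[OF R _ congruence_dominates[OF lc(4) br Rc psd]] Rc by simp
  have gain: "C * ?H\<^sup>T * minv (?H * block_row (sdim D) C i * ?H\<^sup>T + aug_cov D i) \<in> carrier_mat (Suc i * sdim D) ?q"
    using C lc(4) inv by (intro mult_carrier_mat[of _ _ ?q] mult_carrier_mat[of _ _ "sdim D"]) auto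
  show ?thesis
    unfolding analysis_def Let_def
    by (intro vaffine_add X vaffine_mult_mat_vec[OF gain] vaffine_diff W vaffine_const[OF lc(3)]
        vaffine_append vaffine_const[OF y] vaffine_const[OF block_carrier]
        vaffine_mult_mat_vec[OF lc(4)] vaffine_block[OF X] order_refl)
qed

section \<open>Passes and iterations of the smoother\<close>

context
  fixes \<xi> :: "input \<Rightarrow> 'a \<Rightarrow> rvec"
  assumes ri: "random_inputs M D \<xi>"
begin

lemma vaffine_input:
  assumes "h \<in> streams D j" "1 \<le> j"
  shows "vaffine M (generators D \<xi> j) (input_dim D (h 1)) (\<lambda>n. \<xi> (h n))"
  unfolding vaffine_def
proof (intro conjI allI impI ballI)
  show "\<xi> (h n) \<omega> \<in> carrier_vec (input_dim D (h 1))" if "1 \<le> n" "\<omega> \<in> space M" for n \<omega>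
    by (rule random_inputs_carrier[OF ri assms that])
  show "affine_family M (generators D \<xi> j) (\<lambda>n \<omega>. \<xi> (h n) \<omega> $ a)" if "a < input_dim D (h 1)" for a
    using assms that by (intro affine_family.generator) (auto simp: generators_def)
qed

text \<open>The induction over time must carry both facts: convergence of the members alone says
  nothing about sample covariances, and affinity of the reference is what supplies the law of large
  numbers for the next one.\<close>

lemma enks_pass_conv:
  assumes j: "1 \<le> j" and S: "filterlim S at_top F"
    and Z: "vconv M F (Suc (steps D) * sdim D) Z (\<lambda>i \<omega>. z)"
    and i: "i \<le> steps D"
  shows "vconv M (ensemble_filter F S) (Suc i * sdim D)
      (\<lambda>r \<omega>. enks D (S (fst r)) (Z (fst r) \<omega>) (\<lambda>n. \<xi> (Init j n) \<omega>) (\<lambda>n i. \<xi> (Model j n i) \<omega>)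
        (\<lambda>n i. \<xi> (Obs j n i) \<omega>) i (snd r))
      (\<lambda>r. ref_pass M D z \<xi> j i (snd r)) \<and>
    vaffine M (generators D \<xi> j) (Suc i * sdim D) (ref_pass M D z \<xi> j i)"
  using i
proof (induction i)
  case 0
  have "vaffine M (generators D \<xi> j) (sdim D) (\<lambda>n. \<xi> (Init j n))"
    using vaffine_input[of "Init j" j] j by (simp add: streams_def)
  then show ?case
    using vconv_vaffine[OF lln_generator[OF ri j] lln_generator_mult[OF ri j]] by simp
next
  case (Suc i)
  let ?m = "sdim D" and ?G = "generators D \<xi> j" and ?E = "ensemble_filter F S"
  let ?p = "Suc (Suc i) * ?m"
  note lln = lln_generator[OF ri j] lln_generator_mult[OF ri j]
  define E where "E r \<omega> = enks D (S (fst r)) (Z (fst r) \<omega>) (\<lambda>n. \<xi> (Init j n) \<omega>) (\<lambda>n i. \<xi> (Model j n i) \<omega>)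
        (\<lambda>n i. \<xi> (Obs j n i) \<omega>) i (snd r)" for r \<omega>
  define X where "X r \<omega> = append_forecast D (Z (fst r) \<omega>) (Suc i) (\<xi> (Model j (snd r) (Suc i)) \<omega>) (E r \<omega>)" for r \<omega>
  define U where "U n \<omega> = append_forecast D z (Suc i) (\<xi> (Model j n (Suc i)) \<omega>) (ref_pass M D z \<xi> j i n \<omega>)" for n \<omega>
  define C where "C k \<omega> = sample_cov (S k) ?p ?m (\<lambda>n. X (k, n) \<omega>) (\<lambda>n. block ?m (X (k, n) \<omega>) (Suc i))" for k \<omega>
  define C' where "C' = cov_mat M ?p ?m (U 1) (\<lambda>\<omega>. block ?m (U 1 \<omega>) (Suc i))"
  have si: "Suc i \<in> {1..steps D}" using Suc.prems by simp
  have IH: "vconv M ?E (Suc i * ?m) E (\<lambda>r. ref_pass M D z \<xi> j i (snd r))"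
    "vaffine M ?G (Suc i * ?m) (ref_pass M D z \<xi> j i)"
    using Suc.IH Suc.prems unfolding E_def by auto
  have V: "vaffine M ?G ?m (\<lambda>n. \<xi> (Model j n (Suc i)))"
    using vaffine_input[of "\<lambda>n. Model j n (Suc i)" j] j si by (auto simp: streams_def)
  have W: "vaffine M ?G (odim D (Suc i) + ?m) (\<lambda>n. \<xi> (Obs j n (Suc i)))"
    using vaffine_input[of "\<lambda>n. Obs j n (Suc i)" j] j si by (auto simp: streams_def)
  have ZE: "vconv M ?E (Suc (steps D) * ?m) (\<lambda>r. Z (fst r)) (\<lambda>r \<omega>. z)"
    by (rule vconv_filterlim[OF Z filterlim_ensemble_fst])
  have X: "vconv M ?E ?p X (\<lambda>r. U (snd r))"
    unfolding X_def U_def by (rule append_forecast_conv[OF si ZE vconv_vaffine[OF lln V] IH(1)])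
  have U: "vaffine M ?G ?p U"
    unfolding U_def by (rule append_forecast_vaffine[OF si V IH(2)])
  have C: "matconv M F ?p ?m C (\<lambda>k \<omega>. C')"
    unfolding C_def C'_def
    by (rule matconv_sample_cov[OF lln X U vconv_block[OF X] vaffine_block[OF U] S]) simp_all
  \<comment> \<open>The covariance is shared by all members, so its convergence along
    \<open>F\<close> is uniform in the member.\<close>
  have CE: "matconv M ?E ?p ?m (\<lambda>r. C (fst r)) (\<lambda>r \<omega>. C')"
    by (rule matconv_filterlim[OF C filterlim_ensemble_fst])
  have C'c: "C' \<in> carrier_mat ?p ?m" by (simp add: C'_def cov_mat_def)
  have psd': "0 \<le> y \<bullet> (block_row ?m C' (Suc i) *\<^sub>v y)" if "y \<in> carrier_vec ?m" for y
    unfolding C'_def by (rule cov_mat_psd[OF order_refl that vaffine_moments[OF lln U]]) simp_all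
  \<comment> \<open>The divisor N - 1 of the sample covariance is positive from size 2 on, which
    growing sizes guarantee.\<close>
  have "\<forall>\<^sub>F k in F. 2 \<le> S k" using S by (simp add: filterlim_at_top)
  then have "\<forall>\<^sub>F k in F. \<forall>\<omega>\<in>space M. \<forall>y\<in>carrier_vec ?m. 0 \<le> y \<bullet> (block_row ?m (C k \<omega>) (Suc i) *\<^sub>v y)"
    unfolding C_def by eventually_elim (intro ballI sample_cov_psd order_refl)
  then have psd: "\<forall>\<^sub>F r in ?E. \<forall>\<omega>\<in>space M. \<forall>y\<in>carrier_vec ?m. 0 \<le> y \<bullet> (block_row ?m (C (fst r) \<omega>) (Suc i) *\<^sub>v y)"
    by (rule eventually_compose_filterlim[OF _ filterlim_ensemble_fst])
  have "vconv M ?E ?p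
      (\<lambda>r \<omega>. analysis D (Z (fst r) \<omega>) (Suc i) (C (fst r) \<omega>) (\<xi> (Obs j (snd r) (Suc i)) \<omega>) (X r \<omega>))
      (\<lambda>r \<omega>. analysis D z (Suc i) C' (\<xi> (Obs j (snd r) (Suc i)) \<omega>) (U (snd r) \<omega>))"
    by (rule analysis_conv[OF si ZE CE C'c psd psd' vconv_vaffine[OF lln W] X])
  moreover have "vaffine M ?G ?p (\<lambda>n \<omega>. analysis D z (Suc i) C' (\<xi> (Obs j n (Suc i)) \<omega>) (U n \<omega>))"
    by (rule analysis_vaffine[OF si C'c psd' W U])
  moreover have "ref_pass M D z \<xi> j (Suc i) = (\<lambda>n \<omega>. analysis D z (Suc i) C' (\<xi> (Obs j n (Suc i)) \<omega>) (U n \<omega>))"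
    by (simp add: Let_def C'_def U_def[abs_def])
  moreover have "(\<lambda>r \<omega>. enks D (S (fst r)) (Z (fst r) \<omega>) (\<lambda>n. \<xi> (Init j n) \<omega>) (\<lambda>n i. \<xi> (Model j n i) \<omega>)
        (\<lambda>n i. \<xi> (Obs j n i) \<omega>) (Suc i) (snd r))
    = (\<lambda>r \<omega>. analysis D (Z (fst r) \<omega>) (Suc i) (C (fst r) \<omega>) (\<xi> (Obs j (snd r) (Suc i)) \<omega>) (X r \<omega>))"
    by (simp add: Let_def C_def X_def E_def fun_eq_iff)
  ultimately show ?case by simp
qed

text \<open>Each pass relinearizes at the previous mean, which is random but has a deterministic
  limit, so the pass itself can be compared with the reference pass at that limit. The last
  conclusion is the hypothesis of the next step.\<close>

lemma lm_step:
  fixes F :: "(nat \<Rightarrow> nat) filter"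
  assumes S: "filterlim (\<lambda>N. N (Suc j)) at_top F"
    and Z: "vconv M F (Suc (steps D) * sdim D) (\<lambda>N. lm_mean D N \<xi> j)
      (\<lambda>N \<omega>. mean_vec M (Suc (steps D) * sdim D) (ref_member M D \<xi> j 1))"
  shows "vconv M (ensemble_filter F (\<lambda>N. N (Suc j))) (Suc (steps D) * sdim D)
      (\<lambda>r. lm_member D (fst r) \<xi> (Suc j) (snd r)) (\<lambda>r. ref_member M D \<xi> (Suc j) (snd r))"
    and "vaffine M (generators D \<xi> (Suc j)) (Suc (steps D) * sdim D) (ref_member M D \<xi> (Suc j))"
    and "vconv M F (Suc (steps D) * sdim D) (\<lambda>N. lm_mean D N \<xi> (Suc j))
      (\<lambda>N \<omega>. mean_vec M (Suc (steps D) * sdim D) (ref_member M D \<xi> (Suc j) 1))"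
proof -
  have j: "1 \<le> Suc j" by simp
  note pass = enks_pass_conv[OF j S Z order_refl]
  have "(\<lambda>r. lm_member D (fst r) \<xi> (Suc j) (snd r))
    = (\<lambda>r \<omega>. enks D (fst r (Suc j)) (lm_mean D (fst r) \<xi> j \<omega>) (\<lambda>n. \<xi> (Init (Suc j) n) \<omega>)
        (\<lambda>n i. \<xi> (Model (Suc j) n i) \<omega>) (\<lambda>n i. \<xi> (Obs (Suc j) n i) \<omega>) (steps D) (snd r))"
    by (simp add: lm_member_def enks_pass_def fun_eq_iff)
  then show m: "vconv M (ensemble_filter F (\<lambda>N. N (Suc j))) (Suc (steps D) * sdim D)
      (\<lambda>r. lm_member D (fst r) \<xi> (Suc j) (snd r)) (\<lambda>r. ref_member M D \<xi> (Suc j) (snd r))"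
    using pass by simp
  show a: "vaffine M (generators D \<xi> (Suc j)) (Suc (steps D) * sdim D) (ref_member M D \<xi> (Suc j))"
    using pass by simp
  have e: "(\<lambda>N \<omega>. sample_mean (N (Suc j)) (Suc (steps D) * sdim D) (\<lambda>n. lm_member D (fst (N, n)) \<xi> (Suc j) (snd (N, n)) \<omega>))
    = (\<lambda>N. lm_mean D N \<xi> (Suc j))"
    by (simp add: lm_member_def fun_eq_iff)
  show "vconv M F (Suc (steps D) * sdim D) (\<lambda>N. lm_mean D N \<xi> (Suc j))
      (\<lambda>N \<omega>. mean_vec M (Suc (steps D) * sdim D) (ref_member M D \<xi> (Suc j) 1))"
    using vconv_sample_mean[OF lln_generator[OF ri j] lln_generator_mult[OF ri j] m a S] unfolding e .
qed

text \<open>One filter is kept through all iterations: the sizes grow jointly along it, so no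
  iterated limits arise.\<close>

lemma lm_mean_conv:
  fixes F :: "(nat \<Rightarrow> nat) filter"
  assumes "\<And>l. l \<in> {1..j} \<Longrightarrow> filterlim (\<lambda>N. N l) at_top F"
  shows "vconv M F (Suc (steps D) * sdim D) (\<lambda>N. lm_mean D N \<xi> j)
      (\<lambda>N \<omega>. mean_vec M (Suc (steps D) * sdim D) (ref_member M D \<xi> j 1))"
  using assms
proof (induction j)
  case 0
  let ?p = "Suc (steps D) * sdim D"
  have c: "start D \<in> carrier_vec ?p" using D by (simp add: valid_data_def)
  \<comment> \<open>Total mass one makes the mean of the constant start the start itself.\<close>
  then have "mean_vec M ?p (\<lambda>\<omega>. start D) = start D"
    by (intro eq_vecI) (auto simp: mean_vec_def prob_space)
  then show ?case using vconv_const[OF c] by simp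
next
  case (Suc j)
  have "vconv M F (Suc (steps D) * sdim D) (\<lambda>N. lm_mean D N \<xi> j)
      (\<lambda>N \<omega>. mean_vec M (Suc (steps D) * sdim D) (ref_member M D \<xi> j 1))"
    by (rule Suc.IH) (rule Suc.prems, simp)
  then show ?case by (rule lm_step(3)[OF Suc.prems, rotated]) simp
qed

lemma lm_Lp_tendsto:
  assumes "1 \<le> j" "1 \<le> n" "1 \<le> p"
  shows "Lp_tendsto M p (Suc (steps D) * sdim D)
      (\<lambda>N. lm_member D N \<xi> j n) (ref_member M D \<xi> j n) (sizes_at_top j)"
    and "Lp_tendsto M p (Suc (steps D) * sdim D) (\<lambda>N. lm_mean D N \<xi> j)
      (\<lambda>\<omega>. mean_vec M (Suc (steps D) * sdim D) (ref_member M D \<xi> j 1)) (sizes_at_top j)"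
proof -
  \<comment> \<open>Members of pass j are linearized at the mean of pass j - 1, so convergence of
    the means is needed one index earlier.\<close>
  obtain i where j: "j = Suc i" using assms(1) by (cases j) auto
  have lim: "filterlim (\<lambda>N. N l) at_top (sizes_at_top j)" if "l \<in> {1..j}" for l
    by (rule filterlim_sizes_at_top[OF that])
  have S: "filterlim (\<lambda>N. N (Suc i)) at_top (sizes_at_top j)" by (rule lim) (simp add: j)
  have "vconv M (sizes_at_top j) (Suc (steps D) * sdim D) (\<lambda>N. lm_mean D N \<xi> i)
      (\<lambda>N \<omega>. mean_vec M (Suc (steps D) * sdim D) (ref_member M D \<xi> i 1))"
    by (rule lm_mean_conv) (rule lim, simp add: j)
  note step = lm_step[OF S this, folded j]
  \<comment> \<open>Pairing each size sequence with the fixed n extracts one member from the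
    statement that is uniform over the ensemble.\<close>
  have "vconv M (sizes_at_top j) (Suc (steps D) * sdim D) (\<lambda>N. lm_member D N \<xi> j n) (\<lambda>N. ref_member M D \<xi> j n)"
    using vconv_filterlim[OF step(1) filterlim_ensemble_member[OF S[folded j] assms(2)]] by simp
  then show "Lp_tendsto M p (Suc (steps D) * sdim D)
      (\<lambda>N. lm_member D N \<xi> j n) (ref_member M D \<xi> j n) (sizes_at_top j)"
    by (rule Lp_tendsto_vconv[OF _ vaffine_carrier[OF step(2) assms(2)] vaffine_moments[OF lln_generator[OF ri assms(1)]
          lln_generator_mult[OF ri assms(1)] step(2) _ assms(2)] assms(3)])
  show "Lp_tendsto M p (Suc (steps D) * sdim D) (\<lambda>N. lm_mean D N \<xi> j)
      (\<lambda>\<omega>. mean_vec M (Suc (steps D) * sdim D) (ref_member M D \<xi> j 1)) (sizes_at_top j)"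
    by (rule Lp_tendsto_vconv[OF step(3) _ all_moments_const assms(3)]) (simp add: mean_vec_def)
qed

end

end

end

theorem theorem6p9:
  fixes \<Omega> :: "'w measure" and D :: lm_data and \<xi> :: "input \<Rightarrow> 'w \<Rightarrow> rvec"
    and \<kappa> s p :: real and j n :: nat
  assumes "valid_data D"
    and "random_inputs \<Omega> D \<xi>"
    and "0 < \<kappa>" and "0 \<le> s" and "growth_bound D \<kappa> s"
    and "1 \<le> j" and "1 \<le> n" and "1 \<le> p"
  shows "Lp_tendsto \<Omega> p (Suc (steps D) * sdim D)
           (\<lambda>N. lm_member D N \<xi> j n) (ref_member \<Omega> D \<xi> j n) (sizes_at_top j) \<and>
         Lp_tendsto \<Omega> p (Suc (steps D) * sdim D)
           (\<lambda>N. lm_mean D N \<xi> j)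
           (\<lambda>\<omega>. mean_vec \<Omega> (Suc (steps D) * sdim D) (ref_member \<Omega> D \<xi> j 1)) (sizes_at_top j)"
proof -
  interpret prob_space \<Omega> using assms(2) by (simp add: random_inputs_def)
  show ?thesis
    using lm_Lp_tendsto[OF assms(1,3,4,5,2,6,7,8)] by blast
qed

end
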